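(* Let $a,b>0$ and $0<\epsilon_1<\epsilon_2<\epsilon_3<1$. Let $X=S^2(a)\times S^2(b)$, $M=\mathbb{D}^2(\frac a2)\times\mathbb{D}^2(\frac b2)\subset X$, and for $i=1,2,3$ let $D_i=\{(x,y)\in\mathbb{D}^2(\tfrac b2): -\epsilon_i\le y\le\epsilon_i\}$. Then there exists $\delta>0$ such that for every Hamiltonian diffeomorphism $g$ of $X$ compactly supported in $M$ with $d_{C^0}(g,\mathrm{id})<\delta$ there exists a Hamiltonian diffeomorphism $\psi\in\mathrm{Ham}(X)$, compactly supported in $\mathbb{D}^2(\frac a2)\times D_3$, that coincides with $g$ on $\mathbb{D}^2(\frac a2)\times D_1$.
   Context: For $c>0$, $S^{2}(c)$ is the 2-sphere with the area form $c\sigma$, where $\sigma$ is the standard area form of total area $1$. $\mathbb{D}^{2}(c)$ is the closed unit disk in $\mathbb{R}^2$ (coordinates $(x,y)$) with the area form $\frac{c}{\pi}\omega_0$ ($\omega_0$ standard), of total area $c$. The disk $\mathbb{D}^{2}(\frac{c}{2})$ is identified with the upper hemisphere of $S^{2}(c)$, so $M\subset X$. Products carry product symplectic forms $\omega$. Hamiltonian diffeomorphisms are time-one maps of flows of $X_{H_t}$, $\omega(X_{H_t},\cdot)=-dH_t$, with $H$ smooth, time-dependent, compactly supported. "Compactly supported in $Y$" means compactly supported in the interior of $Y$. The $C^0$-distance is $d_{C^0}(\phi,\psi)=\max_x d(\phi(x),\psi(x))$, with $d$ the distance of a fixed Riemannian metric. *)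

theory Defs
  imports "HOL-Analysis.Analysis"
begin

subsection \<open>Smooth maps on subsets of Euclidean spaces\<close>

fun Ck_on :: "nat \<Rightarrow> ('a::euclidean_space \<Rightarrow> 'b::real_normed_vector) \<Rightarrow> 'a set \<Rightarrow> bool" where
  "Ck_on 0 f U \<longleftrightarrow> continuous_on U f"
| "Ck_on (Suc k) f U \<longleftrightarrow>
     (\<forall>x\<in>U. f differentiable (at x)) \<and>
     (\<forall>v. Ck_on k (\<lambda>x. frechet_derivative f (at x) v) U)"

text \<open>\<open>Ck_on\<close> is meant for open \<open>U\<close> only. On an arbitrary set, smooth means: locally the
  restriction of a smooth map defined on an open set. On an embedded submanifold (possibly
  with boundary or corners) this is the intrinsic notion.\<close>

definition smooth_on :: "'a::euclidean_space set \<Rightarrow> ('a \<Rightarrow> 'b::real_normed_vector) \<Rightarrow> bool" where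
  "smooth_on S f \<longleftrightarrow>
     (\<forall>x\<in>S. \<exists>U F. open U \<and> x \<in> U \<and> (\<forall>k. Ck_on k F U) \<and> (\<forall>y\<in>S \<inter> U. F y = f y))"

subsection \<open>The symplectic manifold \<open>S\<^sup>2(a) \<times> S\<^sup>2(b)\<close>\<close>

type_synonym R3 = "real^3"

text \<open>As a smooth manifold \<open>S\<^sup>2(c)\<close> is the unit sphere for every \<open>c\<close>; only the area form
  depends on \<open>c\<close>.\<close>

definition S2 :: "R3 set" where
  "S2 = sphere 0 1"

definition S2_area_form :: "R3 \<Rightarrow> R3 \<Rightarrow> R3 \<Rightarrow> real" where
  "S2_area_form p u v = (p \<bullet> cross3 u v) / (4 * pi)"

definition S2_prod :: "(R3 \<times> R3) set" where
  "S2_prod = S2 \<times> S2"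

definition tangent_S2_prod :: "R3 \<times> R3 \<Rightarrow> (R3 \<times> R3) set" where
  "tangent_S2_prod x = {v. fst x \<bullet> fst v = 0 \<and> snd x \<bullet> snd v = 0}"

definition symp_form :: "real \<Rightarrow> real \<Rightarrow> R3 \<times> R3 \<Rightarrow> R3 \<times> R3 \<Rightarrow> R3 \<times> R3 \<Rightarrow> real" where
  "symp_form a b x v w =
     a * S2_area_form (fst x) (fst v) (fst w) + b * S2_area_form (snd x) (snd v) (snd w)"

subsection \<open>Hamiltonian diffeomorphisms\<close>

text \<open>A derivative within \<open>S2_prod\<close> is unique only on the tangent space, so it is compared only there:
  \<open>V\<close> is the value at \<open>x\<close> of the Hamiltonian vector field of \<open>h\<close>,
  \<open>\<omega>(V, \<cdot>) = - dh\<close>.\<close>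

definition is_ham_vector ::
    "real \<Rightarrow> real \<Rightarrow> (R3 \<times> R3 \<Rightarrow> real) \<Rightarrow> R3 \<times> R3 \<Rightarrow> R3 \<times> R3 \<Rightarrow> bool" where
  "is_ham_vector a b h x V \<longleftrightarrow>
     V \<in> tangent_S2_prod x \<and>
     (\<exists>dh. (h has_derivative dh) (at x within S2_prod) \<and>
           (\<forall>w\<in>tangent_S2_prod x. symp_form a b x V w = - dh w))"

definition is_ham_flow ::
    "real \<Rightarrow> real \<Rightarrow> (real \<Rightarrow> R3 \<times> R3 \<Rightarrow> real) \<Rightarrow> (real \<Rightarrow> R3 \<times> R3 \<Rightarrow> R3 \<times> R3) \<Rightarrow> bool" where
  "is_ham_flow a b H \<phi> \<longleftrightarrow>
     (\<forall>x\<in>S2_prod. \<phi> 0 x = x \<and>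
        (\<forall>t\<in>{0..1}. \<phi> t x \<in> S2_prod \<and>
           (\<exists>V. is_ham_vector a b (H t) (\<phi> t x) V \<and>
                ((\<lambda>s. \<phi> s x) has_vector_derivative V) (at t within {0..1}))))"

text \<open>Since \<open>S2_prod\<close> is compact, every Hamiltonian on \<open>[0,1] \<times> S2_prod\<close> is compactly supported.
  Maps of \<open>S2_prod\<close> are represented by functions on the ambient space whose values off \<open>S2_prod\<close> are
  irrelevant.\<close>

definition Ham :: "real \<Rightarrow> real \<Rightarrow> (R3 \<times> R3 \<Rightarrow> R3 \<times> R3) set" where
  "Ham a b = {g. \<exists>H \<phi>. smooth_on ({0..1} \<times> S2_prod) (\<lambda>(t, x). H t x) \<and>
                        is_ham_flow a b H \<phi> \<and> (\<forall>x\<in>S2_prod. g x = \<phi> 1 x)}"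

definition compactly_supported_in ::
    "(R3 \<times> R3 \<Rightarrow> R3 \<times> R3) \<Rightarrow> (R3 \<times> R3) set \<Rightarrow> bool" where
  "compactly_supported_in g Y \<longleftrightarrow>
     compact (closure {x\<in>S2_prod. g x \<noteq> x}) \<and>
     closure {x\<in>S2_prod. g x \<noteq> x} \<subseteq> (top_of_set S2_prod) interior_of Y"

subsection \<open>The \<open>C\<^sup>0\<close>-distance of a Riemannian metric\<close>

definition riemannian_metric :: "(R3 \<times> R3 \<Rightarrow> R3 \<times> R3 \<Rightarrow> R3 \<times> R3 \<Rightarrow> real) \<Rightarrow> bool" where
  "riemannian_metric G \<longleftrightarrow>
     (\<forall>x\<in>S2_prod. \<forall>u\<in>tangent_S2_prod x. \<forall>v\<in>tangent_S2_prod x. G x u v = G x v u) \<and>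
     (\<forall>x\<in>S2_prod. \<forall>u\<in>tangent_S2_prod x. \<forall>v\<in>tangent_S2_prod x. \<forall>w\<in>tangent_S2_prod x. \<forall>r s.
        G x (r *\<^sub>R u + s *\<^sub>R v) w = r * G x u w + s * G x v w) \<and>
     (\<forall>x\<in>S2_prod. \<forall>u\<in>tangent_S2_prod x. u \<noteq> 0 \<longrightarrow> 0 < G x u u) \<and>
     (\<forall>U V. smooth_on S2_prod U \<and> smooth_on S2_prod V \<and> (\<forall>x\<in>S2_prod. U x \<in> tangent_S2_prod x \<and> V x \<in> tangent_S2_prod x)
        \<longrightarrow> smooth_on S2_prod (\<lambda>x. G x (U x) (V x)))"

definition riemannian_length ::
    "(R3 \<times> R3 \<Rightarrow> R3 \<times> R3 \<Rightarrow> R3 \<times> R3 \<Rightarrow> real) \<Rightarrow> (real \<Rightarrow> R3 \<times> R3) \<Rightarrow> real" where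
  "riemannian_length G \<gamma> =
     integral {0..1}
       (\<lambda>t. sqrt (G (\<gamma> t) (vector_derivative \<gamma> (at t)) (vector_derivative \<gamma> (at t))))"

text \<open>The infimum over \<open>C\<^sup>1\<close> curves is the usual one, since a piecewise \<open>C\<^sup>1\<close> curve becomes
  \<open>C\<^sup>1\<close> when reparametrised so as to stop at its corners. The predicate
  \<open>piecewise_C1_differentiable_on\<close> would be wrong here: it allows unbounded speed near the
  exceptional points, hence curves of infinite length, whose \<open>integral\<close> is 0.\<close>

definition riemannian_dist ::
    "(R3 \<times> R3 \<Rightarrow> R3 \<times> R3 \<Rightarrow> R3 \<times> R3 \<Rightarrow> real) \<Rightarrow> R3 \<times> R3 \<Rightarrow> R3 \<times> R3 \<Rightarrow> real" where
  "riemannian_dist G x y =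
     Inf {riemannian_length G \<gamma> | \<gamma>. \<gamma> C1_differentiable_on {0..1} \<and>
            path_image \<gamma> \<subseteq> S2_prod \<and> pathstart \<gamma> = x \<and> pathfinish \<gamma> = y}"

text \<open>For continuous maps the supremum is a maximum, as \<open>S2_prod\<close> is compact.\<close>

definition C0_dist ::
    "(R3 \<times> R3 \<Rightarrow> R3 \<times> R3 \<Rightarrow> R3 \<times> R3 \<Rightarrow> real) \<Rightarrow>
     (R3 \<times> R3 \<Rightarrow> R3 \<times> R3) \<Rightarrow> (R3 \<times> R3 \<Rightarrow> R3 \<times> R3) \<Rightarrow> real" where
  "C0_dist G f g = (SUP x\<in>S2_prod. riemannian_dist G (f x) (g x))"

subsection \<open>The disk as the upper hemisphere\<close>

definition D2 :: "(real \<times> real) set" where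
  "D2 = cball 0 1"

definition D2_area_form :: "real \<Rightarrow> real \<times> real \<Rightarrow> real \<times> real \<Rightarrow> real" where
  "D2_area_form c u v = c / pi * (fst u * snd v - snd u * fst v)"

text \<open>The identification of \<open>D\<^sup>2(c/2)\<close> with the upper hemisphere of \<open>S\<^sup>2(c)\<close> is the rotationally
  symmetric one (Lambert's equal-area projection, rescaled). It does not depend on \<open>c\<close>; that it
  is a bijection onto the upper hemisphere and area preserving is shown below.\<close>

definition hemi :: "real \<times> real \<Rightarrow> R3" where
  "hemi = (\<lambda>(x, y). vector [x * sqrt (2 - x\<^sup>2 - y\<^sup>2), y * sqrt (2 - x\<^sup>2 - y\<^sup>2), 1 - x\<^sup>2 - y\<^sup>2])"

definition D2_strip :: "real \<Rightarrow> (real \<times> real) set" where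
  "D2_strip \<epsilon> = {(x, y) \<in> D2. - \<epsilon> \<le> y \<and> y \<le> \<epsilon>}"

definition hemi_prod :: "(real \<times> real) set \<Rightarrow> (real \<times> real) set \<Rightarrow> (R3 \<times> R3) set" where
  "hemi_prod A B = (hemi ` A) \<times> (hemi ` B)"

lemma mem_D2: "(x, y) \<in> D2 \<longleftrightarrow> x\<^sup>2 + y\<^sup>2 \<le> 1"
  by (simp add: D2_def norm_Pair)

lemma bij_betw_hemi: "bij_betw hemi D2 {p \<in> S2. 0 \<le> p $ 3}"
proof (rule bij_betw_byWitness)
  let ?g = "\<lambda>p::R3. (p $ 1 / sqrt (1 + p $ 3), p $ 2 / sqrt (1 + p $ 3))"
  have S2: "p \<in> S2 \<longleftrightarrow> (p$1)\<^sup>2 + (p$2)\<^sup>2 + (p$3)\<^sup>2 = 1" for p :: R3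
    by (simp add: S2_def norm_vec_def L2_set_def sum_3)
  have pos: "0 < sqrt (2 - x\<^sup>2 - y\<^sup>2)" if "(x, y) \<in> D2" for x y
    using that by (simp add: mem_D2)
  show "\<forall>q\<in>D2. ?g (hemi q) = q"
  proof
    fix q assume q: "q \<in> D2"
    obtain x y where [simp]: "q = (x, y)" by force
    define s where "s = sqrt (2 - x\<^sup>2 - y\<^sup>2)"
    have "hemi q $ 1 = x * s" "hemi q $ 2 = y * s" "sqrt (1 + hemi q $ 3) = s"
      by (simp_all add: hemi_def s_def diff_diff_eq)
    moreover have "0 < s" using pos q by (simp add: s_def)
    ultimately show "?g (hemi q) = q" by simp
  qed
  have eq: "1 - (p$1)\<^sup>2 / (1 + p$3) - (p$2)\<^sup>2 / (1 + p$3) = p$3"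
    if "p \<in> S2" "0 \<le> p$3" for p :: R3
  proof -
    have "(p$1)\<^sup>2 + (p$2)\<^sup>2 = (1 - p$3) * (1 + p$3)"
      using that by (simp add: S2 power2_eq_square algebra_simps)
    then have "(p$1)\<^sup>2 / (1 + p$3) + (p$2)\<^sup>2 / (1 + p$3) = 1 - p$3"
      using that by (simp add: add_divide_distrib [symmetric])
    then show ?thesis by linarith
  qed
  show "\<forall>p\<in>{p \<in> S2. 0 \<le> p $ 3}. hemi (?g p) = p"
  proof
    fix p assume "p \<in> {p \<in> S2. 0 \<le> p $ 3}"
    then have p: "p \<in> S2" "0 \<le> p$3" by auto
    have 2: "2 - (p$1)\<^sup>2 / (1 + p$3) - (p$2)\<^sup>2 / (1 + p$3) = 1 + p$3"
      using eq[OF p] by linarith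
    then show "hemi (?g p) = p"
      using p eq[OF p] by (simp add: hemi_def vec_eq_iff forall_3 power_divide 2)
  qed
  show "hemi ` D2 \<subseteq> {p \<in> S2. 0 \<le> p $ 3}"
  proof
    fix p assume "p \<in> hemi ` D2"
    then obtain x y where q: "(x, y) \<in> D2" "p = hemi (x, y)" by auto
    have "(sqrt (2 - x\<^sup>2 - y\<^sup>2))\<^sup>2 = 2 - x\<^sup>2 - y\<^sup>2" using q(1) by (simp add: mem_D2)
    then show "p \<in> {p \<in> S2. 0 \<le> p $ 3}"
      using q by (simp add: S2 hemi_def mem_D2 power_mult_distrib) (simp add: power2_eq_square algebra_simps)
  qed
  show "?g ` {p \<in> S2. 0 \<le> p $ 3} \<subseteq> D2"
  proof
    fix q assume "q \<in> ?g ` {p \<in> S2. 0 \<le> p $ 3}"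
    then obtain p where p: "p \<in> S2" "0 \<le> p$3" "q = ?g p" by auto
    show "q \<in> D2" using eq[OF p(1,2)] p by (simp add: mem_D2 power_divide)
  qed
qed

lemma hemi_area_preserving:
  assumes "q \<in> D2"
  obtains dhemi where "(hemi has_derivative dhemi) (at q)"
    and "\<And>u v. c * S2_area_form (hemi q) (dhemi u) (dhemi v) = D2_area_form (c / 2) u v"
proof -
  obtain x y where q: "q = (x, y)" by force
  define r where "r = (\<lambda>p::real\<times>real. sqrt (2 - (fst p)\<^sup>2 - (snd p)\<^sup>2))"
  define s where "s = sqrt (2 - x\<^sup>2 - y\<^sup>2)"
  have pos: "0 < 2 - x\<^sup>2 - y\<^sup>2" using assms by (simp add: q mem_D2)
  then have s: "0 < s" "s\<^sup>2 = 2 - x\<^sup>2 - y\<^sup>2" by (simp_all add: s_def)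
  have hemi: "hemi = (\<lambda>p. (fst p * r p) *\<^sub>R axis 1 1 + (snd p * r p) *\<^sub>R axis 2 1
      + (1 - (fst p)\<^sup>2 - (snd p)\<^sup>2) *\<^sub>R axis 3 1)"
    by (auto simp: fun_eq_iff hemi_def r_def vec_eq_iff forall_3 axis_def)
  define dr where "dr = (\<lambda>u::real\<times>real. - (x * fst u + y * snd u) / s)"
  have dr: "(r has_derivative dr) (at q)"
    unfolding r_def dr_def using pos
    by (auto intro!: derivative_eq_intros simp: q s_def fun_eq_iff field_simps)
  define dh where "dh = (\<lambda>u::real\<times>real. (fst u * s + x * dr u) *\<^sub>R axis 1 1
     + (snd u * s + y * dr u) *\<^sub>R axis 2 1 + (- 2 * x * fst u - 2 * y * snd u) *\<^sub>R axis 3 (1::real) :: R3)"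
  have "r q = s" by (simp add: q r_def s_def)
  then have "(hemi has_derivative dh) (at q)"
    unfolding hemi dh_def
    by (auto intro!: derivative_eq_intros dr[unfolded q] simp: q fun_eq_iff algebra_simps)
  moreover have "c * S2_area_form (hemi q) (dh u) (dh v) = D2_area_form (c / 2) u v" for u v
  proof -
    obtain u1 u2 v1 v2 where uv: "u = (u1, u2)" "v = (v1, v2)" by force
    have "hemi q \<bullet> cross3 (dh u) (dh v) = 2 * (u1 * v2 - u2 * v1)"
    proof -
      have du: "s * dr u = - (x * u1 + y * u2)" and dv: "s * dr v = - (x * v1 + y * v2)"
        using s by (simp_all add: dr_def uv)
      have "hemi q \<bullet> cross3 (dh u) (dh v) =
         x * s * ((u2 * s + y * dr u) * (- 2 * x * v1 - 2 * y * v2) - (- 2 * x * u1 - 2 * y * u2) * (v2 * s + y * dr v))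
       + y * s * ((- 2 * x * u1 - 2 * y * u2) * (v1 * s + x * dr v) - (u1 * s + x * dr u) * (- 2 * x * v1 - 2 * y * v2))
       + (1 - x\<^sup>2 - y\<^sup>2) * ((u1 * s + x * dr u) * (v2 * s + y * dr v) - (u2 * s + y * dr u) * (v1 * s + x * dr v))"
        by (simp add: hemi_def q s_def dh_def uv inner_vec_def sum_3 cross3_def axis_def)
      also have "\<dots> = 2 * (u1 * v2 - u2 * v1)"
        using du dv s(2) by algebra
      finally show ?thesis .
    qed
    moreover have "c * (2 * k / (4 * pi)) = c / 2 / pi * k" for k by simp
    ultimately show ?thesis by (simp only: S2_area_form_def D2_area_form_def uv fst_conv snd_conv)
  qed
  ultimately show thesis by (rule that)
qed

end

theory Submission
  imports Defs
begin

text \<open>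
  Cutting off along one wall suffices, since the two walls of the strip can be treated in turn. So let
  \<open>f\<close> be a symplectic diffeomorphism of \<open>\<real>\<^sup>4\<close> supported in the bidisk that does not move points below
  the level \<open>e2\<close> to the level \<open>e3\<close> or above; this is all that remains of the smallness of \<open>g\<close>. Let
  \<open>\<lambda>\<close> be the primitive of \<open>\<omega>\<close> dual to the expanding Liouville field \<open>(p - c) / 2\<close> whose centre \<open>c\<close>
  lies at level \<open>e2\<close>, and let \<open>h\<close> be the compactly supported function with \<open>dh = \<lambda> - f\<^sup>*\<lambda>\<close>. Multiplying
  \<open>h\<close> by a function of the level that is 0 below \<open>e1\<close> and 1 above \<open>e2\<close>, we obtain \<open>F\<close>, and the field
  \<open>Y = (p - c) / 2 + X\<^sub>F\<close> is the Liouville field below \<open>e1\<close>, but its pull-back by \<open>f\<close> where \<open>f\<close> takes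
  values above \<open>e3\<close>. With \<open>\<eta>\<^sub>s\<close> and \<open>\<theta>\<^sub>s\<close> the flows of the Liouville field and of \<open>Y\<close>, the symplectic
  isotopy \<open>\<eta>\<^sub>-\<^sub>s \<circ> \<theta>\<^sub>s\<close> is generated by the explicit Hamiltonian \<open>e\<^sup>-\<^sup>s F \<circ> \<eta>\<^sub>s\<close>. It is the identity below
  \<open>e1\<close>, and for large \<open>s\<close> it equals \<open>f\<close> where \<open>f\<close> takes values above \<open>e3\<close>, because \<open>\<eta>\<^sub>s\<close> moves these
  values out of the support of \<open>f\<close>. Composing \<open>f\<close> with the inverse of its end point cuts \<open>f\<close> off, and
  stays Hamiltonian without any appeal to pseudoholomorphic curves.
\<close>

section \<open>Parametrised \<open>C\<^sup>k\<close> calculus\<close>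

text \<open>The obstacle is that \<open>g\<close> is close to the identity while the isotopy
  generating it need not be: its trajectories may cross the strip and return, so cutting off the
  given Hamiltonian gives no control over the end point. The isotopy used instead depends on
  \<open>f\<close> alone. It is a symplectic Alexander trick, in which conjugation with dilations
  contracts the support of \<open>f\<close> towards \<open>c\<close>. Dilations multiply \<omega> by
  a constant, so all conjugates are symplectic, and \<open>h\<close> is read off from
  \<open>f\<close> without any isotopy. The level \<open>e2\<close> of the centre serves both ends
  at once. An expansion lowers the levels below \<open>e2\<close> and raises those above it: a point
  below \<open>e1\<close> never meets the cut-off field, and a point above \<open>e3\<close> stays
  above \<open>e3\<close>, where its preimage under \<open>f\<close> lies above \<open>e2\<close>
  and the cut-off has no effect. Smallness is thus a condition on levels alone, without bounds on
  derivatives. The map cut along the first wall need not be close to the identity, so for the second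
  wall this condition has to be recovered from \<open>g\<close>.\<close>

text \<open>The parameter \<open>t\<close>, usually the time, enters only continuously, so that Hamiltonians need no smooth
  extension beyond \<open>0 \<le> t \<le> 1\<close>.\<close>

fun pCk :: "nat \<Rightarrow> ('t::topological_space \<Rightarrow> 'a::euclidean_space \<Rightarrow> 'b::real_normed_vector) \<Rightarrow> ('t \<times> 'a) set \<Rightarrow> bool" where
  "pCk 0 f W \<longleftrightarrow> continuous_on W (\<lambda>z. f (fst z) (snd z))"
| "pCk (Suc k) f W \<longleftrightarrow> continuous_on W (\<lambda>z. f (fst z) (snd z)) \<and>
     (\<forall>z\<in>W. f (fst z) differentiable (at (snd z))) \<and>
     (\<forall>v. pCk k (\<lambda>t x. frechet_derivative (f t) (at x) v) W)"

text \<open>Openness is asked of each slice only, since derivatives are taken in \<open>x\<close>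
  alone: \<open>{0..1} \<times> U\<close> with \<open>U\<close> open qualifies although it is not
  open.\<close>

definition open_slices :: "('t \<times> 'a::topological_space) set \<Rightarrow> bool" where
  "open_slices W \<longleftrightarrow> (\<forall>t. open {x. (t, x) \<in> W})"

lemma open_slices_Times:
  assumes "open U" shows "open_slices (T \<times> U)"
proof -
  have "{x. t \<in> T \<and> x \<in> U} = (if t \<in> T then U else {})" for t by auto
  then show ?thesis using assms by (simp add: open_slices_def)
qed

lemma open_slices_Int_open:
  fixes W :: "('t::topological_space \<times> 'a::topological_space) set"
  assumes "open_slices W" "open S"
  shows "open_slices (W \<inter> S)"
proof -
  have "open {x. (t, x) \<in> S}" for t
  proof -
    have "{x. (t, x) \<in> S} = Pair t -` S" by auto
    then show ?thesis using assms(2) by (auto intro!: open_vimage continuous_intros)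
  qed
  then show ?thesis using assms(1) by (auto simp: open_slices_def Collect_conj_eq)
qed

lemma pCk_continuous: "pCk k f W \<Longrightarrow> continuous_on W (\<lambda>z. f (fst z) (snd z))"
  by (cases k) auto

lemma pCk_subset: "pCk k f W \<Longrightarrow> V \<subseteq> W \<Longrightarrow> pCk k f V"
  by (induction k arbitrary: f) (auto intro: continuous_on_subset)

lemma pCk_Suc_imp: "pCk (Suc k) f W \<Longrightarrow> pCk k f W"
  proof (induction k arbitrary: f)
  case (Suc k)
  have "pCk k (\<lambda>t x. frechet_derivative (f t) (at x) v) W" for v
    by (rule Suc.IH) (use Suc.prems in \<open>subst (asm) pCk.simps(2), blast\<close>)
  then show ?case using Suc.prems unfolding pCk.simps(2) by blast
qed simp

lemma pCk_mono: "pCk k f W \<Longrightarrow> j \<le> k \<Longrightarrow> pCk j f W"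
  by (induction k) (auto simp del: pCk.simps simp: le_Suc_eq dest: pCk_Suc_imp)

lemma frechet_derivative_cong_slices:
  assumes "open_slices W" "(t, x) \<in> W" "\<And>t x. (t, x) \<in> W \<Longrightarrow> f t x = g t x"
  shows "frechet_derivative (f t) (at x) = frechet_derivative (g t) (at x)"
    and "f t differentiable (at x) \<longleftrightarrow> g t differentiable (at x)"
proof -
  have o: "open {y. (t, y) \<in> W}" using assms(1) by (auto simp: open_slices_def)
  have "(f t has_derivative D) (at x) \<longleftrightarrow> (g t has_derivative D) (at x)" for D
    using has_derivative_transform_within_open[OF _ o, of "f t" D x UNIV "g t"]
      has_derivative_transform_within_open[OF _ o, of "g t" D x UNIV "f t"] assms(2,3)
    by auto
  then show "frechet_derivative (f t) (at x) = frechet_derivative (g t) (at x)"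
    and "f t differentiable (at x) \<longleftrightarrow> g t differentiable (at x)"
    by (simp_all add: frechet_derivative_def differentiable_def)
qed

lemma pCk_cong:
  assumes "open_slices W" "\<And>t x. (t, x) \<in> W \<Longrightarrow> f t x = g t x" "pCk k f W"
  shows "pCk k g W"
  using assms(2,3)
proof (induction k arbitrary: f g)
  case 0
  then show ?case by (auto intro: continuous_on_eq)
next
  case (Suc k)
  have 1: "continuous_on W (\<lambda>z. g (fst z) (snd z))"
    using Suc.prems by (auto intro: continuous_on_eq)
  have 2: "g (fst z) differentiable (at (snd z))" if "z \<in> W" for z
    using frechet_derivative_cong_slices(2)[OF assms(1), of "fst z" "snd z" f g] that Suc.prems by auto
  have "pCk k (\<lambda>t x. frechet_derivative (g t) (at x) v) W" for v
    by (rule Suc.IH[of "\<lambda>t x. frechet_derivative (f t) (at x) v"])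
       (use frechet_derivative_cong_slices(1)[OF assms(1), of _ _ f g] Suc.prems in auto)
  with 1 2 show ?case by simp
qed

text \<open>The derivative may be given by any formula \<open>D\<close>: it agrees with
  \<open>frechet_derivative\<close> on open slices, and that is all the recursion in
  \<open>pCk\<close> sees.\<close>

lemma pCk_SucI:
  assumes "open_slices W" "continuous_on W (\<lambda>z. f (fst z) (snd z))"
    and "\<And>t x. (t, x) \<in> W \<Longrightarrow> (f t has_derivative D t x) (at x)"
    and "\<And>v. pCk k (\<lambda>t x. D t x v) W"
  shows "pCk (Suc k) f W"
proof -
  have *: "D t x = frechet_derivative (f t) (at x)" if "(t, x) \<in> W" for t x
    using assms(3)[OF that] by (rule frechet_derivative_at)
  have "pCk k (\<lambda>t x. frechet_derivative (f t) (at x) v) W" for v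
    by (rule pCk_cong[OF assms(1) _ assms(4)[of v]]) (simp add: *)
  then show ?thesis using assms(2,3) by (force simp: differentiable_def)
qed

lemma pCk_has_derivative:
  assumes "pCk (Suc k) f W" "(t, x) \<in> W"
  shows "(f t has_derivative frechet_derivative (f t) (at x)) (at x)"
  using assms by (auto simp: frechet_derivative_works[symmetric])

lemma pCk_SucD: "pCk (Suc k) f W \<Longrightarrow> pCk k (\<lambda>t x. frechet_derivative (f t) (at x) v) W"
  by simp

lemma pCk_of_t: "open_slices W \<Longrightarrow> continuous_on (fst ` W) c \<Longrightarrow> pCk k (\<lambda>t x. c t) W"
proof (induction k arbitrary: c)
  case 0
  have "continuous_on W (\<lambda>z. c (fst z))"
    by (rule continuous_on_compose2[OF 0(2)]) (auto intro!: continuous_intros)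
  then show ?case by simp
next
  case (Suc k)
  have "continuous_on W (\<lambda>z. c (fst z))"
    by (rule continuous_on_compose2[OF Suc(3)]) (auto intro!: continuous_intros)
  then show ?case
    by (intro pCk_SucI[where D = "\<lambda>t x v. 0"]) (use Suc in auto)
qed

lemma pCk_const: "open_slices W \<Longrightarrow> pCk k (\<lambda>t x. c) W"
  by (rule pCk_of_t) auto

lemma pCk_linear:
  assumes "open_slices W" "bounded_linear h" "pCk k f W"
  shows "pCk k (\<lambda>t x. h (f t x)) W"
  using assms(3)
proof (induction k arbitrary: f)
  case 0
  then show ?case
    unfolding pCk.simps by (rule bounded_linear.continuous_on[OF assms(2)])
next
  case (Suc k)
  show ?case
  proof (rule pCk_SucI[where D = "\<lambda>t x v. h (frechet_derivative (f t) (at x) v)"])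
    show "continuous_on W (\<lambda>z. h (f (fst z) (snd z)))"
      by (rule bounded_linear.continuous_on[OF assms(2) pCk_continuous[OF Suc.prems]])
    show "((\<lambda>x. h (f t x)) has_derivative (\<lambda>v. h (frechet_derivative (f t) (at x) v))) (at x)"
      if "(t, x) \<in> W" for t x
      by (rule bounded_linear.has_derivative[OF assms(2) pCk_has_derivative[OF Suc.prems that]])
    show "pCk k (\<lambda>t x. h (frechet_derivative (f t) (at x) v)) W" for v
      by (rule Suc.IH) (use Suc.prems in simp)
  qed (rule assms)
qed

lemma pCk_add:
  assumes "open_slices W" "pCk k f W" "pCk k g W"
  shows "pCk k (\<lambda>t x. f t x + g t x) W"
  using assms(2,3)
proof (induction k arbitrary: f g)
  case 0
  then show ?case by (auto intro!: continuous_intros)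
next
  case (Suc k)
  show ?case
  proof (rule pCk_SucI[where D = "\<lambda>t x v. frechet_derivative (f t) (at x) v + frechet_derivative (g t) (at x) v"])
    show "continuous_on W (\<lambda>z. f (fst z) (snd z) + g (fst z) (snd z))"
      using Suc.prems by (auto intro!: continuous_intros)
    show "((\<lambda>x. f t x + g t x) has_derivative (\<lambda>v. frechet_derivative (f t) (at x) v + frechet_derivative (g t) (at x) v)) (at x)"
      if "(t, x) \<in> W" for t x
      by (intro has_derivative_add pCk_has_derivative[OF Suc.prems(1) that] pCk_has_derivative[OF Suc.prems(2) that])
    show "pCk k (\<lambda>t x. frechet_derivative (f t) (at x) v + frechet_derivative (g t) (at x) v) W" for v
      by (rule Suc.IH) (use Suc.prems in simp_all)
  qed (rule assms)
qed

lemma pCk_sum: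
  assumes "open_slices W" "\<And>i. i \<in> A \<Longrightarrow> pCk k (f i) W"
  shows "pCk k (\<lambda>t x. \<Sum>i\<in>A. f i t x) W"
  using assms(2)
  by (induction A rule: infinite_finite_induct) (auto intro!: pCk_add pCk_const assms(1))

lemma pCk_minus: "open_slices W \<Longrightarrow> pCk k f W \<Longrightarrow> pCk k (\<lambda>t x. - f t x) W"
  by (rule pCk_linear[of _ uminus]) (auto intro: bounded_linear_minus[OF bounded_linear_ident])

lemma pCk_diff: "open_slices W \<Longrightarrow> pCk k f W \<Longrightarrow> pCk k g W \<Longrightarrow> pCk k (\<lambda>t x. f t x - g t x) W"
  using pCk_add[OF _ _ pCk_minus[of W k g], of f] by simp

lemma pCk_bilinear:
  assumes "open_slices W" "bounded_bilinear h" "pCk k f W" "pCk k g W"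
  shows "pCk k (\<lambda>t x. h (f t x) (g t x)) W"
  using assms(3,4)
proof (induction k arbitrary: f g)
  case 0
  then show ?case unfolding pCk.simps by (rule bounded_bilinear.continuous_on[OF assms(2)])
next
  case (Suc k)
  show ?case
  proof (rule pCk_SucI[where D = "\<lambda>t x v. h (f t x) (frechet_derivative (g t) (at x) v) + h (frechet_derivative (f t) (at x) v) (g t x)"])
    show "continuous_on W (\<lambda>z. h (f (fst z) (snd z)) (g (fst z) (snd z)))"
      by (rule bounded_bilinear.continuous_on[OF assms(2) pCk_continuous[OF Suc.prems(1)] pCk_continuous[OF Suc.prems(2)]])
    show "((\<lambda>x. h (f t x) (g t x)) has_derivative (\<lambda>v. h (f t x) (frechet_derivative (g t) (at x) v) + h (frechet_derivative (f t) (at x) v) (g t x))) (at x)"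
      if "(t, x) \<in> W" for t x
      by (rule bounded_bilinear.FDERIV[OF assms(2) pCk_has_derivative[OF Suc.prems(1) that] pCk_has_derivative[OF Suc.prems(2) that]])
    show "pCk k (\<lambda>t x. h (f t x) (frechet_derivative (g t) (at x) v) + h (frechet_derivative (f t) (at x) v) (g t x)) W" for v
      by (intro pCk_add Suc.IH assms) (use Suc.prems pCk_Suc_imp in auto)
  qed (rule assms)
qed

lemma pCk_scaleR: "open_slices W \<Longrightarrow> pCk k f W \<Longrightarrow> pCk k g W \<Longrightarrow> pCk k (\<lambda>t x. f t x *\<^sub>R g t x) W"
  by (rule pCk_bilinear[OF _ bounded_bilinear_scaleR])

lemma pCk_mult:
  fixes f g :: "'t::topological_space \<Rightarrow> 'a::euclidean_space \<Rightarrow> real"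
  shows "open_slices W \<Longrightarrow> pCk k f W \<Longrightarrow> pCk k g W \<Longrightarrow> pCk k (\<lambda>t x. f t x * g t x) W"
  by (rule pCk_bilinear[OF _ bounded_bilinear_mult])

lemma pCk_inner:
  fixes f g :: "'t::topological_space \<Rightarrow> 'a::euclidean_space \<Rightarrow> 'b::euclidean_space"
  shows "open_slices W \<Longrightarrow> pCk k f W \<Longrightarrow> pCk k g W \<Longrightarrow> pCk k (\<lambda>t x. f t x \<bullet> g t x) W"
  by (rule pCk_bilinear[OF _ bounded_bilinear_inner])

lemma pCk_fst: "open_slices W \<Longrightarrow> pCk k f W \<Longrightarrow> pCk k (\<lambda>t x. fst (f t x)) W"
  by (rule pCk_linear[OF _ bounded_linear_fst])

lemma pCk_snd: "open_slices W \<Longrightarrow> pCk k f W \<Longrightarrow> pCk k (\<lambda>t x. snd (f t x)) W"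
  by (rule pCk_linear[OF _ bounded_linear_snd])

lemma pCk_Pair:
  assumes "open_slices W" "pCk k f W" "pCk k g W"
  shows "pCk k (\<lambda>t x. (f t x, g t x)) W"
proof -
  have "pCk k (\<lambda>t x. (f t x, 0) + (0, g t x)) W"
    by (intro pCk_add pCk_linear[of _ "\<lambda>y. (y, 0)"] pCk_linear[of _ "\<lambda>y. (0, y)"] assms
        bounded_linear_Pair bounded_linear_ident bounded_linear_zero)
  then show ?thesis by simp
qed

lemma pCk_ident: "open_slices W \<Longrightarrow> pCk k (\<lambda>t x. x) W"
proof (cases k)
  case (Suc j)
  show "open_slices W \<Longrightarrow> ?thesis" unfolding Suc
    by (rule pCk_SucI[where D = "\<lambda>t x v. v"]) (auto intro!: continuous_intros pCk_const)
qed (auto intro!: continuous_intros)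

lemma linear_sum_Basis:
  assumes "linear h" shows "h (x::'a::euclidean_space) = (\<Sum>i\<in>Basis. (x \<bullet> i) *\<^sub>R h i)"
proof -
  have "h x = h (\<Sum>i\<in>Basis. (x \<bullet> i) *\<^sub>R i)" by (simp add: euclidean_representation)
  also have "\<dots> = (\<Sum>i\<in>Basis. (x \<bullet> i) *\<^sub>R h i)"
    using assms by (simp add: linear_sum linear_cmul)
  finally show ?thesis .
qed

text \<open>\<open>pCk\<close> speaks of derivatives in fixed directions, whereas in the chain rule
  the direction fed to the outer derivative varies with \<open>x\<close>. Expanding that direction
  in the basis leaves outer derivatives in basis directions, to which the induction hypothesis
  applies.\<close>

lemma pCk_compose:
  fixes g :: "'t::topological_space \<Rightarrow> 'a::euclidean_space \<Rightarrow> 'b::euclidean_space"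
  assumes V: "open_slices V" and sub: "\<And>t x. (t, x) \<in> V \<Longrightarrow> (t, g t x) \<in> W"
    and f: "pCk k f W" and g: "pCk k g V"
  shows "pCk k (\<lambda>t x. f t (g t x)) V"
  using f g
proof (induction k arbitrary: f)
  case 0
  have "continuous_on V (\<lambda>z. (fst z, g (fst z) (snd z)))"
    by (intro continuous_on_Pair pCk_continuous[OF 0(2)] continuous_intros)
  from continuous_on_compose2[OF pCk_continuous[OF 0(1)] this] sub
  show ?case by force
next
  case (Suc k)
  have "continuous_on V (\<lambda>z. (fst z, g (fst z) (snd z)))"
    by (intro continuous_on_Pair pCk_continuous[OF Suc.prems(2)] continuous_intros)
  from continuous_on_compose2[OF pCk_continuous[OF Suc.prems(1)] this] sub
  have c: "continuous_on V (\<lambda>z. f (fst z) (g (fst z) (snd z)))" by force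
  have IH: "pCk k (\<lambda>t x. frechet_derivative (f t) (at (g t x)) v) V" for v
    by (rule Suc.IH[of "\<lambda>t x. frechet_derivative (f t) (at x) v"]) (use Suc.prems pCk_Suc_imp in auto)
  show ?case
  proof (rule pCk_SucI[where D = "\<lambda>t x v. \<Sum>i\<in>Basis. (frechet_derivative (g t) (at x) v \<bullet> i) *\<^sub>R frechet_derivative (f t) (at (g t x)) i"])
    show "continuous_on V (\<lambda>z. f (fst z) (g (fst z) (snd z)))" using c by simp
    show "((\<lambda>x. f t (g t x)) has_derivative (\<lambda>v. \<Sum>i\<in>Basis. (frechet_derivative (g t) (at x) v \<bullet> i) *\<^sub>R frechet_derivative (f t) (at (g t x)) i)) (at x)"
      if "(t, x) \<in> V" for t x
    proof -
      have f': "(f t has_derivative frechet_derivative (f t) (at (g t x))) (at (g t x))"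
        by (rule pCk_has_derivative[OF Suc.prems(1) sub[OF that]])
      have "((\<lambda>x. f t (g t x)) has_derivative (\<lambda>v. frechet_derivative (f t) (at (g t x)) (frechet_derivative (g t) (at x) v))) (at x)"
        using diff_chain_at[OF pCk_has_derivative[OF Suc.prems(2) that] f'] by (simp add: o_def)
      moreover have "frechet_derivative (f t) (at (g t x)) (frechet_derivative (g t) (at x) v) =
          (\<Sum>i\<in>Basis. (frechet_derivative (g t) (at x) v \<bullet> i) *\<^sub>R frechet_derivative (f t) (at (g t x)) i)" for v
        by (rule linear_sum_Basis[OF has_derivative_linear[OF f']])
      ultimately show ?thesis by simp
    qed
    show "pCk k (\<lambda>t x. \<Sum>i\<in>Basis. (frechet_derivative (g t) (at x) v \<bullet> i) *\<^sub>R frechet_derivative (f t) (at (g t x)) i) V" for v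
      by (intro pCk_sum pCk_scaleR pCk_linear[OF _ bounded_linear_inner_left] IH V) (use Suc.prems in auto)
  qed (rule V)
qed

lemma continuous_on_local:
  assumes "\<And>z. z \<in> W \<Longrightarrow> \<exists>S. open S \<and> z \<in> S \<and> continuous_on (W \<inter> S) f"
  shows "continuous_on W f"
  unfolding continuous_on_def
proof
  fix z assume "z \<in> W"
  then obtain S where S: "open S" "z \<in> S" "continuous_on (W \<inter> S) f" using assms by blast
  then have "(f \<longlongrightarrow> f z) (at z within (W \<inter> S))"
    using \<open>z \<in> W\<close> by (auto simp: continuous_on_def)
  moreover have "at z within (W \<inter> S) = at z within W"
    by (rule at_within_nhd[OF S(2,1)]) auto
  ultimately show "(f \<longlongrightarrow> f z) (at z within W)" by simp
qed

lemma pCk_local: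
  assumes "\<And>z. z \<in> W \<Longrightarrow> \<exists>S. open S \<and> z \<in> S \<and> pCk k f (W \<inter> S)"
  shows "pCk k f W"
  using assms
proof (induction k arbitrary: f)
  case 0
  then show ?case by (auto intro!: continuous_on_local)
next
  case (Suc k)
  have "continuous_on W (\<lambda>z. f (fst z) (snd z))"
  proof (rule continuous_on_local)
    fix z assume "z \<in> W"
    from Suc.prems[OF this] obtain S where "open S" "z \<in> S" "pCk (Suc k) f (W \<inter> S)" by blast
    then show "\<exists>S. open S \<and> z \<in> S \<and> continuous_on (W \<inter> S) (\<lambda>z. f (fst z) (snd z))"
      using pCk_continuous by blast
  qed
  moreover have "f (fst z) differentiable (at (snd z))" if "z \<in> W" for z
    using Suc.prems[OF that] that by auto
  moreover have "pCk k (\<lambda>t x. frechet_derivative (f t) (at x) v) W" for v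
  proof (rule Suc.IH)
    fix z assume "z \<in> W"
    then show "\<exists>S. open S \<and> z \<in> S \<and> pCk k (\<lambda>t x. frechet_derivative (f t) (at x) v) (W \<inter> S)"
      using Suc.prems[of z] by auto
  qed
  ultimately show ?case by simp
qed

text \<open>A change of time need only be continuous, as no derivative in time is taken. It serves
  to reverse time and, with constant \<open>\<tau>\<close>, to freeze it.\<close>

lemma pCk_reparam:
  assumes "continuous_on T \<tau>" "\<And>s x. (s, x) \<in> V \<Longrightarrow> s \<in> T \<and> (\<tau> s, x) \<in> W" "pCk k f W"
  shows "pCk k (\<lambda>s x. f (\<tau> s) x) V"
proof -
  have t: "continuous_on V (\<lambda>z. (\<tau> (fst z), snd z))"
    by (intro continuous_on_Pair continuous_on_compose2[OF assms(1)] continuous_intros) (use assms(2) in force)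
  show ?thesis
    using assms(3)
  proof (induction k arbitrary: f)
    case 0
    show ?case using continuous_on_compose2[OF pCk_continuous[OF 0] t] assms(2) by force
  next
    case (Suc k)
    have "continuous_on V (\<lambda>z. f (\<tau> (fst z)) (snd z))"
      using continuous_on_compose2[OF pCk_continuous[OF Suc.prems] t] assms(2) by force
    moreover have "f (\<tau> (fst z)) differentiable (at (snd z))" if "z \<in> V" for z
      using assms(2)[of "fst z" "snd z"] Suc.prems that by auto
    moreover have "pCk k (\<lambda>s x. frechet_derivative (f (\<tau> s)) (at x) v) V" for v
      by (rule Suc.IH[of "\<lambda>t x. frechet_derivative (f t) (at x) v"]) (use Suc.prems in simp)
    ultimately show ?case by simp
  qed
qed

lemma Ck_on_continuous: "Ck_on k F U \<Longrightarrow> continuous_on U F"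
  by (cases k) (auto intro!: differentiable_imp_continuous_on differentiable_at_imp_differentiable_on)

lemma Ck_on_imp_pCk: "Ck_on k F U \<Longrightarrow> pCk k (\<lambda>_. F) (T \<times> U)"
proof (induction k arbitrary: F)
  case 0
  have "continuous_on (T \<times> U) (\<lambda>z. F (snd z))"
    by (rule continuous_on_compose2[OF Ck_on_continuous[OF 0]]) (auto intro!: continuous_intros)
  then show ?case by simp
next
  case (Suc k)
  have "continuous_on (T \<times> U) (\<lambda>z. F (snd z))"
    by (rule continuous_on_compose2[OF Ck_on_continuous[OF Suc.prems]]) (auto intro!: continuous_intros)
  with Suc show ?case by auto
qed

lemma pCk_imp_Ck_on: "pCk k (\<lambda>_. F) (T \<times> U) \<Longrightarrow> t \<in> T \<Longrightarrow> Ck_on k F U"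
proof (induction k arbitrary: F)
  case 0
  have "continuous_on U (\<lambda>x. (\<lambda>z. F (snd z)) (t, x))"
    by (rule continuous_on_compose2[of "T \<times> U"]) (use 0 in \<open>auto intro!: continuous_intros\<close>)
  then show ?case by simp
qed auto

text \<open>The derivative in \<open>x\<close> alone is the full derivative applied to
  \<open>(0, v)\<close>. This carries joint smoothness, as demanded of Hamiltonians, over to the
  parametrised notion.\<close>

lemma Ck_on_slice: "open U \<Longrightarrow> Ck_on k F U \<Longrightarrow> pCk k (\<lambda>t x. F (t, x)) U"
proof (induction k arbitrary: F)
  case 0 then show ?case by simp
next
  case (Suc k)
  have d: "((\<lambda>x. F (t, x)) has_derivative (\<lambda>v. frechet_derivative F (at (t, x)) (0, v))) (at x)"
    if "(t, x) \<in> U" for t x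
  proof -
    have "(F has_derivative frechet_derivative F (at (t, x))) (at (t, x))"
      using Suc.prems that by (auto simp: frechet_derivative_works[symmetric])
    moreover have "(Pair t has_derivative Pair 0) (at x)"
      by (auto intro!: derivative_eq_intros)
    ultimately show ?thesis using diff_chain_at[of "Pair t" "Pair 0" x F] by (simp add: o_def)
  qed
  have "frechet_derivative (\<lambda>x. F (t, x)) (at x) = (\<lambda>v. frechet_derivative F (at (t, x)) (0, v))"
    if "(t, x) \<in> U" for t x
    using frechet_derivative_at[OF d[OF that]] by simp
  note fd = this
  have k: "pCk k (\<lambda>t x. frechet_derivative F (at (t, x)) (0, v)) U" for v
    using Suc by auto
  have "continuous_on U F" using Ck_on_continuous[OF Suc.prems(2)] .
  moreover have "pCk k (\<lambda>t x. frechet_derivative (\<lambda>x. F (t, x)) (at x) v) U" for v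
  proof -
    have "open_slices U" using open_slices_Int_open[of UNIV U] \<open>open U\<close> by (simp add: open_slices_def)
    then show ?thesis by (rule pCk_cong[OF _ _ k[of v]]) (simp add: fd)
  qed
  ultimately show ?case using d by (force simp: differentiable_def)
qed

section \<open>Smooth functions of one variable, symmetry of second derivatives, closed forms\<close>

lemma pCk_inverse: "pCk k (\<lambda>_ x::real. inverse x) (T \<times> (-{0}))"
proof (induction k)
  case 0 show ?case by (auto intro!: continuous_intros)
next
  case (Suc k)
  have o: "open_slices (T \<times> (-{0::real}))" by (rule open_slices_Times) auto
  show ?case
  proof (rule pCk_SucI[where D = "\<lambda>_ x v. v * - (inverse x * inverse x)"])
    show "pCk k (\<lambda>_ x. v * - (inverse x * inverse x)) (T \<times> (-{0}))" for v :: real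
      by (intro pCk_mult pCk_minus pCk_const Suc o)
  qed (auto intro!: o continuous_intros derivative_eq_intros)
qed

lemma pCk_sqrt: "pCk k (\<lambda>_ x::real. sqrt x) (T \<times> {0<..})"
proof (induction k)
  case 0 show ?case by (auto intro!: continuous_intros)
next
  case (Suc k)
  have o: "open_slices (T \<times> {0::real<..})" by (rule open_slices_Times) auto
  show ?case
  proof (rule pCk_SucI[where D = "\<lambda>_ x v. v * (1/2 * inverse (sqrt x))"])
    have "pCk k (\<lambda>_ x. inverse (sqrt x)) (T \<times> {0<..})"
      by (rule pCk_compose[OF o _ pCk_inverse[where T = T] Suc]) auto
    then show "pCk k (\<lambda>_ x. v * (1/2 * inverse (sqrt x))) (T \<times> {0<..})" for v
      by (intro pCk_mult pCk_const o)
    show "(sqrt has_derivative (\<lambda>v. v * (1/2 * inverse (sqrt x)))) (at x)" if "(t, x) \<in> T \<times> {0<..}" for t x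
      using that by (auto intro!: derivative_eq_intros simp: field_simps)
  qed (auto intro!: o continuous_intros)
qed

text \<open>The functions x^(-n) exp(-1/x), extended by 0. All exponents are treated together
  because the derivative of each is a combination of two others, so that one induction shows all of
  them smooth.\<close>

definition flat_exp :: "nat \<Rightarrow> real \<Rightarrow> real" where
  "flat_exp n x = (if 0 < x then inverse x ^ n * exp (- inverse x) else 0)"

lemma flat_exp_tendsto: "(flat_exp n \<longlongrightarrow> 0) (at_right 0)"
proof -
  have "((\<lambda>y. y ^ n / exp y) \<longlongrightarrow> (0::real)) at_top" by (rule tendsto_power_div_exp_0)
  then have "((\<lambda>x. inverse x ^ n / exp (inverse x)) \<longlongrightarrow> (0::real)) (at_right 0)"
    by (rule filterlim_compose[OF _ filterlim_inverse_at_top_right])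
  then show ?thesis
    by (rule Lim_transform_eventually)
      (auto simp: flat_exp_def exp_minus field_simps eventually_at_right_less intro: eventually_mono[OF eventually_at_right_less])
qed

lemma flat_exp_tendsto_0: "(flat_exp n \<longlongrightarrow> 0) (at 0)"
proof -
  have "(flat_exp n \<longlongrightarrow> 0) (at_left 0)"
    by (rule Lim_transform_eventually[of "\<lambda>_. 0"])
      (auto simp: flat_exp_def eventually_at_left_field intro!: exI[of _ "-1"])
  then show ?thesis using flat_exp_tendsto by (simp add: filterlim_split_at)
qed

lemma flat_exp_derivative:
  "(flat_exp n has_real_derivative flat_exp (n + 2) x - real n * flat_exp (n + 1) x) (at x)"
proof -
  consider "x < 0" | "x = 0" | "0 < x" by linarith
  then show ?thesis
  proof cases
    case 1
    have "((\<lambda>_. 0) has_real_derivative 0) (at x)" by simp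
    then have "(flat_exp n has_real_derivative 0) (at x)"
      by (rule DERIV_cong_ev[THEN iffD1, OF refl _ refl, rotated])
        (use 1 in \<open>auto simp: flat_exp_def eventually_nhds intro!: exI[of _ "{..<0}"]\<close>)
    then show ?thesis using 1 by (simp add: flat_exp_def)
  next
    case 2
    have "((\<lambda>h. flat_exp n h / h) \<longlongrightarrow> 0) (at 0)"
    proof -
      have "flat_exp (n + 1) = (\<lambda>h. flat_exp n h / h)"
        by (auto simp: flat_exp_def fun_eq_iff field_simps)
      then show ?thesis using flat_exp_tendsto_0[of "n + 1"] by simp
    qed
    then show ?thesis using 2 by (simp add: DERIV_def flat_exp_def)
  next
    case 3
    have "((\<lambda>x. inverse x ^ n * exp (- inverse x)) has_real_derivative flat_exp (n + 2) x - real n * flat_exp (n + 1) x) (at x)"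
    proof -
      have d: "((\<lambda>x. inverse x ^ n * exp (- inverse x)) has_real_derivative
          inverse x ^ n * (exp (- inverse x) * (inverse x * inverse x)) + real n * inverse x ^ (n - 1) * - (inverse x * inverse x) * exp (- inverse x)) (at x)"
        using 3 by (auto intro!: derivative_eq_intros)
      have e1: "real n * inverse x ^ (n - 1) * - (inverse x * inverse x) = - (real n * (inverse x ^ n * inverse x))"
        by (cases n) auto
      have e2: "flat_exp (n + 2) x = inverse x ^ n * (exp (- inverse x) * (inverse x * inverse x))"
        "flat_exp (n + 1) x = inverse x ^ n * inverse x * exp (- inverse x)"
        using 3 by (simp_all add: flat_exp_def power_add power2_eq_square mult_ac)
      show ?thesis
        by (rule DERIV_cong[OF d]) (simp only: e1 e2, simp)
    qed
    then show ?thesis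
      by (rule DERIV_cong_ev[THEN iffD1, OF refl _ refl, rotated])
        (use 3 in \<open>auto simp: flat_exp_def eventually_nhds intro!: exI[of _ "{0<..}"]\<close>)
  qed
qed


lemma pCk_flat_exp: "pCk k (\<lambda>_. flat_exp n) (T \<times> UNIV)"
proof (induction k arbitrary: n)
  case 0
  have "continuous_on UNIV (flat_exp n)"
    by (rule continuous_at_imp_continuous_on) (auto intro!: DERIV_isCont flat_exp_derivative)
  then have "continuous_on (T \<times> UNIV) (\<lambda>z. flat_exp n (snd z))"
    by (rule continuous_on_compose2) (auto intro!: continuous_intros)
  then show ?case by simp
next
  case (Suc k)
  have o: "open_slices (T \<times> (UNIV::real set))" by (rule open_slices_Times) auto
  show ?case
  proof (rule pCk_SucI[where D = "\<lambda>_ x v. v * (flat_exp (n + 2) x - real n * flat_exp (n + 1) x)"])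
    have "continuous_on UNIV (flat_exp n)"
      by (rule continuous_at_imp_continuous_on) (auto intro!: DERIV_isCont flat_exp_derivative)
    then show "continuous_on (T \<times> UNIV) (\<lambda>z. flat_exp n (snd z))"
      by (rule continuous_on_compose2) (auto intro!: continuous_intros)
    show "(flat_exp n has_derivative (\<lambda>v. v * (flat_exp (n + 2) x - real n * flat_exp (n + 1) x))) (at x)" for x
      using flat_exp_derivative[of n x] by (simp add: has_field_derivative_def mult_commute_abs)
  qed (intro o pCk_mult pCk_diff pCk_const Suc)+
qed

text \<open>The values 0 and 1 are attained with a margin, on \<open>x \<le> 1/3\<close> and
  \<open>2/3 \<le> x\<close>, so the function is constant on neighbourhoods of 0 and of 1.\<close>

definition smooth_step :: "real \<Rightarrow> real" where
  "smooth_step x = flat_exp 0 (x - 1/3) * inverse (flat_exp 0 (x - 1/3) + flat_exp 0 (2/3 - x))"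

lemma smooth_step_denominator: "0 < flat_exp 0 (x - 1/3) + flat_exp 0 (2/3 - x)"
proof -
  have nn: "0 \<le> flat_exp 0 y" and p: "0 < y \<Longrightarrow> 0 < flat_exp 0 y" for y
    by (simp_all add: flat_exp_def)
  have "0 < x - 1/3 \<or> 0 < 2/3 - x" by linarith
  then show ?thesis using nn[of "x - 1/3"] nn[of "2/3 - x"] p[of "x - 1/3"] p[of "2/3 - x"] by linarith
qed

lemma smooth_step_eq_0: "x \<le> 1/3 \<Longrightarrow> smooth_step x = 0"
  by (simp add: smooth_step_def flat_exp_def)

lemma smooth_step_eq_1: "2/3 \<le> x \<Longrightarrow> smooth_step x = 1"
  by (simp add: smooth_step_def flat_exp_def)

lemma smooth_step_bounds: "0 \<le> smooth_step x" "smooth_step x \<le> 1"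
proof -
  have "0 \<le> flat_exp 0 y" for y by (simp add: flat_exp_def)
  then show "0 \<le> smooth_step x" "smooth_step x \<le> 1"
    using smooth_step_denominator[of x]
    by (simp_all add: smooth_step_def divide_inverse[symmetric])
qed

lemma pCk_smooth_step: "pCk k (\<lambda>_. smooth_step) (T \<times> UNIV)"
proof -
  have o: "open_slices (T \<times> (UNIV::real set))" by (rule open_slices_Times) auto
  have 1: "pCk k (\<lambda>_ x. flat_exp 0 (x - 1/3)) (T \<times> UNIV)"
    by (rule pCk_compose[OF o _ pCk_flat_exp[where T = T]]) (auto intro!: pCk_diff pCk_ident pCk_const o)
  have 2: "pCk k (\<lambda>_ x. flat_exp 0 (2/3 - x)) (T \<times> UNIV)"
    by (rule pCk_compose[OF o _ pCk_flat_exp[where T = T]]) (auto intro!: pCk_diff pCk_ident pCk_const o)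
  have "pCk k (\<lambda>_ x. inverse (flat_exp 0 (x - 1/3) + flat_exp 0 (2/3 - x))) (T \<times> UNIV)"
    by (rule pCk_compose[OF o _ pCk_inverse[where T = T]])
      (use smooth_step_denominator in \<open>auto intro!: pCk_add o 1 2 simp: less_imp_neq[symmetric]\<close>)
  then show ?thesis
    unfolding smooth_step_def by (intro pCk_mult o 1)
qed

section \<open>Symmetry of second derivatives\<close>

lemma second_difference_mvt:
  fixes f :: "'a::real_normed_vector \<Rightarrow> real"
  assumes "0 < s"
    and U: "\<And>r q. r \<in> {0..s} \<Longrightarrow> q \<in> {0..s} \<Longrightarrow> x + r *\<^sub>R u + q *\<^sub>R v \<in> U"
    and D: "\<And>y. y \<in> U \<Longrightarrow> (f has_derivative D y) (at y)"
    and A: "\<And>y. y \<in> U \<Longrightarrow> ((\<lambda>y. D y u) has_derivative A y) (at y)"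
  shows "\<exists>r\<in>{0..s}. \<exists>q\<in>{0..s}.
    f (x + s *\<^sub>R u + s *\<^sub>R v) - f (x + s *\<^sub>R u) - f (x + s *\<^sub>R v) + f x = s * (s * A (x + r *\<^sub>R u + q *\<^sub>R v) v)"
proof -
  have 1: "((\<lambda>r. f (x + r *\<^sub>R u + q *\<^sub>R v)) has_real_derivative D (x + r *\<^sub>R u + q *\<^sub>R v) u) (at r)"
    if "r \<in> {0..s}" "q \<in> {0..s}" for r q
  proof -
    have "((\<lambda>r. x + r *\<^sub>R u + q *\<^sub>R v) has_derivative (\<lambda>h. h *\<^sub>R u)) (at r)"
      by (auto intro!: derivative_eq_intros)
    from diff_chain_at[OF this D[OF U[OF that]]]
    have "((\<lambda>r. f (x + r *\<^sub>R u + q *\<^sub>R v)) has_derivative (\<lambda>h. D (x + r *\<^sub>R u + q *\<^sub>R v) (h *\<^sub>R u))) (at r)"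
      by (simp add: o_def)
    moreover have "D (x + r *\<^sub>R u + q *\<^sub>R v) (h *\<^sub>R u) = D (x + r *\<^sub>R u + q *\<^sub>R v) u * h" for h
      using linear_cmul[OF has_derivative_linear[OF D[OF U[OF that]]]] by (simp add: mult.commute)
    ultimately show ?thesis by (simp add: has_field_derivative_def)
  qed
  have 2: "((\<lambda>q. D (x + r *\<^sub>R u + q *\<^sub>R v) u) has_real_derivative A (x + r *\<^sub>R u + q *\<^sub>R v) v) (at q)"
    if "r \<in> {0..s}" "q \<in> {0..s}" for r q
  proof -
    have "((\<lambda>q. x + r *\<^sub>R u + q *\<^sub>R v) has_derivative (\<lambda>h. h *\<^sub>R v)) (at q)"
      by (auto intro!: derivative_eq_intros)
    from diff_chain_at[OF this A[OF U[OF that]]]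
    have "((\<lambda>q. D (x + r *\<^sub>R u + q *\<^sub>R v) u) has_derivative (\<lambda>h. A (x + r *\<^sub>R u + q *\<^sub>R v) (h *\<^sub>R v))) (at q)"
      by (simp add: o_def)
    moreover have "A (x + r *\<^sub>R u + q *\<^sub>R v) (h *\<^sub>R v) = A (x + r *\<^sub>R u + q *\<^sub>R v) v * h" for h
      using linear_cmul[OF has_derivative_linear[OF A[OF U[OF that]]]] by (simp add: mult.commute)
    ultimately show ?thesis by (simp add: has_field_derivative_def)
  qed
  have "\<exists>r>0. r < s \<and> (f (x + s *\<^sub>R u + s *\<^sub>R v) - f (x + s *\<^sub>R u + 0 *\<^sub>R v))
      - (f (x + 0 *\<^sub>R u + s *\<^sub>R v) - f (x + 0 *\<^sub>R u + 0 *\<^sub>R v)) =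
      (s - 0) * (D (x + r *\<^sub>R u + s *\<^sub>R v) u - D (x + r *\<^sub>R u + 0 *\<^sub>R v) u)"
    by (rule MVT2[OF \<open>0 < s\<close>, of "\<lambda>r. f (x + r *\<^sub>R u + s *\<^sub>R v) - f (x + r *\<^sub>R u + 0 *\<^sub>R v)"])
      (intro DERIV_diff 1; use \<open>0 < s\<close> in simp)
  then obtain r where r: "0 < r" "r < s" "f (x + s *\<^sub>R u + s *\<^sub>R v) - f (x + s *\<^sub>R u) - f (x + s *\<^sub>R v) + f x =
      s * (D (x + r *\<^sub>R u + s *\<^sub>R v) u - D (x + r *\<^sub>R u + 0 *\<^sub>R v) u)"
    by (auto simp: algebra_simps)
  have "\<exists>q>0. q < s \<and> D (x + r *\<^sub>R u + s *\<^sub>R v) u - D (x + r *\<^sub>R u + 0 *\<^sub>R v) u = (s - 0) * A (x + r *\<^sub>R u + q *\<^sub>R v) v"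
    by (rule MVT2[OF \<open>0 < s\<close>, of "\<lambda>q. D (x + r *\<^sub>R u + q *\<^sub>R v) u"])
      (intro 2; use r in simp)
  then obtain q where "0 < q" "q < s" "D (x + r *\<^sub>R u + s *\<^sub>R v) u - D (x + r *\<^sub>R u + 0 *\<^sub>R v) u = s * A (x + r *\<^sub>R u + q *\<^sub>R v) v"
    by auto
  with r show ?thesis by (intro bexI[of _ r] bexI[of _ q]) auto
qed

text \<open>The second difference of \<open>f\<close> over the parallelogram spanned by
  \<open>s *\<^sub>R u\<close> and \<open>s *\<^sub>R v\<close> is symmetric in the two directions.
  The mean value theorem, applied once in each direction, makes it \<open>s * s\<close> times a
  value of either mixed derivative at some point of the parallelogram. Letting the parallelogram
  shrink, continuity gives the claim.\<close>

lemma symmetric_second_derivative_real: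
  fixes f :: "'a::real_normed_vector \<Rightarrow> real"
  assumes "open U" "x \<in> U"
    and D: "\<And>y. y \<in> U \<Longrightarrow> (f has_derivative D y) (at y)"
    and A: "\<And>y. y \<in> U \<Longrightarrow> ((\<lambda>y. D y u) has_derivative A y) (at y)"
    and B: "\<And>y. y \<in> U \<Longrightarrow> ((\<lambda>y. D y v) has_derivative B y) (at y)"
    and cA: "continuous_on U (\<lambda>y. A y v)" and cB: "continuous_on U (\<lambda>y. B y u)"
  shows "A x v = B x u"
proof -
  have "\<bar>A x v - B x u\<bar> \<le> 2 * e" if "0 < e" for e
  proof -
    have "continuous (at x) (\<lambda>y. A y v)" "continuous (at x) (\<lambda>y. B y u)"
      using cA cB assms(1,2) by (auto simp: continuous_on_eq_continuous_at)
    then obtain d1 d2 where d: "0 < d1" "\<And>y. dist y x < d1 \<Longrightarrow> dist (A y v) (A x v) < e"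
        "0 < d2" "\<And>y. dist y x < d2 \<Longrightarrow> dist (B y u) (B x u) < e"
      using \<open>0 < e\<close> unfolding continuous_at_eps_delta by metis
    obtain d3 where d3: "0 < d3" "ball x d3 \<subseteq> U" using assms(1,2) open_contains_ball by blast
    define d where "d = min d1 (min d2 d3)"
    \<comment> \<open>Chosen so that the whole parallelogram stays within distance
      \<open>d / 2\<close> of \<open>x\<close>; the summand 1 keeps the denominator positive when
      both directions vanish.\<close>
    define s where "s = d / (2 * (norm u + norm v + 1))"
    have dpos: "0 < d" using d d3 by (simp add: d_def)
    have np: "0 < 2 * (norm u + norm v + 1)" by (smt (verit) norm_ge_zero)
    have s: "0 < s" using dpos np by (simp add: s_def)
    have near: "dist (x + r *\<^sub>R u + q *\<^sub>R v) x < d" if "r \<in> {0..s}" "q \<in> {0..s}" for r q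
    proof -
      have "dist (x + r *\<^sub>R u + q *\<^sub>R v) x = norm (r *\<^sub>R u + q *\<^sub>R v)" by (simp add: dist_norm)
      also have "\<dots> \<le> norm (r *\<^sub>R u) + norm (q *\<^sub>R v)" by (rule norm_triangle_ineq)
      also have "\<dots> \<le> s * norm u + s * norm v"
        using that by (auto intro!: add_mono mult_right_mono)
      also have "\<dots> \<le> s * (norm u + norm v + 1)" using s by (simp add: algebra_simps)
      also have "\<dots> = d / 2" using np by (simp add: s_def field_simps)
      also have "\<dots> < d" using dpos by simp
      finally show ?thesis .
    qed
    have U: "x + r *\<^sub>R u + q *\<^sub>R v \<in> U" if "r \<in> {0..s}" "q \<in> {0..s}" for r q
      using near[OF that] d3(2) by (auto simp: d_def dist_commute)
    obtain r q where 1: "r \<in> {0..s}" "q \<in> {0..s}"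
      "f (x + s *\<^sub>R u + s *\<^sub>R v) - f (x + s *\<^sub>R u) - f (x + s *\<^sub>R v) + f x = s * (s * A (x + r *\<^sub>R u + q *\<^sub>R v) v)"
      using second_difference_mvt[OF s U D A] by blast
    have U': "x + r *\<^sub>R v + q *\<^sub>R u \<in> U" if "r \<in> {0..s}" "q \<in> {0..s}" for r q
      using U[OF that(2,1)] by (simp add: algebra_simps)
    obtain r' q' where 2: "r' \<in> {0..s}" "q' \<in> {0..s}"
      "f (x + s *\<^sub>R v + s *\<^sub>R u) - f (x + s *\<^sub>R v) - f (x + s *\<^sub>R u) + f x = s * (s * B (x + r' *\<^sub>R v + q' *\<^sub>R u) u)"
      using second_difference_mvt[OF s U' D B] by blast
    have "s * (s * A (x + r *\<^sub>R u + q *\<^sub>R v) v) = s * (s * B (x + r' *\<^sub>R v + q' *\<^sub>R u) u)"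
      using 1(3) 2(3) by (simp add: algebra_simps)
    then have "A (x + r *\<^sub>R u + q *\<^sub>R v) v = B (x + q' *\<^sub>R u + r' *\<^sub>R v) u"
      using s by (simp add: algebra_simps)
    moreover have "dist (A (x + r *\<^sub>R u + q *\<^sub>R v) v) (A x v) < e"
      using d(2) near[OF 1(1,2)] by (simp add: d_def)
    moreover have "dist (B (x + q' *\<^sub>R u + r' *\<^sub>R v) u) (B x u) < e"
      using d(4) near[OF 2(2,1)] by (simp add: d_def)
    ultimately show ?thesis by (simp add: dist_real_def)
  qed
  from this[of "\<bar>A x v - B x u\<bar> / 4"] show ?thesis by (cases "A x v = B x u") auto
qed

lemma symmetric_second_derivative:
  fixes f :: "'a::real_normed_vector \<Rightarrow> 'b::euclidean_space"
  assumes "open U" "x \<in> U"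
    and D: "\<And>y. y \<in> U \<Longrightarrow> (f has_derivative D y) (at y)"
    and A: "\<And>y. y \<in> U \<Longrightarrow> ((\<lambda>y. D y u) has_derivative A y) (at y)"
    and B: "\<And>y. y \<in> U \<Longrightarrow> ((\<lambda>y. D y v) has_derivative B y) (at y)"
    and cA: "continuous_on U (\<lambda>y. A y v)" and cB: "continuous_on U (\<lambda>y. B y u)"
  shows "A x v = B x u"
proof (rule euclidean_eqI)
  fix i :: 'b
  show "A x v \<bullet> i = B x u \<bullet> i"
    by (rule symmetric_second_derivative_real[OF assms(1,2), of "\<lambda>y. f y \<bullet> i" "\<lambda>y w. D y w \<bullet> i" u "\<lambda>y w. A y w \<bullet> i" v "\<lambda>y w. B y w \<bullet> i"])
      (auto intro!: continuous_intros cA cB bounded_linear.has_derivative[OF bounded_linear_inner_left] D A B)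
qed

lemma frechet_derivative_symmetric:
  fixes f :: "'t::topological_space \<Rightarrow> 'a::euclidean_space \<Rightarrow> 'b::euclidean_space"
  assumes W: "open_slices W" and f: "pCk 2 f W" and x: "(t, x) \<in> W"
  shows "frechet_derivative (\<lambda>x. frechet_derivative (f t) (at x) u) (at x) v =
    frechet_derivative (\<lambda>x. frechet_derivative (f t) (at x) v) (at x) u"
proof (rule symmetric_second_derivative[of "{x. (t, x) \<in> W}" x "f t"])
  have f1: "pCk (Suc (Suc 0)) f W" using f by (simp only: numeral_2_eq_2)
  note f2 = pCk_SucD[OF f1]
  show "open {x. (t, x) \<in> W}" using W by (simp add: open_slices_def)
  show "(f t has_derivative frechet_derivative (f t) (at y)) (at y)" if "y \<in> {x. (t, x) \<in> W}" for y
    using pCk_has_derivative[OF f1] that by simp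
  show "((\<lambda>x. frechet_derivative (f t) (at x) u) has_derivative frechet_derivative (\<lambda>x. frechet_derivative (f t) (at x) u) (at y)) (at y)"
    "((\<lambda>x. frechet_derivative (f t) (at x) v) has_derivative frechet_derivative (\<lambda>x. frechet_derivative (f t) (at x) v) (at y)) (at y)"
    if "y \<in> {x. (t, x) \<in> W}" for y
    using pCk_has_derivative[OF f2] that by simp_all
  have c: "continuous_on {x. (t, x) \<in> W} (\<lambda>x. frechet_derivative (\<lambda>x. frechet_derivative (f t) (at x) u) (at x) v)" for u v
  proof -
    have "continuous_on {x. (t, x) \<in> W} (\<lambda>x. (t, x))" by (auto intro!: continuous_intros)
    from continuous_on_compose2[OF pCk_continuous[OF pCk_SucD[OF f2]] this]
    show ?thesis by force
  qed
  show "continuous_on {x. (t, x) \<in> W} (\<lambda>y. frechet_derivative (\<lambda>x. frechet_derivative (f t) (at x) u) (at y) v)" 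
    "continuous_on {x. (t, x) \<in> W} (\<lambda>y. frechet_derivative (\<lambda>x. frechet_derivative (f t) (at x) v) (at y) u)"
    by (rule c)+
qed (use x in auto)


text \<open>The derivative of the integrand in direction \<open>w\<close> is
  \<open>\<alpha> (s *\<^sub>R p) w + s * D (s *\<^sub>R p) p w\<close>. By closedness this is the
  derivative of \<open>s * \<alpha> (s *\<^sub>R p) w\<close> with respect to \<open>s\<close>, and
  integration from 0 to 1 leaves \<open>\<alpha> p w\<close>.\<close>

lemma poincare_lemma:
  fixes \<alpha> :: "'a::euclidean_space \<Rightarrow> 'a \<Rightarrow> real"
  assumes lin: "\<And>x. linear (\<alpha> x)"
    and D: "\<And>x v. ((\<lambda>x. \<alpha> x v) has_derivative D x v) (at x)"
    and cD: "\<And>v w. continuous_on UNIV (\<lambda>x. D x v w)"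
    and closed: "\<And>x v w. D x v w = D x w v"
  shows "((\<lambda>p. integral {0..1} (\<lambda>s. \<alpha> (s *\<^sub>R p) p)) has_derivative \<alpha> p) (at p)"
proof -
  have c\<alpha>: "continuous_on UNIV (\<lambda>x. \<alpha> x v)" for v
    by (rule has_derivative_continuous_on) (use D in auto)
  have expand: "\<alpha> x v = (\<Sum>i\<in>Basis. (v \<bullet> i) * \<alpha> x i)" for x v
    using linear_sum_Basis[OF lin[of x], of v] by simp
  have linD: "linear (\<lambda>v. D x v w)" for x w
  proof -
    have "(\<lambda>v. D x v w) = D x w" by (rule ext) (rule closed)
    then show ?thesis using has_derivative_linear[OF D[where x = x and v = w]] by simp
  qed
  define c where "c p s j = \<alpha> (s *\<^sub>R p) j + s * D (s *\<^sub>R p) p j" for p :: 'a and s :: real and j :: 'a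
  have d: "((\<lambda>p. \<alpha> (s *\<^sub>R p) p) has_derivative (\<lambda>w. c p s w)) (at p)" for p s
  proof -
    have 1: "((\<lambda>p. \<alpha> (s *\<^sub>R p) i) has_derivative (\<lambda>w. D (s *\<^sub>R p) i (s *\<^sub>R w))) (at p)" for i
    proof -
      have "((\<lambda>p. s *\<^sub>R p) has_derivative (\<lambda>w. s *\<^sub>R w)) (at p)" by (auto intro!: derivative_eq_intros)
      from diff_chain_at[OF this D[of i]] show ?thesis by (simp add: o_def)
    qed
    have "((\<lambda>p. \<Sum>i\<in>Basis. (p \<bullet> i) * \<alpha> (s *\<^sub>R p) i) has_derivative
        (\<lambda>w. \<Sum>i\<in>Basis. (p \<bullet> i) * D (s *\<^sub>R p) i (s *\<^sub>R w) + (w \<bullet> i) * \<alpha> (s *\<^sub>R p) i)) (at p)"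
      by (intro has_derivative_sum has_derivative_mult 1 bounded_linear.has_derivative[OF bounded_linear_inner_left] has_derivative_ident)
    moreover have "(\<Sum>i\<in>Basis. (p \<bullet> i) * D (s *\<^sub>R p) i (s *\<^sub>R w) + (w \<bullet> i) * \<alpha> (s *\<^sub>R p) i) = c p s w" for w
    proof -
      have "D (s *\<^sub>R p) p w = (\<Sum>i\<in>Basis. (p \<bullet> i) * D (s *\<^sub>R p) i w)"
        using linear_sum_Basis[OF linD[where x = "s *\<^sub>R p" and w = w], of p] by simp
      moreover have "D (s *\<^sub>R p) i (s *\<^sub>R w) = s * D (s *\<^sub>R p) i w" for i
        using linear_cmul[OF has_derivative_linear[OF D]] by simp
      ultimately show ?thesis
        by (simp add: c_def sum.distrib sum_distrib_left expand[of _ w] mult_ac)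
    qed
    ultimately show ?thesis unfolding expand[symmetric] by simp
  qed
  have lin_c: "c p s w = (\<Sum>j\<in>Basis. (w \<bullet> j) * c p s j)" for p s w
    using linear_sum_Basis[OF has_derivative_linear[OF d[of s p]], of w] by simp
  have cc: "continuous_on (UNIV \<times> {0..1}) (\<lambda>(p, s). c p s j)" for j
  proof -
    have s: "continuous_on (UNIV \<times> {0..1}) (\<lambda>z. snd z *\<^sub>R fst z :: 'a)" by (auto intro!: continuous_intros)
    have 1: "continuous_on (UNIV \<times> {0..1}) (\<lambda>z. \<alpha> (snd z *\<^sub>R fst z) j)"
      by (rule continuous_on_compose2[OF c\<alpha> s]) auto
    have 2: "continuous_on (UNIV \<times> {0..1}) (\<lambda>z. D (snd z *\<^sub>R fst z) i j)" for i
      by (rule continuous_on_compose2[OF cD s]) auto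
    have 3: "continuous_on (UNIV \<times> {0..1}) (\<lambda>z. \<Sum>i\<in>Basis. (fst z \<bullet> i) * D (snd z *\<^sub>R fst z) i j)"
      by (intro continuous_intros 2)
    have e: "D x p j = (\<Sum>i\<in>Basis. (p \<bullet> i) * D x i j)" for x p
      using linear_sum_Basis[OF linD[where x = x and w = j], of p] by simp
    have "continuous_on (UNIV \<times> {0..1}) (\<lambda>z. D (snd z *\<^sub>R fst z) (fst z) j)"
      using 3 unfolding e[symmetric] .
    with 1 show ?thesis unfolding c_def split_beta by (intro continuous_intros)
  qed
  \<comment> \<open>\<open>leibniz_rule\<close> wants the derivative as a bounded linear function
    depending continuously on both arguments, so it is assembled from the values of \<open>c\<close>
    on the basis.\<close>
  define fx where "fx p s = (\<Sum>j\<in>Basis. c p s j *\<^sub>R blinfun_inner_left j)" for p s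
  have fx: "blinfun_apply (fx p s) = c p s" for p s
  proof
    fix w
    show "blinfun_apply (fx p s) w = c p s w"
      by (subst lin_c) (simp add: fx_def blinfun.sum_left blinfun.scaleR_left mult_ac)
  qed
  have "((\<lambda>p. integral (cbox 0 1) (\<lambda>s. \<alpha> (s *\<^sub>R p) p)) has_derivative integral (cbox 0 1) (fx p)) (at p within UNIV)"
  proof (rule leibniz_rule)
    show "((\<lambda>p. \<alpha> (s *\<^sub>R p) p) has_derivative blinfun_apply (fx p s)) (at p within UNIV)" for p and s :: real
      using d[of s p] by (simp add: fx)
    show "continuous_on (UNIV \<times> cbox 0 (1::real)) (\<lambda>(p, s). fx p s)"
      using cc unfolding fx_def split_beta by (auto intro!: continuous_intros)
    show "(\<lambda>s. \<alpha> (s *\<^sub>R p) p) integrable_on cbox 0 (1::real)" for p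
      by (intro integrable_continuous continuous_on_compose2[OF c\<alpha>] continuous_intros) auto
  qed auto
  moreover have "blinfun_apply (integral (cbox 0 1) (fx p)) w = \<alpha> p w" for w
  proof -
    have cfx: "continuous_on (cbox 0 1) (fx p)"
    proof -
      have "continuous_on {0..1} (\<lambda>s. c p s j)" for j
      proof -
        have "continuous_on {0..1} (\<lambda>s::real. (p, s))" by (intro continuous_intros)
        from continuous_on_compose2[OF cc[of j] this] show ?thesis by auto
      qed
      then show ?thesis unfolding fx_def by (auto intro!: continuous_intros)
    qed
    have "blinfun_apply (integral (cbox 0 1) (fx p)) w = integral (cbox 0 1) (\<lambda>s. blinfun_apply (fx p s) w)"
      using integral_linear[OF integrable_continuous[OF cfx] blinfun.bounded_linear_left, of w] by (simp add: o_def)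
    also have "\<dots> = integral {0..1} (\<lambda>s. c p s w)" by (simp add: fx)
    also have "\<dots> = 1 * \<alpha> (1 *\<^sub>R p) w - 0 * \<alpha> (0 *\<^sub>R p) w"
    proof (rule integral_unique[OF fundamental_theorem_of_calculus])
      fix s :: real assume "s \<in> {0..1}"
      have "((\<lambda>s. \<alpha> (s *\<^sub>R p) w) has_derivative (\<lambda>h. D (s *\<^sub>R p) w (h *\<^sub>R p))) (at s within {0..1})"
      proof -
        have "((\<lambda>s. s *\<^sub>R p) has_derivative (\<lambda>h. h *\<^sub>R p)) (at s within {0..1})" by (auto intro!: derivative_eq_intros)
        from diff_chain_within[OF this has_derivative_at_withinI[OF D[of w]]] show ?thesis by (simp add: o_def)
      qed
      then have "((\<lambda>s. \<alpha> (s *\<^sub>R p) w) has_vector_derivative D (s *\<^sub>R p) p w) (at s within {0..1})"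
        using linear_cmul[OF has_derivative_linear[OF D]] by (simp add: has_vector_derivative_def closed[of _ w])
      then show "((\<lambda>s. s * \<alpha> (s *\<^sub>R p) w) has_vector_derivative c p s w) (at s within {0..1})"
        unfolding c_def by (auto intro!: derivative_eq_intros)
    qed simp
    finally show ?thesis by simp
  qed
  then have "blinfun_apply (integral (cbox 0 1) (fx p)) = \<alpha> p" by auto
  ultimately show ?thesis by simp
qed

section \<open>Ordinary differential equations\<close>

text \<open>Squares are used because the norm need not be differentiable at zeros of
  \<open>w\<close>. From \<open>2 * (norm (w s) * e) \<le> (norm (w s))\<^sup>2 + e\<^sup>2\<close>
  it follows that \<open>(w s \<bullet> w s + e\<^sup>2) * exp (- (2 * L + 1) * s)\<close> does not
  increase; the added \<open>e\<^sup>2\<close> absorbs the inhomogeneous term.\<close>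

lemma gronwall:
  fixes w :: "real \<Rightarrow> 'a::real_inner"
  assumes w: "\<And>t. t \<in> {0..T} \<Longrightarrow> (w has_vector_derivative w' t) (at t within {0..T})"
    and bound: "\<And>t. t \<in> {0..T} \<Longrightarrow> norm (w' t) \<le> L * norm (w t) + e"
    and "0 \<le> L" "0 \<le> e" and t: "t \<in> {0..T}"
  shows "norm (w t) \<le> (norm (w 0) + e) * exp ((2 * L + 1) * t)"
proof -
  define c where "c = 2 * L + 1"
  define q where "q = (\<lambda>s. (w s \<bullet> w s + e\<^sup>2) * exp (- c * s))"
  have "\<exists>s\<in>{0..t}. q t - q 0 = (t - 0) * ((2 * (w s \<bullet> w' s) - c * (w s \<bullet> w s + e\<^sup>2)) * exp (- c * s))"
  proof (rule mvt_very_simple)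
    fix s assume s: "0 \<le> s" "s \<le> t"
    have "(w has_vector_derivative w' s) (at s within {0..t})"
      by (rule has_vector_derivative_within_subset[OF w]) (use s t in auto)
    then show "(q has_derivative (\<lambda>h. h * ((2 * (w s \<bullet> w' s) - c * (w s \<bullet> w s + e\<^sup>2)) * exp (- c * s)))) (at s within {0..t})"
      unfolding q_def has_vector_derivative_def
      by (auto intro!: derivative_eq_intros simp: algebra_simps inner_commute)
  qed (use t in auto)
  then obtain s where s: "s \<in> {0..t}"
    and qs: "q t - q 0 = t * ((2 * (w s \<bullet> w' s) - c * (w s \<bullet> w s + e\<^sup>2)) * exp (- c * s))" by auto
  have "w s \<bullet> w' s \<le> norm (w s) * norm (w' s)" by (rule norm_cauchy_schwarz)
  also have "\<dots> \<le> norm (w s) * (L * norm (w s) + e)"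
    using bound[of s] s t by (auto intro!: mult_left_mono)
  finally have "2 * (w s \<bullet> w' s) \<le> 2 * L * (norm (w s))\<^sup>2 + 2 * (norm (w s) * e)"
    by (simp add: power2_eq_square algebra_simps)
  also have "2 * (norm (w s) * e) \<le> (norm (w s))\<^sup>2 + e\<^sup>2"
    using sum_squares_bound[of "norm (w s)" e] by (simp add: mult_ac)
  finally have "2 * (w s \<bullet> w' s) \<le> c * (w s \<bullet> w s) + e\<^sup>2"
    by (simp add: c_def dot_square_norm algebra_simps)
  also have "e\<^sup>2 \<le> c * e\<^sup>2" using \<open>0 \<le> L\<close> by (simp add: c_def algebra_simps)
  finally have "2 * (w s \<bullet> w' s) - c * (w s \<bullet> w s + e\<^sup>2) \<le> 0" by (simp add: algebra_simps)
  then have "t * ((2 * (w s \<bullet> w' s) - c * (w s \<bullet> w s + e\<^sup>2)) * exp (- c * s)) \<le> 0"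
    using t by (intro mult_nonneg_nonpos mult_nonpos_nonneg) auto
  then have "q t \<le> q 0" using qs by simp
  then have "(w t \<bullet> w t + e\<^sup>2) \<le> (w 0 \<bullet> w 0 + e\<^sup>2) * exp (c * t)"
    by (simp add: q_def exp_minus field_simps)
  then have "(norm (w t))\<^sup>2 + e\<^sup>2 \<le> ((norm (w 0))\<^sup>2 + e\<^sup>2) * exp (c * t)"
    by (simp only: dot_square_norm)
  then have "(norm (w t))\<^sup>2 \<le> ((norm (w 0))\<^sup>2 + e\<^sup>2) * exp (c * t)"
    by (rule order_trans[rotated]) simp
  also have "\<dots> \<le> (norm (w 0) + e)\<^sup>2 * (exp (c * t))\<^sup>2"
  proof (intro mult_mono)
    show "(norm (w 0))\<^sup>2 + e\<^sup>2 \<le> (norm (w 0) + e)\<^sup>2" using \<open>0 \<le> e\<close> by (simp add: power2_sum)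
    have "1 \<le> exp (c * t)" using \<open>0 \<le> L\<close> t by (simp add: c_def)
    then show "exp (c * t) \<le> (exp (c * t))\<^sup>2" by (rule self_le_power) simp
  qed auto
  finally have "(norm (w t))\<^sup>2 \<le> ((norm (w 0) + e) * exp (c * t))\<^sup>2" by (simp add: power_mult_distrib)
  then have "norm (w t) \<le> (norm (w 0) + e) * exp (c * t)"
    by (rule power2_le_imp_le) (use \<open>0 \<le> e\<close> in simp)
  then show ?thesis by (simp only: c_def)
qed

text \<open>Multiplied by \<open>exp (- (2 * L) * t)\<close> the squared norm does not increase,
  multiplied by \<open>exp (2 * L * t)\<close> it does not decrease, so a zero spreads in both
  directions of time. Trajectories will be compared from arbitrary times \<open>t0\<close>, not only
  from 0.\<close>

lemma ode_zero_everywhere: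
  fixes w :: "real \<Rightarrow> 'a::real_inner"
  assumes w: "\<And>t. t \<in> {a..b} \<Longrightarrow> (w has_vector_derivative w' t) (at t within {a..b})"
    and bound: "\<And>t. t \<in> {a..b} \<Longrightarrow> norm (w' t) \<le> L * norm (w t)"
    and t0: "t0 \<in> {a..b}" "w t0 = 0" and t: "t \<in> {a..b}"
  shows "w t = 0"
proof -
  have dq: "((\<lambda>t. (w t \<bullet> w t) * exp (c * t)) has_derivative (\<lambda>h. h * ((2 * (w s \<bullet> w' s) + c * (w s \<bullet> w s)) * exp (c * s)))) (at s within S)"
    if "s \<in> S" "S \<subseteq> {a..b}" for c s S
  proof -
    have "(w has_vector_derivative w' s) (at s within S)"
      by (rule has_vector_derivative_within_subset[OF w]) (use that in auto)
    then show ?thesis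
      unfolding has_vector_derivative_def
      by (auto intro!: derivative_eq_intros simp: algebra_simps inner_commute)
  qed
  have b2: "\<bar>2 * (w s \<bullet> w' s)\<bar> \<le> 2 * L * (w s \<bullet> w s)" if "s \<in> {a..b}" for s
  proof -
    have "\<bar>w s \<bullet> w' s\<bar> \<le> norm (w s) * norm (w' s)" by (rule Cauchy_Schwarz_ineq2)
    also have "\<dots> \<le> norm (w s) * (L * norm (w s))" using bound[OF that] by (intro mult_left_mono) auto
    finally show ?thesis by (simp add: dot_square_norm power2_eq_square algebra_simps)
  qed
  consider "t0 \<le> t" | "t \<le> t0" by linarith
  then show ?thesis
  proof cases
    case 1
    have "\<exists>s\<in>{t0..t}. (w t \<bullet> w t) * exp (- (2 * L) * t) - (w t0 \<bullet> w t0) * exp (- (2 * L) * t0)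
        = (t - t0) * ((2 * (w s \<bullet> w' s) + - (2 * L) * (w s \<bullet> w s)) * exp (- (2 * L) * s))"
      by (rule mvt_very_simple[OF 1 dq]) (use t t0 in auto)
    then obtain s where s: "s \<in> {t0..t}" and
      eq: "(w t \<bullet> w t) * exp (- (2 * L) * t) = (t - t0) * ((2 * (w s \<bullet> w' s) + - (2 * L) * (w s \<bullet> w s)) * exp (- (2 * L) * s))"
      using t0(2) by auto
    have "2 * (w s \<bullet> w' s) + - (2 * L) * (w s \<bullet> w s) \<le> 0" using b2[of s] s t t0 by auto
    then have "(w t \<bullet> w t) * exp (- (2 * L) * t) \<le> 0"
      unfolding eq using 1 by (simp add: mult_nonneg_nonpos mult_nonpos_nonneg)
    then have "w t \<bullet> w t \<le> 0" by (simp add: mult_le_0_iff)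
    then show ?thesis by (meson inner_gt_zero_iff not_le)
  next
    case 2
    have "\<exists>s\<in>{t..t0}. (w t0 \<bullet> w t0) * exp (2 * L * t0) - (w t \<bullet> w t) * exp (2 * L * t)
        = (t0 - t) * ((2 * (w s \<bullet> w' s) + 2 * L * (w s \<bullet> w s)) * exp (2 * L * s))"
      by (rule mvt_very_simple[OF 2 dq]) (use t t0 in auto)
    then obtain s where s: "s \<in> {t..t0}" and
      eq: "- ((w t \<bullet> w t) * exp (2 * L * t)) = (t0 - t) * ((2 * (w s \<bullet> w' s) + 2 * L * (w s \<bullet> w s)) * exp (2 * L * s))"
      using t0(2) by auto
    have "0 \<le> 2 * (w s \<bullet> w' s) + 2 * L * (w s \<bullet> w s)" using b2[of s] s t t0 by auto
    then have "0 \<le> - ((w t \<bullet> w t) * exp (2 * L * t))"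
      unfolding eq using 2 by simp
    then have "w t \<bullet> w t \<le> 0" by (simp add: mult_le_0_iff)
    then show ?thesis by (meson inner_gt_zero_iff not_le)
  qed
qed

lemma ode_unique:
  fixes x y :: "real \<Rightarrow> 'a::real_inner"
  assumes "\<And>t. t \<in> {a..b} \<Longrightarrow> (x has_vector_derivative f t (x t)) (at t within {a..b})"
    and "\<And>t. t \<in> {a..b} \<Longrightarrow> (y has_vector_derivative f t (y t)) (at t within {a..b})"
    and "\<And>t. t \<in> {a..b} \<Longrightarrow> norm (f t (x t) - f t (y t)) \<le> L * norm (x t - y t)"
    and "t0 \<in> {a..b}" "x t0 = y t0" "t \<in> {a..b}"
  shows "x t = y t"
proof -
  have "x t - y t = 0"
    by (rule ode_zero_everywhere[of a b "\<lambda>t. x t - y t" "\<lambda>t. f t (x t) - f t (y t)" L t0 t])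
      (use assms in \<open>auto intro!: has_vector_derivative_diff\<close>)
  then show ?thesis by simp
qed

section \<open>Existence of solutions\<close>

lemma picard_lindelof:
  fixes f :: "real \<Rightarrow> 'a::euclidean_space \<Rightarrow> 'a"
  assumes cont: "continuous_on ({0..1} \<times> UNIV) (\<lambda>z. f (fst z) (snd z))"
    and lip: "\<And>t x y. t \<in> {0..1} \<Longrightarrow> norm (f t x - f t y) \<le> L * norm (x - y)"
    and "0 < L"
  obtains x where "x 0 = x0" "\<And>t. t \<in> {0..1} \<Longrightarrow> (x has_vector_derivative f t (x t)) (at t within {0..1})"
proof -
  define X where "X = rec_nat (\<lambda>t. x0) (\<lambda>n Y t. x0 + integral {0..t} (\<lambda>s. f s (Y s)))"
  have X0: "X 0 = (\<lambda>t. x0)" and XS: "X (Suc n) = (\<lambda>t. x0 + integral {0..t} (\<lambda>s. f s (X n s)))" for n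
    by (simp_all add: X_def)
  have comp: "continuous_on {0..1} (\<lambda>s. f s (Y s))" if "continuous_on {0..1} Y" for Y
    using continuous_on_compose2[OF cont continuous_on_Pair[OF continuous_on_id that]] by auto
  have der: "((\<lambda>t. x0 + integral {0..t} (\<lambda>s. f s (Y s))) has_vector_derivative f t (Y t)) (at t within {0..1})"
    if "continuous_on {0..1} Y" "t \<in> {0..1}" for Y t
    using integral_has_vector_derivative[OF comp[OF that(1)] that(2)] by (auto intro!: derivative_eq_intros)
  have Xc: "continuous_on {0..1} (X n)" for n
  proof (induction n)
    case (Suc n)
    show ?case unfolding XS
      by (rule continuous_on_vector_derivative[OF der[OF Suc]])
  qed (simp add: X0)
  have XD: "(X (Suc n) has_vector_derivative f t (X n t)) (at t within {0..1})" if "t \<in> {0..1}" for n t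
    unfolding XS by (rule der[OF Xc that])
  have "compact ((\<lambda>s. f s x0) ` {0..1})" by (intro compact_continuous_image comp continuous_intros) auto
  then obtain C where C: "\<And>s. s \<in> {0..1} \<Longrightarrow> norm (f s x0) \<le> C" and "0 < C"
    using compact_imp_bounded bounded_pos by (metis (no_types, lifting) image_eqI)
  \<comment> \<open>The weight \<open>exp (2 * L * t)\<close> turns every iteration into a
    contraction by 1/2, so the iterates converge on all of \<open>{0..1}\<close> and no short time
    intervals have to be glued.\<close>
  have step: "norm (X (Suc n) t - X n t) \<le> C * exp (2 * L * t) * (1/2) ^ n" if "t \<in> {0..1}" for n t
    using that
  proof (induction n arbitrary: t)
    case 0
    have "norm (X 1 t - X 1 0) \<le> C * t - C * 0"
    proof (cases "t = 0")
      case False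
      show ?thesis
      proof (rule differentiable_bound_general[where f' = "\<lambda>s. f s x0" and \<phi>' = "\<lambda>s. C"])
        show "0 < t" using False 0 by simp
        show "continuous_on {0..t} (X 1)" by (rule continuous_on_subset[OF Xc]) (use 0 in auto)
        show "continuous_on {0..t} ((*) C)" by (intro continuous_intros)
        fix s assume s: "0 < s" "s < t"
        have "(X 1 has_vector_derivative f s x0) (at s within {0..1})"
          using der[of "X 0" s] s 0 by (simp add: XS X0)
        then show "(X 1 has_vector_derivative f s x0) (at s)"
          using s 0 by (simp add: at_within_Icc_at)
        show "((*) C has_vector_derivative C) (at s)" by (auto intro!: derivative_eq_intros)
        show "norm (f s x0) \<le> C" using C s 0 by simp
      qed
    qed simp
    moreover have "X 1 0 = x0" by (simp add: XS)
    moreover have "C * t \<le> C * exp (2 * L * t)"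
    proof (rule mult_left_mono)
      have "t \<le> 1" using 0 by simp
      also have "1 \<le> exp (2 * L * t)" using \<open>0 < L\<close> 0 by simp
      finally show "t \<le> exp (2 * L * t)" .
    qed (use \<open>0 < C\<close> in simp)
    ultimately show ?case by (simp add: X0)
  next
    case (Suc n)
    let ?\<phi> = "\<lambda>s. C * exp (2 * L * s) * (1/2) ^ Suc n"
    have "norm ((X (Suc (Suc n)) t - X (Suc n) t) - (X (Suc (Suc n)) 0 - X (Suc n) 0)) \<le> ?\<phi> t - ?\<phi> 0"
    proof (cases "t = 0")
      case False
      show ?thesis
      proof (rule differentiable_bound_general[where f = "\<lambda>s. X (Suc (Suc n)) s - X (Suc n) s"
            and f' = "\<lambda>s. f s (X (Suc n) s) - f s (X n s)" and \<phi>' = "\<lambda>s. L * (C * exp (2 * L * s) * (1/2) ^ n)"])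
        show "0 < t" using False Suc by simp
        show "continuous_on {0..t} (\<lambda>s. X (Suc (Suc n)) s - X (Suc n) s)"
          by (intro continuous_on_diff continuous_on_subset[OF Xc]) (use Suc in auto)
        show "continuous_on {0..t} ?\<phi>" by (intro continuous_intros)
        fix s assume s: "0 < s" "s < t"
        have "((\<lambda>s. X (Suc (Suc n)) s - X (Suc n) s) has_vector_derivative f s (X (Suc n) s) - f s (X n s)) (at s within {0..1})"
          by (intro has_vector_derivative_diff XD) (use s Suc.prems in auto)
        then show "((\<lambda>s. X (Suc (Suc n)) s - X (Suc n) s) has_vector_derivative f s (X (Suc n) s) - f s (X n s)) (at s)"
          using s Suc.prems by (simp add: at_within_Icc_at)
        show "(?\<phi> has_vector_derivative L * (C * exp (2 * L * s) * (1/2) ^ n)) (at s)"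
          by (auto intro!: derivative_eq_intros simp: has_real_derivative_iff_has_vector_derivative[symmetric])
        have "norm (f s (X (Suc n) s) - f s (X n s)) \<le> L * norm (X (Suc n) s - X n s)"
          by (rule lip) (use s Suc.prems in auto)
        also have "\<dots> \<le> L * (C * exp (2 * L * s) * (1/2) ^ n)"
          using Suc.IH[of s] s Suc.prems \<open>0 < L\<close> by (intro mult_left_mono) auto
        finally show "norm (f s (X (Suc n) s) - f s (X n s)) \<le> L * (C * exp (2 * L * s) * (1/2) ^ n)" .
      qed
    qed simp
    moreover have "X (Suc m) 0 = x0" for m by (simp add: XS)
    moreover have "0 \<le> ?\<phi> 0" using \<open>0 < C\<close> by simp
    ultimately show ?case by simp
  qed
  define M where "M n = C * exp (2 * L) * (1/2) ^ n" for n :: nat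
  have "uniform_limit {0..1} (\<lambda>n t. \<Sum>i<n. X (Suc i) t - X i t) (\<lambda>t. suminf (\<lambda>i. X (Suc i) t - X i t)) sequentially"
  proof (rule Weierstrass_m_test)
    show "summable M" unfolding M_def by (intro summable_mult summable_geometric) simp
    show "norm (X (Suc n) t - X n t) \<le> M n" if "t \<in> {0..1}" for n t
    proof -
      have "exp (2 * L * t) \<le> exp (2 * L)" using that \<open>0 < L\<close> by simp
      then have "C * exp (2 * L * t) * (1/2) ^ n \<le> M n" unfolding M_def using \<open>0 < C\<close> by simp
      then show ?thesis using step[OF that, of n] by linarith
    qed
  qed
  moreover have "(\<Sum>i<n. X (Suc i) t - X i t) = X n t - x0" for n t
    using sum_lessThan_telescope[of "\<lambda>i. X i t" n] by (simp add: X0)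
  ultimately have ul: "uniform_limit {0..1} (\<lambda>n t. X n t - x0) (\<lambda>t. suminf (\<lambda>i. X (Suc i) t - X i t)) sequentially"
    by simp
  define x where "x t = x0 + suminf (\<lambda>i. X (Suc i) t - X i t)" for t
  have ux: "uniform_limit {0..1} X x sequentially"
  proof -
    have "uniform_limit {0..1} (\<lambda>n t. x0 + (X n t - x0)) x sequentially"
      unfolding x_def by (intro uniform_limit_add uniform_limit_const ul)
    then show ?thesis by simp
  qed
  have xc: "continuous_on {0..1} x"
    by (rule uniform_limit_theorem[OF _ ux]) (simp_all add: Xc)
  \<comment> \<open>The Lipschitz bound carries uniform convergence over from the iterates to the
    integrands, so the integral equation passes to the limit.\<close>
  have uf: "uniform_limit {0..1} (\<lambda>n s. f s (X n s)) (\<lambda>s. f s (x s)) sequentially"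
  proof (rule uniform_limitI)
    fix e :: real assume "0 < e"
    have "\<forall>\<^sub>F n in sequentially. \<forall>s\<in>{0..1}. dist (X n s) (x s) < e / L"
      using uniform_limitD[OF ux, of "e / L"] \<open>0 < e\<close> \<open>0 < L\<close> by simp
    then show "\<forall>\<^sub>F n in sequentially. \<forall>s\<in>{0..1}. dist (f s (X n s)) (f s (x s)) < e"
    proof eventually_elim
      case (elim n)
      show ?case
      proof
        fix s :: real assume s: "s \<in> {0..1}"
        have "dist (f s (X n s)) (f s (x s)) \<le> L * dist (X n s) (x s)" using lip[OF s] by (simp add: dist_norm)
        also have "\<dots> < L * (e / L)" using elim s \<open>0 < L\<close> by (intro mult_strict_left_mono) auto
        finally show "dist (f s (X n s)) (f s (x s)) < e" using \<open>0 < L\<close> by simp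
      qed
    qed
  qed
  have xeq: "x t = x0 + integral {0..t} (\<lambda>s. f s (x s))" if t: "t \<in> {0..1}" for t
  proof -
    have u: "uniform_limit {0..t} (\<lambda>n s. f s (X n s)) (\<lambda>s. f s (x s)) sequentially"
      by (rule uniform_limit_on_subset[OF uf]) (use t in auto)
    have c: "continuous_on {0..t} (\<lambda>s. f s (X n s))" for n
      by (rule continuous_on_subset[OF comp[OF Xc]]) (use t in auto)
    obtain I J where I: "\<And>n. ((\<lambda>s. f s (X n s)) has_integral I n) {0..t}"
      and J: "((\<lambda>s. f s (x s)) has_integral J) {0..t}" and IJ: "I \<longlonglongrightarrow> J"
      by (rule uniform_limit_integral[OF u c]) auto
    have "(\<lambda>n. X (Suc n) t) = (\<lambda>n. x0 + I n)" by (simp add: XS integral_unique[OF I])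
    moreover have "(\<lambda>n. X (Suc n) t) \<longlonglongrightarrow> x t"
      using tendsto_uniform_limitI[OF ux t] by (rule LIMSEQ_Suc)
    ultimately have "(\<lambda>n. x0 + I n) \<longlonglongrightarrow> x t" by simp
    moreover have "(\<lambda>n. x0 + I n) \<longlonglongrightarrow> x0 + J" by (intro tendsto_intros IJ)
    ultimately have "x t = x0 + J" by (rule LIMSEQ_unique)
    then show ?thesis using integral_unique[OF J] by simp
  qed
  show thesis
  proof (rule that)
    show "x 0 = x0" using xeq[of 0] by simp
    show "(x has_vector_derivative f t (x t)) (at t within {0..1})" if "t \<in> {0..1}" for t
      by (rule has_vector_derivative_transform[OF that _ der[OF xc that]]) (use xeq in auto)
  qed
qed

section \<open>Dependence of solutions on the initial point\<close>

lemma compact_tube: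
  fixes x0 :: "real \<Rightarrow> 'e::euclidean_space"
  assumes U: "open U" and c: "continuous_on {0..1} x0" and sub: "\<And>t. t \<in> {0..1} \<Longrightarrow> x0 t \<in> U"
  obtains r where "0 < r" "\<And>t. t \<in> {0..1} \<Longrightarrow> cball (x0 t) r \<subseteq> U"
proof -
  have K: "compact (x0 ` {0..1})" by (intro compact_continuous_image c) auto
  have "x0 ` {0..1} \<noteq> {}" "x0 ` {0..1} \<subseteq> U" using sub by auto
  from compact_in_open_separated[OF this(1) K U this(2)]
  obtain e where e: "0 < e" "{x. infdist x (x0 ` {0..1}) \<le> e} \<subseteq> U" by metis
  show thesis
  proof (rule that[OF e(1)])
    fix t :: real assume t: "t \<in> {0..1}"
    show "cball (x0 t) e \<subseteq> U"
    proof
      fix y assume "y \<in> cball (x0 t) e"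
      then have "infdist y (x0 ` {0..1}) \<le> e"
        using infdist_le[of "x0 t" "x0 ` {0..1}" y] t by (auto simp: dist_commute)
      then show "y \<in> U" using e(2) by auto
    qed
  qed
qed

lemma linear_norm_bound_Basis:
  fixes h :: "'e::euclidean_space \<Rightarrow> 'f::real_normed_vector"
  assumes "linear h"
  shows "norm (h v) \<le> (\<Sum>i\<in>Basis. norm (h i)) * norm v"
proof -
  have "h v = (\<Sum>i\<in>Basis. (v \<bullet> i) *\<^sub>R h i)" by (rule linear_sum_Basis[OF assms])
  then have "norm (h v) \<le> (\<Sum>i\<in>Basis. norm ((v \<bullet> i) *\<^sub>R h i))" by (metis norm_sum)
  also have "\<dots> \<le> (\<Sum>i\<in>Basis. norm v * norm (h i))"
    by (intro sum_mono) (auto intro!: mult_right_mono Basis_le_norm)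
  finally show ?thesis by (simp add: sum_distrib_left mult.commute)
qed

text \<open>One radius \<open>d\<close> serves all times: the derivative of \<open>f\<close> is
  uniformly continuous near the compact trajectory, hence varies by at most \<open>e\<close> in a
  thin tube, and the mean value inequality turns this into the bound on the linearisation
  error.\<close>

lemma tube_linearization:
  fixes f :: "real \<Rightarrow> 'e::euclidean_space \<Rightarrow> 'e" and x0 :: "real \<Rightarrow> 'e"
  assumes U: "open U" and f: "pCk 1 f ({0..1} \<times> U)"
    and c: "continuous_on {0..1} x0" and sub: "\<And>t. t \<in> {0..1} \<Longrightarrow> x0 t \<in> U"
    and e: "0 < e"
  obtains d where "0 < d" "\<And>t. t \<in> {0..1} \<Longrightarrow> cball (x0 t) d \<subseteq> U"
    "\<And>t y. t \<in> {0..1} \<Longrightarrow> norm (y - x0 t) \<le> d \<Longrightarrow>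
      norm (f t y - f t (x0 t) - frechet_derivative (f t) (at (x0 t)) (y - x0 t)) \<le> e * norm (y - x0 t)"
proof -
  obtain r where r: "0 < r" "\<And>t. t \<in> {0..1} \<Longrightarrow> cball (x0 t) r \<subseteq> U"
    using compact_tube[OF U c sub] by blast
  have f1: "pCk (Suc 0) f ({0..1} \<times> U)" using f by (simp only: One_nat_def)
  define D where "D t y = frechet_derivative (f t) (at y)" for t y
  have D: "(f t has_derivative D t y) (at y)" if "t \<in> {0..1}" "y \<in> U" for t y
    unfolding D_def by (rule pCk_has_derivative[OF f1]) (use that in auto)
  have cD: "continuous_on ({0..1} \<times> U) (\<lambda>z. D (fst z) (snd z) i)" for i
    using pCk_continuous[OF pCk_SucD[OF f1], of i] by (simp add: D_def)
  \<comment> \<open>Measuring points from \<open>x0 t\<close> straightens the tube to a product,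
    whose compactness is immediate. Below, \<open>g\<close> bounds the oscillation of the derivative
    and vanishes at offset 0.\<close>
  let ?K = "{0..1} \<times> cball (0::'e) r"
  define g where "g z = (\<Sum>i\<in>Basis. norm (D (fst z) (x0 (fst z) + snd z) i - D (fst z) (x0 (fst z)) i))" for z
  have cx: "continuous_on ?K (\<lambda>z. x0 (fst z))"
    by (rule continuous_on_compose2[OF c]) (auto intro!: continuous_intros)
  have "continuous_on ?K (\<lambda>z. D (fst z) (x0 (fst z) + snd z) i)" for i
  proof -
    have "continuous_on ?K (\<lambda>z. (fst z, x0 (fst z) + snd z))" by (intro continuous_intros cx)
    moreover have "(\<lambda>z. (fst z, x0 (fst z) + snd z)) ` ?K \<subseteq> {0..1} \<times> U"
      using r(2) by (fastforce simp: dist_norm)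
    ultimately show ?thesis using continuous_on_compose2[OF cD] by fastforce
  qed
  moreover have "continuous_on ?K (\<lambda>z. D (fst z) (x0 (fst z)) i)" for i
  proof -
    have "continuous_on ?K (\<lambda>z. (fst z, x0 (fst z)))" by (intro continuous_intros cx)
    moreover have "(\<lambda>z. (fst z, x0 (fst z))) ` ?K \<subseteq> {0..1} \<times> U" using sub by auto
    ultimately show ?thesis using continuous_on_compose2[OF cD] by fastforce
  qed
  ultimately have "continuous_on ?K g" unfolding g_def by (intro continuous_intros)
  then have "uniformly_continuous_on ?K g"
    by (intro compact_uniformly_continuous compact_Times) auto
  then obtain d where d: "0 < d" "\<And>z z'. z \<in> ?K \<Longrightarrow> z' \<in> ?K \<Longrightarrow> dist z' z < d \<Longrightarrow> dist (g z') (g z) < e"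
    using e unfolding uniformly_continuous_on_def by metis
  define d' where "d' = min r (d / 2)"
  have d': "0 < d'" "d' \<le> r" "d' < d" using r d by (auto simp: d'_def)
  have gD: "onorm (\<lambda>v. D t y v - D t (x0 t) v) \<le> e" if t: "t \<in> {0..1}" and y: "y \<in> cball (x0 t) d'" for t y
  proof (rule onorm_bound)
    fix v
    have yU: "y \<in> U" using y r(2)[OF t] d' by auto
    have lin: "linear (\<lambda>v. D t y v - D t (x0 t) v)"
      by (intro linear_compose_sub has_derivative_linear[OF D] t sub yU)
    have "norm (D t y v - D t (x0 t) v) \<le> g (t, y - x0 t) * norm v"
      using linear_norm_bound_Basis[OF lin, of v] by (simp add: g_def)
    moreover have "g (t, y - x0 t) < e"
    proof -
      have "dist (g (t, y - x0 t)) (g (t, 0)) < e"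
        by (rule d(2)) (use t y d' r in \<open>auto simp: dist_norm norm_minus_commute dist_Pair_Pair\<close>)
      moreover have "g (t, 0) = 0" by (simp add: g_def)
      ultimately show ?thesis by (simp add: dist_real_def)
    qed
    ultimately show "norm (D t y v - D t (x0 t) v) \<le> e * norm v"
      by (smt (verit) mult_right_mono norm_ge_zero)
  qed (use e in simp)
  show thesis
  proof (rule that[OF d'(1)])
    fix t :: real assume t: "t \<in> {0..1}"
    show sub': "cball (x0 t) d' \<subseteq> U" using r(2)[OF t] d' by auto
    fix y assume y: "norm (y - x0 t) \<le> d'"
    have "norm (f t y - f t (x0 t) - D t (x0 t) (y - x0 t)) \<le> norm (y - x0 t) * e"
    proof (rule differentiable_bound_linearization[where S = "cball (x0 t) d'" and f' = "D t"])
      show "x0 t + s *\<^sub>R (y - x0 t) \<in> cball (x0 t) d'" if "s \<in> {0..1}" for s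
        using that y mult_mono[of s 1 "norm (y - x0 t)" d'] d' by (auto simp: dist_norm)
      show "(f t has_derivative D t z) (at z within cball (x0 t) d')" if "z \<in> cball (x0 t) d'" for z
        by (rule has_derivative_at_withinI[OF D[OF t]]) (use that sub' in auto)
      show "onorm (D t z - D t (x0 t)) \<le> e" if "z \<in> cball (x0 t) d'" for z
        using gD[OF t that] by (simp add: fun_diff_def)
    qed (use d' in auto)
    then show "norm (f t y - f t (x0 t) - frechet_derivative (f t) (at (x0 t)) (y - x0 t)) \<le> e * norm (y - x0 t)"
      by (simp add: D_def mult.commute)
  qed
qed

lemma tube_derivative_bound:
  fixes f :: "real \<Rightarrow> 'e::euclidean_space \<Rightarrow> 'e" and x0 :: "real \<Rightarrow> 'e"
  assumes f: "pCk 1 f ({0..1} \<times> U)"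
    and c: "continuous_on {0..1} x0" and sub: "\<And>t. t \<in> {0..1} \<Longrightarrow> x0 t \<in> U"
  obtains B where "0 < B" "\<And>t v. t \<in> {0..1} \<Longrightarrow> norm (frechet_derivative (f t) (at (x0 t)) v) \<le> B * norm v"
proof -
  have f1: "pCk (Suc 0) f ({0..1} \<times> U)" using f by (simp only: One_nat_def)
  define g where "g t = (\<Sum>i\<in>Basis. norm (frechet_derivative (f t) (at (x0 t)) i))" for t
  have p: "continuous_on {0..1} (\<lambda>t. (t, x0 t))" by (intro continuous_intros c)
  have "(\<lambda>t. (t, x0 t)) ` {0..1} \<subseteq> {0..1} \<times> U" using sub by auto
  from continuous_on_compose2[OF pCk_continuous[OF pCk_SucD[OF f1]] p this]
  have "continuous_on {0..1} g" unfolding g_def by (intro continuous_intros) auto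
  then have "compact (g ` {0..1})" by (intro compact_continuous_image) auto
  then obtain B where B: "0 < B" "\<And>t. t \<in> {0..1} \<Longrightarrow> norm (g t) \<le> B"
    using compact_imp_bounded bounded_pos by (metis (no_types, lifting) image_eqI)
  show thesis
  proof (rule that[OF B(1)])
    fix t :: real and v assume t: "t \<in> {0..1}"
    have "linear (frechet_derivative (f t) (at (x0 t)))"
      by (rule has_derivative_linear[OF pCk_has_derivative[OF f1]]) (use t sub in auto)
    from linear_norm_bound_Basis[OF this, of v]
    have "norm (frechet_derivative (f t) (at (x0 t)) v) \<le> g t * norm v" by (simp add: g_def)
    also have "\<dots> \<le> B * norm v" using B(2)[OF t] by (intro mult_right_mono) auto
    finally show "norm (frechet_derivative (f t) (at (x0 t)) v) \<le> B * norm v" .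
  qed
qed

text \<open>A solution starting close to \<open>x0\<close> cannot leave
  the tube on which \<open>f\<close> is Lipschitz.\<close>

lemma ode_continuous_dependence:
  fixes f :: "real \<Rightarrow> 'e::euclidean_space \<Rightarrow> 'e" and x0 :: "real \<Rightarrow> 'e"
  assumes U: "open U" and f: "pCk 1 f ({0..1} \<times> U)"
    and x0: "\<And>t. t \<in> {0..1} \<Longrightarrow> (x0 has_vector_derivative f t (x0 t)) (at t within {0..1})"
    and sub: "\<And>t. t \<in> {0..1} \<Longrightarrow> x0 t \<in> U"
  obtains M \<rho> where "0 < M" "0 < \<rho>"
    "\<And>x t. (\<And>t. t \<in> {0..1} \<Longrightarrow> (x has_vector_derivative f t (x t)) (at t within {0..1})) \<Longrightarrow>
      norm (x 0 - x0 0) < \<rho> \<Longrightarrow> t \<in> {0..1} \<Longrightarrow> norm (x t - x0 t) \<le> M * norm (x 0 - x0 0)"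
proof -
  have c0: "continuous_on {0..1} x0" by (rule continuous_on_vector_derivative[OF x0])
  obtain d where d: "0 < d" "\<And>t y. t \<in> {0..1} \<Longrightarrow> norm (y - x0 t) \<le> d \<Longrightarrow>
      norm (f t y - f t (x0 t) - frechet_derivative (f t) (at (x0 t)) (y - x0 t)) \<le> 1 * norm (y - x0 t)"
    by (rule tube_linearization[OF U f c0 sub, of 1]) auto
  obtain B where B: "0 < B" "\<And>t v. t \<in> {0..1} \<Longrightarrow> norm (frechet_derivative (f t) (at (x0 t)) v) \<le> B * norm v"
    using tube_derivative_bound[OF f c0 sub] by blast
  define L where "L = B + 1"
  have L: "norm (f t y - f t (x0 t)) \<le> L * norm (y - x0 t)" if "t \<in> {0..1}" "norm (y - x0 t) \<le> d" for t y
    using d(2)[OF that] B(2)[OF that(1), of "y - x0 t"]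
      norm_triangle_sub[of "f t y - f t (x0 t)" "frechet_derivative (f t) (at (x0 t)) (y - x0 t)"]
    by (simp add: L_def algebra_simps)
  have "0 \<le> L" using B by (simp add: L_def)
  define M where "M = exp (2 * L + 1)"
  have M: "0 < M" "1 \<le> M" using \<open>0 \<le> L\<close> by (simp_all add: M_def)
  \<comment> \<open>\<open>M\<close> is the growth factor from Gronwall's inequality over
    \<open>{0..1}\<close>. A solution that starts closer than \<open>d / M\<close> is kept by it
    strictly inside the tube of radius \<open>d\<close>.\<close>
  show thesis
  proof (rule that[of M "d / M"])
    show "0 < d / M" using d M by simp
    fix x and t :: real
    assume x: "\<And>t. t \<in> {0..1} \<Longrightarrow> (x has_vector_derivative f t (x t)) (at t within {0..1})"
      and close: "norm (x 0 - x0 0) < d / M" and t: "t \<in> {0..1}"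
    define w where "w t = x t - x0 t" for t
    have M0: "M * norm (w 0) < d" using close M by (simp add: w_def field_simps)
    have gw: "norm (w s) \<le> M * norm (w 0)"
      if T: "T \<in> {0..1}" "\<And>s. s \<in> {0..T} \<Longrightarrow> norm (w s) \<le> d" and s: "s \<in> {0..T}" for T s
    proof -
      have "norm (w s) \<le> (norm (w 0) + 0) * exp ((2 * L + 1) * s)"
      proof (rule gronwall[where T = T and w' = "\<lambda>s. f s (x s) - f s (x0 s)"])
        fix r assume r: "r \<in> {0..T}"
        then have r1: "r \<in> {0..1}" using T by auto
        show "(w has_vector_derivative f r (x r) - f r (x0 r)) (at r within {0..T})"
          unfolding w_def using T
          by (intro has_vector_derivative_diff has_vector_derivative_within_subset[OF x[OF r1]]
              has_vector_derivative_within_subset[OF x0[OF r1]]) auto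
        show "norm (f r (x r) - f r (x0 r)) \<le> L * norm (w r) + 0"
          using L[OF r1, of "x r"] T(2)[OF r] by (simp add: w_def)
      qed (use s \<open>0 \<le> L\<close> in auto)
      also have "\<dots> \<le> norm (w 0) * M"
      proof -
        have "(2 * L + 1) * s \<le> (2 * L + 1) * 1" using s T \<open>0 \<le> L\<close> by (intro mult_left_mono) auto
        then show ?thesis by (auto simp: M_def intro!: mult_left_mono)
      qed
      finally show ?thesis by (simp add: mult.commute)
    qed
    have cw: "continuous_on {0..1} (\<lambda>t. norm (w t))"
      unfolding w_def by (intro continuous_intros c0 continuous_on_vector_derivative[OF x])
    have "norm (w s) < d" if s: "s \<in> {0..1}" for s
    proof (rule ccontr)
      assume far: "\<not> norm (w s) < d"
      have w0: "norm (w 0) < d" using M0 M mult_right_mono[of 1 M "norm (w 0)"] by simp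
      have ivt: "\<exists>r\<in>{0..s}. norm (w r) = d" if "s \<in> {0..1}" "d \<le> norm (w s)" for s
      proof -
        have "\<exists>r. 0 \<le> r \<and> r \<le> s \<and> norm (w r) = d"
          by (rule IVT') (use that w0 in \<open>auto intro: continuous_on_subset[OF cw]\<close>)
        then show ?thesis by auto
      qed
      let ?S = "{r \<in> {0..1}. norm (w r) = d}"
      have "?S = {0..1} \<inter> (\<lambda>t. norm (w t)) -` {d}" by auto
      then have "closed ?S" using continuous_closed_preimage[OF cw, of "{d}"] by simp
      then have cS: "compact ?S" by (intro compact_eq_bounded_closed[THEN iffD2] conjI) (auto intro: bounded_subset[of "{0..1}"])
      have "?S \<noteq> {}" using ivt[OF s] far s by force
      \<comment> \<open>\<open>\<tau>\<close> is the first time at distance \<open>d\<close>. Up to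
        then the Lipschitz bound of the tube is available, and Gronwall's inequality at
        \<open>\<tau>\<close> gives a distance below \<open>d\<close>.\<close>
      from compact_attains_inf[OF cS this] obtain \<tau> where \<tau>: "\<tau> \<in> ?S" "\<And>r. r \<in> ?S \<Longrightarrow> \<tau> \<le> r"
        by blast
      have "norm (w r) \<le> d" if r: "r \<in> {0..\<tau>}" for r
      proof (rule ccontr)
        assume n: "\<not> norm (w r) \<le> d"
        obtain q where q: "q \<in> {0..r}" "norm (w q) = d" using ivt[of r] n r \<tau>(1) by force
        then have "\<tau> \<le> q" using \<tau> r by auto
        then have "q = r" using q r by auto
        then show False using q n by simp
      qed
      then have "norm (w \<tau>) \<le> M * norm (w 0)" using \<tau>(1) gw[of \<tau> \<tau>] by simp
      then show False using M0 \<tau>(1) by simp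
    qed
    then have "norm (w t) \<le> M * norm (w 0)" using gw[of 1 t] t by (simp add: less_imp_le)
    then show "norm (x t - x0 t) \<le> M * norm (x 0 - x0 0)" by (simp add: w_def)
  qed (use M in simp)
qed

text \<open>The initial point \<open>x 0 z\<close> may be any differentiable function of the
  parameter \<open>z\<close>, not just \<open>z\<close> itself: later \<open>z\<close> ranges over a
  chart of smaller dimension than the space in which the equation lives.\<close>

lemma flow_locally_lipschitz:
  fixes f :: "real \<Rightarrow> 'e::euclidean_space \<Rightarrow> 'e" and x :: "real \<Rightarrow> 'z::euclidean_space \<Rightarrow> 'e"
  assumes U: "open U" and Z: "open Z" and f: "pCk 1 f ({0..1} \<times> U)"
    and sol: "\<And>z t. z \<in> Z \<Longrightarrow> t \<in> {0..1} \<Longrightarrow> ((\<lambda>t. x t z) has_vector_derivative f t (x t z)) (at t within {0..1})"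
    and sub: "\<And>z t. z \<in> Z \<Longrightarrow> t \<in> {0..1} \<Longrightarrow> x t z \<in> U"
    and z: "z \<in> Z" and init: "x 0 differentiable (at z)"
  obtains C \<rho> where "0 < C" "0 < \<rho>" "ball z \<rho> \<subseteq> Z"
    "\<And>y t. y \<in> ball z \<rho> \<Longrightarrow> t \<in> {0..1} \<Longrightarrow> norm (x t y - x t z) \<le> C * norm (y - z)"
proof -
  obtain M \<rho> where M: "0 < M" "0 < \<rho>"
    "\<And>y t. (\<And>t. t \<in> {0..1} \<Longrightarrow> (y has_vector_derivative f t (y t)) (at t within {0..1})) \<Longrightarrow>
      norm (y 0 - x 0 z) < \<rho> \<Longrightarrow> t \<in> {0..1} \<Longrightarrow> norm (y t - x t z) \<le> M * norm (y 0 - x 0 z)"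
    by (rule ode_continuous_dependence[OF U f sol[OF z] sub[OF z]]) blast+
  obtain D where D: "(x 0 has_derivative D) (at z)" using init by (auto simp: differentiable_def)
  obtain B where B: "0 < B" "\<And>h. norm (D h) \<le> B * norm h"
    using bounded_linear.pos_bounded[OF has_derivative_bounded_linear[OF D]] by (metis mult.commute)
  obtain d where d: "0 < d" "\<And>y. norm (y - z) < d \<Longrightarrow> norm (x 0 y - x 0 z - D (y - z)) \<le> 1 * norm (y - z)"
    using D unfolding has_derivative_at_alt by (metis zero_less_one)
  have lip0: "norm (x 0 y - x 0 z) \<le> (B + 1) * norm (y - z)" if "norm (y - z) < d" for y
    using d(2)[OF that] B(2)[of "y - z"] norm_triangle_sub[of "x 0 y - x 0 z" "D (y - z)"]
    by (simp add: algebra_simps)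
  obtain r where r: "0 < r" "ball z r \<subseteq> Z" using Z z open_contains_ball by blast
  define \<eta> where "\<eta> = min r (min d (\<rho> / (B + 1)))"
  show thesis
  proof (rule that[of "M * (B + 1)" \<eta>])
    show "0 < \<eta>" "ball z \<eta> \<subseteq> Z" using r d M B by (auto simp: \<eta>_def)
    fix y and t :: real assume y: "y \<in> ball z \<eta>" and t: "t \<in> {0..1}"
    have yd: "norm (y - z) < d" "norm (y - z) < \<rho> / (B + 1)" and yZ: "y \<in> Z"
      using y r by (auto simp: \<eta>_def dist_norm norm_minus_commute)
    have "(B + 1) * norm (y - z) < \<rho>" using yd B by (simp add: field_simps)
    with lip0[OF yd(1)] have "norm (x 0 y - x 0 z) < \<rho>" by linarith
    then have "norm (x t y - x t z) \<le> M * norm (x 0 y - x 0 z)"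
      using M(3)[of "\<lambda>t. x t y" t] sol[OF yZ] t by blast
    also have "\<dots> \<le> M * ((B + 1) * norm (y - z))" using lip0[OF yd(1)] M by (intro mult_left_mono) auto
    finally show "norm (x t y - x t z) \<le> M * (B + 1) * norm (y - z)" by (simp add: mult.assoc)
  qed (use M B in simp)
qed

lemma continuous_on_Times_uniform:
  fixes x :: "real \<Rightarrow> 'z::metric_space \<Rightarrow> 'e::metric_space"
  assumes ct: "\<And>z. z \<in> Z \<Longrightarrow> continuous_on T (\<lambda>t. x t z)"
    and cz: "\<And>z e. z \<in> Z \<Longrightarrow> 0 < e \<Longrightarrow> \<exists>d>0. \<forall>y\<in>Z. dist y z < d \<longrightarrow> (\<forall>t\<in>T. dist (x t y) (x t z) < e)"
  shows "continuous_on (T \<times> Z) (\<lambda>p. x (fst p) (snd p))"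
  unfolding continuous_on_iff
proof (intro ballI allI impI)
  fix p and e :: real assume p: "p \<in> T \<times> Z" and e: "0 < e"
  obtain t z where tz: "p = (t, z)" "t \<in> T" "z \<in> Z" using p by auto
  obtain d1 where d1: "0 < d1" "\<And>s. s \<in> T \<Longrightarrow> dist s t < d1 \<Longrightarrow> dist (x s z) (x t z) < e / 2"
    using ct[OF tz(3)] tz(2) e unfolding continuous_on_iff by (meson half_gt_zero)
  obtain d2 where d2: "0 < d2" "\<And>y s. y \<in> Z \<Longrightarrow> dist y z < d2 \<Longrightarrow> s \<in> T \<Longrightarrow> dist (x s y) (x s z) < e / 2"
    using cz[OF tz(3), of "e / 2"] e by auto
  show "\<exists>d>0. \<forall>q\<in>T \<times> Z. dist q p < d \<longrightarrow> dist (x (fst q) (snd q)) (x (fst p) (snd p)) < e"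
  proof (intro exI[of _ "min d1 d2"] conjI ballI impI)
    show "0 < min d1 d2" using d1 d2 by simp
    fix q assume q: "q \<in> T \<times> Z" "dist q p < min d1 d2"
    obtain s y where sy: "q = (s, y)" "s \<in> T" "y \<in> Z" using q by auto
    have "dist s t \<le> dist q p" "dist y z \<le> dist q p"
      using dist_fst_le[of q p] dist_snd_le[of q p] by (simp_all add: sy tz)
    then have "dist (x s y) (x s z) < e / 2" "dist (x s z) (x t z) < e / 2"
      using d1(2)[OF sy(2)] d2(2)[OF sy(3) _ sy(2)] q(2) by auto
    then show "dist (x (fst q) (snd q)) (x (fst p) (snd p)) < e"
      using dist_triangle[of "x s y" "x t z" "x s z"] by (simp add: sy tz)
  qed
qed

lemma flow_continuous:
  fixes f :: "real \<Rightarrow> 'e::euclidean_space \<Rightarrow> 'e" and x :: "real \<Rightarrow> 'z::euclidean_space \<Rightarrow> 'e"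
  assumes U: "open U" and Z: "open Z" and f: "pCk 1 f ({0..1} \<times> U)"
    and sol: "\<And>z t. z \<in> Z \<Longrightarrow> t \<in> {0..1} \<Longrightarrow> ((\<lambda>t. x t z) has_vector_derivative f t (x t z)) (at t within {0..1})"
    and sub: "\<And>z t. z \<in> Z \<Longrightarrow> t \<in> {0..1} \<Longrightarrow> x t z \<in> U"
    and init: "\<And>z. z \<in> Z \<Longrightarrow> x 0 differentiable (at z)"
  shows "continuous_on ({0..1} \<times> Z) (\<lambda>p. x (fst p) (snd p))"
proof (rule continuous_on_Times_uniform)
  show "continuous_on {0..1} (\<lambda>t. x t z)" if "z \<in> Z" for z
    by (rule continuous_on_vector_derivative[OF sol[OF that]])
  fix z and e :: real assume z: "z \<in> Z" and e: "0 < e"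
  obtain C \<rho> where C: "0 < C" "0 < \<rho>" "ball z \<rho> \<subseteq> Z"
    "\<And>y t. y \<in> ball z \<rho> \<Longrightarrow> t \<in> {0..1} \<Longrightarrow> norm (x t y - x t z) \<le> C * norm (y - z)"
    using flow_locally_lipschitz[OF U Z f sol sub z init[OF z]] by blast
  show "\<exists>d>0. \<forall>y\<in>Z. dist y z < d \<longrightarrow> (\<forall>t\<in>{0..1}. dist (x t y) (x t z) < e)"
  proof (intro exI[of _ "min \<rho> (e / C)"] conjI ballI impI)
    show "0 < min \<rho> (e / C)" using C e by simp
    fix y and t :: real assume y: "dist y z < min \<rho> (e / C)" and t: "t \<in> {0..1}"
    have "norm (x t y - x t z) \<le> C * norm (y - z)"
      by (rule C(4)) (use y t in \<open>auto simp: dist_commute\<close>)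
    also have "\<dots> < C * (e / C)" using y C(1) by (intro mult_strict_left_mono) (auto simp: dist_norm)
    finally show "dist (x t y) (x t z) < e" using C(1) by (simp add: dist_norm)
  qed
qed

text \<open>The candidate \<open>Y\<close> for the derivative solves the variational equation. The
  remainder \<open>x t y - x t z - Y t (y - z)\<close> satisfies the same linear equation up to an
  error that is small compared with \<open>y - z\<close>, and Gronwall's inequality bounds
  it.\<close>

lemma flow_differentiable:
  fixes f :: "real \<Rightarrow> 'e::euclidean_space \<Rightarrow> 'e" and x :: "real \<Rightarrow> 'z::euclidean_space \<Rightarrow> 'e"
  assumes U: "open U" and Z: "open Z" and f: "pCk 1 f ({0..1} \<times> U)"
    and sol: "\<And>z t. z \<in> Z \<Longrightarrow> t \<in> {0..1} \<Longrightarrow> ((\<lambda>t. x t z) has_vector_derivative f t (x t z)) (at t within {0..1})"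
    and sub: "\<And>z t. z \<in> Z \<Longrightarrow> t \<in> {0..1} \<Longrightarrow> x t z \<in> U"
    and z: "z \<in> Z" and init: "x 0 differentiable (at z)"
  obtains Y where "\<And>t. t \<in> {0..1} \<Longrightarrow> (x t has_derivative Y t) (at z)"
    "\<And>t v. t \<in> {0..1} \<Longrightarrow>
      ((\<lambda>t. Y t v) has_vector_derivative frechet_derivative (f t) (at (x t z)) (Y t v)) (at t within {0..1})"
proof -
  have f1: "pCk (Suc 0) f ({0..1} \<times> U)" using f by (simp only: One_nat_def)
  define A where "A t = frechet_derivative (f t) (at (x t z))" for t
  have linA: "linear (A t)" if "t \<in> {0..1}" for t
    unfolding A_def by (rule has_derivative_linear[OF pCk_has_derivative[OF f1]]) (use that sub z in auto)
  have cx: "continuous_on {0..1} (\<lambda>t. x t z)" by (rule continuous_on_vector_derivative[OF sol[OF z]])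
  obtain B where B: "0 < B" "\<And>t v. t \<in> {0..1} \<Longrightarrow> norm (A t v) \<le> B * norm v"
    using tube_derivative_bound[OF f cx sub[OF z]] unfolding A_def by blast
  obtain D where D: "(x 0 has_derivative D) (at z)" using init by (auto simp: differentiable_def)
  have linD: "linear D" by (rule has_derivative_linear[OF D])
  have cA: "continuous_on ({0..1} \<times> UNIV) (\<lambda>p. A (fst p) (snd p))"
  proof -
    have p: "continuous_on ({0..1} \<times> (UNIV::'e set)) (\<lambda>p. (fst p, x (fst p) z))"
      by (intro continuous_on_Pair continuous_intros continuous_on_compose2[OF cx]) auto
    have "(\<lambda>p. (fst p, x (fst p) z)) ` ({0..1} \<times> (UNIV::'e set)) \<subseteq> {0..1} \<times> U" using sub z by auto
    from continuous_on_compose2[OF pCk_continuous[OF pCk_SucD[OF f1]] p this]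
    have "continuous_on ({0..1} \<times> (UNIV::'e set)) (\<lambda>p. A (fst p) i)" for i by (simp add: A_def)
    then have "continuous_on ({0..1} \<times> (UNIV::'e set)) (\<lambda>p. \<Sum>i\<in>Basis. (snd p \<bullet> i) *\<^sub>R A (fst p) i)"
      by (intro continuous_intros)
    then show ?thesis
      by (rule continuous_on_eq) (use linear_sum_Basis[OF linA] in force)
  qed
  have "\<exists>u. u 0 = D i \<and> (\<forall>t\<in>{0..1}. (u has_vector_derivative A t (u t)) (at t within {0..1}))" for i
  proof -
    have "norm (A t a - A t b) \<le> B * norm (a - b)" if "t \<in> {0..1}" for t a b
      using B(2)[OF that, of "a - b"] linear_diff[OF linA[OF that]] by simp
    then show ?thesis using picard_lindelof[OF cA _ B(1), of "D i"] by metis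
  qed
  then obtain u where u: "\<And>i. u i 0 = D i"
    "\<And>i t. t \<in> {0..1} \<Longrightarrow> (u i has_vector_derivative A t (u i t)) (at t within {0..1})" by metis
  \<comment> \<open>Combining the solutions for the basis directions makes \<open>Y t\<close> linear
    by construction.\<close>
  define Y where "Y t v = (\<Sum>i\<in>Basis. (v \<bullet> i) *\<^sub>R u i t)" for t and v :: 'z
  have linY: "linear (Y t)" for t
    unfolding Y_def by (rule linearI) (simp_all add: inner_add_left scaleR_add_left sum.distrib scaleR_sum_right)
  have Yd: "((\<lambda>t. Y t v) has_vector_derivative A t (Y t v)) (at t within {0..1})" if t: "t \<in> {0..1}" for t v
  proof -
    have "((\<lambda>t. Y t v) has_vector_derivative (\<Sum>i\<in>Basis. (v \<bullet> i) *\<^sub>R A t (u i t))) (at t within {0..1})"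
      unfolding Y_def by (intro has_vector_derivative_sum) (auto intro!: derivative_eq_intros u(2)[OF t])
    then show ?thesis by (simp add: Y_def linear_sum[OF linA[OF t]] linear_cmul[OF linA[OF t]])
  qed
  have Y0: "Y 0 v = D v" for v
    using linear_sum_Basis[OF linD, of v] by (simp add: Y_def u)
  obtain C \<rho> where C: "0 < C" "0 < \<rho>" "ball z \<rho> \<subseteq> Z"
    "\<And>y t. y \<in> ball z \<rho> \<Longrightarrow> t \<in> {0..1} \<Longrightarrow> norm (x t y - x t z) \<le> C * norm (y - z)"
    using flow_locally_lipschitz[OF U Z f sol sub z init] by blast
  have der: "(x t has_derivative Y t) (at z)" if t: "t \<in> {0..1}" for t
    unfolding has_derivative_at_alt
  proof (intro conjI allI impI)
    show "bounded_linear (Y t)" using linY by (simp add: linear_conv_bounded_linear)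
    fix e :: real assume e: "0 < e"
    define K where "K = exp (2 * B + 1)"
    have K: "0 < K" by (simp add: K_def)
    \<comment> \<open>In the final bound \<open>e'\<close> stems from the initial remainder,
      \<open>e' * C\<close> from the linearisation error of the field along the two trajectories,
      and \<open>K\<close> is Gronwall's factor on \<open>{0..1}\<close>; together they give
      \<open>e\<close>.\<close>
    define e' where "e' = e / ((1 + C) * K)"
    have e': "0 < e'" using e C K by (simp add: e'_def)
    obtain d1 where d1: "0 < d1" "\<And>t y. t \<in> {0..1} \<Longrightarrow> norm (y - x t z) \<le> d1 \<Longrightarrow>
      norm (f t y - f t (x t z) - frechet_derivative (f t) (at (x t z)) (y - x t z)) \<le> e' * norm (y - x t z)"
      by (rule tube_linearization[OF U f cx sub[OF z] e']) auto
    obtain d2 where d2: "0 < d2" "\<And>y. norm (y - z) < d2 \<Longrightarrow> norm (x 0 y - x 0 z - D (y - z)) \<le> e' * norm (y - z)"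
      using D e' unfolding has_derivative_at_alt by metis
    define d where "d = min \<rho> (min d2 (d1 / C))"
    have "norm (x t y - x t z - Y t (y - z)) \<le> e * norm (y - z)" if y: "norm (y - z) < d" for y
    proof -
      have yb: "y \<in> ball z \<rho>" using y by (simp add: d_def dist_norm norm_minus_commute)
      then have yZ: "y \<in> Z" using C by auto
      define w where "w t = x t y - x t z - Y t (y - z)" for t
      have "norm (w t) \<le> (norm (w 0) + e' * C * norm (y - z)) * exp ((2 * B + 1) * t)"
      proof (rule gronwall[where T = 1 and w' = "\<lambda>t. f t (x t y) - f t (x t z) - A t (Y t (y - z))"])
        fix s :: real assume s: "s \<in> {0..1}"
        show "(w has_vector_derivative f s (x s y) - f s (x s z) - A s (Y s (y - z))) (at s within {0..1})"
          unfolding w_def by (intro has_vector_derivative_diff sol yZ z s Yd)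
        have l: "norm (x s y - x s z) \<le> C * norm (y - z)" by (rule C(4)[OF yb s])
        also have "C * norm (y - z) \<le> d1" using y C(1) by (simp add: d_def field_simps)
        finally have "norm (f s (x s y) - f s (x s z) - A s (x s y - x s z)) \<le> e' * norm (x s y - x s z)"
          unfolding A_def by (rule d1(2)[OF s])
        also have "\<dots> \<le> e' * (C * norm (y - z))" using l e' by (intro mult_left_mono) auto
        finally have 1: "norm (f s (x s y) - f s (x s z) - A s (x s y - x s z)) \<le> e' * C * norm (y - z)" by simp
        have "f s (x s y) - f s (x s z) - A s (Y s (y - z)) =
            (f s (x s y) - f s (x s z) - A s (x s y - x s z)) + A s (w s)"
          by (simp add: w_def linear_diff[OF linA[OF s]])
        then have "norm (f s (x s y) - f s (x s z) - A s (Y s (y - z))) \<le>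
            norm (f s (x s y) - f s (x s z) - A s (x s y - x s z)) + norm (A s (w s))"
          by (simp only: norm_triangle_ineq)
        with 1 B(2)[OF s, of "w s"]
        show "norm (f s (x s y) - f s (x s z) - A s (Y s (y - z))) \<le> B * norm (w s) + e' * C * norm (y - z)"
          by linarith
      qed (use t B e' C in auto)
      also have "\<dots> \<le> (e' * norm (y - z) + e' * C * norm (y - z)) * K"
      proof (intro mult_mono add_mono)
        show "norm (w 0) \<le> e' * norm (y - z)" using d2(2)[of y] y by (simp add: w_def Y0 d_def)
        have "(2 * B + 1) * t \<le> (2 * B + 1) * 1" using t B by (intro mult_left_mono) auto
        then show "exp ((2 * B + 1) * t) \<le> K" by (simp add: K_def)
      qed (use e' C in auto)
      also have "\<dots> = e' * ((1 + C) * K) * norm (y - z)" by (simp add: algebra_simps)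
      also have "\<dots> = e * norm (y - z)" using C K by (simp add: e'_def)
      finally show ?thesis by (simp add: w_def)
    qed
    moreover have "0 < d" using C d1 d2 by (simp add: d_def)
    ultimately show "\<exists>d>0. \<forall>y. norm (y - z) < d \<longrightarrow> norm (x t y - x t z - Y t (y - z)) \<le> e * norm (y - z)" by blast
  qed
  show thesis by (rule that[OF der]) (use Yd in \<open>auto simp: A_def\<close>)
qed

section \<open>Smooth dependence on parameters\<close>

text \<open>Base case for linear equations, where the coefficients are merely continuous and the
  results on continuously differentiable fields do not apply. Gronwall's inequality is used for the
  difference of two solutions, whose forcing term measures how the coefficients vary against the
  fixed solution at \<open>z\<close>.\<close>

lemma linear_ode_continuous:
  fixes u :: "real \<Rightarrow> 'z::euclidean_space \<Rightarrow> 'e::euclidean_space"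
    and a :: "'e \<Rightarrow> real \<Rightarrow> 'z \<Rightarrow> 'e"
  assumes Z: "open Z"
    and a: "\<And>i. i \<in> Basis \<Longrightarrow> continuous_on ({0..1} \<times> Z) (\<lambda>p. a i (fst p) (snd p))"
    and b: "continuous_on ({0..1} \<times> Z) (\<lambda>p. b (fst p) (snd p))"
    and u0: "continuous_on Z (u 0)"
    and sol: "\<And>z t. z \<in> Z \<Longrightarrow> t \<in> {0..1} \<Longrightarrow>
      ((\<lambda>t. u t z) has_vector_derivative (\<Sum>i\<in>Basis. (u t z \<bullet> i) *\<^sub>R a i t z) + b t z) (at t within {0..1})"
  shows "continuous_on ({0..1} \<times> Z) (\<lambda>p. u (fst p) (snd p))"
proof (rule continuous_on_Times_uniform)
  show cu: "continuous_on {0..1} (\<lambda>t. u t z)" if "z \<in> Z" for z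
    by (rule continuous_on_vector_derivative[OF sol[OF that]])
  fix z and e :: real assume z: "z \<in> Z" and e: "0 < e"
  obtain r where r: "0 < r" "cball z r \<subseteq> Z" using Z z open_contains_cball by blast
  let ?K = "{0..1::real} \<times> cball z r"
  have K: "compact ?K" by (intro compact_Times) auto
  have K_sub: "?K \<subseteq> {0..1} \<times> Z" using r by auto
  have slice: "continuous_on ?K (\<lambda>p. h (fst p) z)" if "continuous_on ({0..1} \<times> Z) (\<lambda>p. h (fst p) (snd p))"
    for h :: "real \<Rightarrow> 'z \<Rightarrow> 'e"
  proof -
    have "continuous_on ?K (\<lambda>p. (fst p, z))" by (intro continuous_intros)
    moreover have "(\<lambda>p. (fst p, z)) ` ?K \<subseteq> {0..1} \<times> Z" using z by auto
    ultimately show ?thesis using continuous_on_compose2[OF that] by fastforce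
  qed
  have cuz: "continuous_on ?K (\<lambda>p. u (fst p) z)"
    by (rule continuous_on_compose2[OF cu[OF z]]) (auto intro!: continuous_intros)
  have aK: "continuous_on ?K (\<lambda>p. a i (fst p) (snd p))" if "i \<in> Basis" for i
    by (rule continuous_on_subset[OF a[OF that] K_sub])
  have bK: "continuous_on ?K (\<lambda>p. b (fst p) (snd p))"
    by (rule continuous_on_subset[OF b K_sub])
  define N where "N p = (\<Sum>i\<in>Basis. norm (a i (fst p) (snd p)))" for p
  have "continuous_on ?K N" unfolding N_def by (intro continuous_intros aK)
  then have "compact (N ` ?K)" by (intro compact_continuous_image K)
  then obtain L where L: "0 < L" "\<And>p. p \<in> ?K \<Longrightarrow> norm (N p) \<le> L"
    using compact_imp_bounded bounded_pos by (metis (no_types, lifting) image_eqI)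
  define g where "g p = (\<Sum>i\<in>Basis. norm (u (fst p) z) * norm (a i (fst p) (snd p) - a i (fst p) z))
      + norm (b (fst p) (snd p) - b (fst p) z)" for p
  have "continuous_on ?K g" unfolding g_def
    by (intro continuous_intros cuz aK bK slice a b)
  then have ug: "uniformly_continuous_on ?K g" by (rule compact_uniformly_continuous) (rule K)
  define E where "E = exp (2 * L + 1)"
  have E: "0 < E" by (simp add: E_def)
  define e' where "e' = e / (3 * E)"
  have e': "0 < e'" using e E by (simp add: e'_def)
  obtain d1 where d1: "0 < d1" "\<And>p p'. p \<in> ?K \<Longrightarrow> p' \<in> ?K \<Longrightarrow> dist p' p < d1 \<Longrightarrow> dist (g p') (g p) < e'"
    using ug e' unfolding uniformly_continuous_on_def by metis
  obtain d2 where d2: "0 < d2" "\<And>y. y \<in> Z \<Longrightarrow> dist y z < d2 \<Longrightarrow> dist (u 0 y) (u 0 z) < e'"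
    using u0 z e' unfolding continuous_on_iff by metis
  show "\<exists>d>0. \<forall>y\<in>Z. dist y z < d \<longrightarrow> (\<forall>t\<in>{0..1}. dist (u t y) (u t z) < e)"
  proof (intro exI[of _ "min r (min d1 d2)"] conjI ballI impI)
    show "0 < min r (min d1 d2)" using r d1 d2 by simp
    fix y and t :: real assume y: "y \<in> Z" "dist y z < min r (min d1 d2)" and t: "t \<in> {0..1}"
    define w where "w t = u t y - u t z" for t
    define R where "R t = (\<Sum>i\<in>Basis. (u t z \<bullet> i) *\<^sub>R (a i t y - a i t z)) + (b t y - b t z)" for t
    have "norm (w t) \<le> (norm (w 0) + e') * exp ((2 * L + 1) * t)"
    proof (rule gronwall[where T = 1 and w' = "\<lambda>t. (\<Sum>i\<in>Basis. (w t \<bullet> i) *\<^sub>R a i t y) + R t"])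
      fix s :: real assume s: "s \<in> {0..1}"
      have "(w has_vector_derivative ((\<Sum>i\<in>Basis. (u s y \<bullet> i) *\<^sub>R a i s y) + b s y) - ((\<Sum>i\<in>Basis. (u s z \<bullet> i) *\<^sub>R a i s z) + b s z)) (at s within {0..1})"
        unfolding w_def by (intro has_vector_derivative_diff sol y z s)
      moreover have "((\<Sum>i\<in>Basis. (u s y \<bullet> i) *\<^sub>R a i s y) + b s y) - ((\<Sum>i\<in>Basis. (u s z \<bullet> i) *\<^sub>R a i s z) + b s z)
          = (\<Sum>i\<in>Basis. (w s \<bullet> i) *\<^sub>R a i s y) + R s"
        by (simp add: w_def R_def sum.distrib sum_subtractf algebra_simps inner_diff_left)
      ultimately show "(w has_vector_derivative (\<Sum>i\<in>Basis. (w s \<bullet> i) *\<^sub>R a i s y) + R s) (at s within {0..1})" by simp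
      have sy: "(s, y) \<in> ?K" "(s, z) \<in> ?K" using s y r by (auto simp: dist_commute)
      have "norm (\<Sum>i\<in>Basis. (w s \<bullet> i) *\<^sub>R a i s y) \<le> (\<Sum>i\<in>Basis. norm (w s) * norm (a i s y))"
        by (rule sum_norm_le) (auto intro!: mult_right_mono Basis_le_norm)
      also have "\<dots> = norm (w s) * N (s, y)" by (simp add: N_def sum_distrib_left)
      also have "\<dots> \<le> norm (w s) * L" using L(2)[OF sy(1)] by (intro mult_left_mono) auto
      finally have 1: "norm (\<Sum>i\<in>Basis. (w s \<bullet> i) *\<^sub>R a i s y) \<le> L * norm (w s)" by (simp add: mult.commute)
      have "norm (\<Sum>i\<in>Basis. (u s z \<bullet> i) *\<^sub>R (a i s y - a i s z)) \<le> (\<Sum>i\<in>Basis. norm (u s z) * norm (a i s y - a i s z))"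
        by (rule sum_norm_le) (auto intro!: mult_right_mono Basis_le_norm)
      then have "norm (R s) \<le> g (s, y)" unfolding R_def g_def fst_conv snd_conv
        by (intro order_trans[OF norm_triangle_ineq] add_mono) auto
      also have "g (s, y) < e'"
      proof -
        have "dist (g (s, y)) (g (s, z)) < e'"
          by (rule d1(2)[OF sy(2,1)]) (use y in \<open>auto simp: dist_Pair_Pair\<close>)
        moreover have "g (s, z) = 0" by (simp add: g_def)
        ultimately show ?thesis by (simp add: dist_real_def)
      qed
      finally have "norm (R s) \<le> e'" by simp
      with 1 show "norm ((\<Sum>i\<in>Basis. (w s \<bullet> i) *\<^sub>R a i s y) + R s) \<le> L * norm (w s) + e'"
        by (intro order_trans[OF norm_triangle_ineq] add_mono)
    qed (use t L e' in auto)
    also have "\<dots> \<le> (e' + e') * E"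
    proof (intro mult_mono add_mono)
      show "norm (w 0) \<le> e'" using d2(2)[OF y(1)] y(2) by (simp add: w_def dist_norm)
      have "(2 * L + 1) * t \<le> (2 * L + 1) * 1" using t L by (intro mult_left_mono) auto
      then show "exp ((2 * L + 1) * t) \<le> E" by (simp add: E_def)
    qed (use e' in auto)
    also have "\<dots> = e * (2/3)" using E by (simp add: e'_def)
    also have "\<dots> < e" using e by simp
    finally show "dist (u t y) (u t z) < e" by (simp add: w_def dist_norm)
  qed
qed

text \<open>Adding \<open>z\<close> to the unknowns as a constant component makes differentiability
  in \<open>z\<close> a case of dependence on initial points. The derivative again solves a linear
  equation with the same coefficients \<open>a\<close> but a new inhomogeneity; this is why the
  equation carries a term \<open>b\<close>, arbitrary in the induction.\<close>

lemma linear_ode_pCk: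
  fixes u :: "real \<Rightarrow> 'z::euclidean_space \<Rightarrow> 'e::euclidean_space"
    and a :: "'e \<Rightarrow> real \<Rightarrow> 'z \<Rightarrow> 'e"
  assumes Z: "open Z"
    and a: "\<And>i. i \<in> Basis \<Longrightarrow> pCk k (a i) ({0..1} \<times> Z)"
    and b: "pCk k b ({0..1} \<times> Z)"
    and u0: "pCk k (\<lambda>t. u 0) ({0..1::real} \<times> Z)"
    and sol: "\<And>z t. z \<in> Z \<Longrightarrow> t \<in> {0..1} \<Longrightarrow>
      ((\<lambda>t. u t z) has_vector_derivative (\<Sum>i\<in>Basis. (u t z \<bullet> i) *\<^sub>R a i t z) + b t z) (at t within {0..1})"
  shows "pCk k u ({0..1} \<times> Z)"
  using a b u0 sol
proof (induction k arbitrary: u b)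
  case 0
  have "continuous_on Z (u 0)"
    using Ck_on_continuous[OF pCk_imp_Ck_on[OF 0(3), of 0]] by simp
  then show ?case using linear_ode_continuous[OF Z, of a b u] 0 by simp
next
  case (Suc k)
  let ?W = "{0..1::real} \<times> Z"
  have W: "open_slices ?W" by (rule open_slices_Times[OF Z])
  have u_k: "pCk k u ?W"
    by (rule Suc.IH[of b u]) (use Suc.prems pCk_Suc_imp in blast)+
  let ?V = "{0..1::real} \<times> (Z \<times> (UNIV::'e set))"
  have oZ: "open (Z \<times> (UNIV::'e set))" using Z by (simp add: open_Times)
  have V: "open_slices ?V" by (rule open_slices_Times[OF oZ])
  define f where "f t p = (0::'z, (\<Sum>i\<in>Basis. (snd p \<bullet> i) *\<^sub>R a i t (fst p)) + b t (fst p))" for t and p :: "'z \<times> 'e"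
  have lift: "pCk 1 (\<lambda>t p. h t (fst p)) ?V" if "pCk (Suc k) h ?W" for h :: "real \<Rightarrow> 'z \<Rightarrow> 'e"
  proof (rule pCk_compose[OF V, where W = ?W])
    show "pCk 1 h ?W" by (rule pCk_mono[OF that]) simp
    show "pCk 1 (\<lambda>(t::real) p. fst p) ?V" by (intro pCk_fst pCk_ident V)
  qed auto
  have f: "pCk 1 f ?V"
    unfolding f_def
    by (intro pCk_Pair pCk_const pCk_add pCk_sum pCk_scaleR lift Suc.prems V pCk_inner pCk_snd pCk_ident)
  define x where "x t z = (z, u t z)" for t z
  have xsol: "((\<lambda>t. x t z) has_vector_derivative f t (x t z)) (at t within {0..1})"
    if "z \<in> Z" "t \<in> {0..1}" for z t
    unfolding x_def f_def fst_conv snd_conv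
    by (rule has_vector_derivative_Pair[OF has_vector_derivative_const Suc.prems(4)[OF that]])
  have xsub: "x t z \<in> Z \<times> UNIV" if "z \<in> Z" "t \<in> {0..1}" for z t
    using that by (simp add: x_def)
  have u0_diff: "u 0 differentiable (at z)" if "z \<in> Z" for z
    using pCk_has_derivative[OF Suc.prems(3), of 0 z] that by (auto simp: differentiable_def)
  have xinit: "x 0 differentiable (at z)" if "z \<in> Z" for z
    unfolding x_def using u0_diff[OF that] has_derivative_Pair[OF has_derivative_ident]
    unfolding differentiable_def by blast
  have main: "u t differentiable (at z) \<and> (t \<in> {0..1} \<longrightarrow>
      ((\<lambda>t. frechet_derivative (u t) (at z) v) has_vector_derivative
        (\<Sum>i\<in>Basis. (frechet_derivative (u t) (at z) v \<bullet> i) *\<^sub>R a i t z) +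
        ((\<Sum>i\<in>Basis. (u t z \<bullet> i) *\<^sub>R frechet_derivative (a i t) (at z) v) + frechet_derivative (b t) (at z) v)) (at t within {0..1}))"
    if z: "z \<in> Z" and t: "t \<in> {0..1}" for z t v
  proof -
    obtain Y where Y: "\<And>t. t \<in> {0..1} \<Longrightarrow> (x t has_derivative Y t) (at z)"
      "\<And>t v. t \<in> {0..1} \<Longrightarrow>
        ((\<lambda>t. Y t v) has_vector_derivative frechet_derivative (f t) (at (x t z)) (Y t v)) (at t within {0..1})"
      by (rule flow_differentiable[OF oZ Z f xsol xsub z xinit[OF z]]) blast+
    have Yu: "(u t has_derivative (\<lambda>v. snd (Y t v))) (at z)" if "t \<in> {0..1}" for t
      using has_derivative_snd[OF Y(1)[OF that]] by (simp add: x_def)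
    have Y1: "fst (Y t v) = v" if "t \<in> {0..1}" for t v
    proof -
      have "((\<lambda>z. z) has_derivative (\<lambda>v. fst (Y t v))) (at z)"
        using has_derivative_fst[OF Y(1)[OF that]] by (simp add: x_def)
      from has_derivative_unique[OF this has_derivative_ident] show ?thesis by metis
    qed
    have fd: "frechet_derivative (u t) (at z) v = snd (Y t v)" if "t \<in> {0..1}" for t
      using frechet_derivative_at[OF Yu[OF that]] by metis
    have "(f t has_derivative (\<lambda>p. (0, (\<Sum>i\<in>Basis. (u t z \<bullet> i) *\<^sub>R frechet_derivative (a i t) (at z) (fst p) + (snd p \<bullet> i) *\<^sub>R a i t z)
        + frechet_derivative (b t) (at z) (fst p)))) (at (x t z))"
    proof -
      have c: "((\<lambda>p. h t (fst p)) has_derivative (\<lambda>p. frechet_derivative (h t) (at z) (fst p))) (at (x t z))"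
        if "pCk (Suc k) h ?W" for h :: "real \<Rightarrow> 'z \<Rightarrow> 'e"
      proof -
        have "(h t has_derivative frechet_derivative (h t) (at z)) (at (fst (x t z)))"
          using pCk_has_derivative[OF that, of t z] z t by (simp add: x_def)
        from diff_chain_at[OF has_derivative_fst[OF has_derivative_ident] this] show ?thesis by (simp add: o_def)
      qed
      have s: "((\<lambda>p. snd p \<bullet> i) has_derivative (\<lambda>p. snd p \<bullet> i)) (at (x t z))" for i :: 'e
        by (auto intro!: derivative_eq_intros)
      have sr: "((\<lambda>p. (snd p \<bullet> i) *\<^sub>R a i t (fst p)) has_derivative
          (\<lambda>p. (u t z \<bullet> i) *\<^sub>R frechet_derivative (a i t) (at z) (fst p) + (snd p \<bullet> i) *\<^sub>R a i t z)) (at (x t z))"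
        if "i \<in> Basis" for i
        using has_derivative_scaleR[OF s c[OF Suc.prems(1)[OF that]], of i] by (simp add: x_def)
      show ?thesis unfolding f_def
        by (intro has_derivative_Pair has_derivative_const has_derivative_add has_derivative_sum sr c Suc.prems)
    qed
    note ff = frechet_derivative_at[OF this, symmetric]
    have "((\<lambda>t. snd (Y t v)) has_vector_derivative snd (frechet_derivative (f t) (at (x t z)) (Y t v))) (at t within {0..1})"
      by (rule bounded_linear.has_vector_derivative[OF bounded_linear_snd Y(2)[OF t]])
    moreover have "snd (frechet_derivative (f t) (at (x t z)) (Y t v)) =
        (\<Sum>i\<in>Basis. (frechet_derivative (u t) (at z) v \<bullet> i) *\<^sub>R a i t z) +
        ((\<Sum>i\<in>Basis. (u t z \<bullet> i) *\<^sub>R frechet_derivative (a i t) (at z) v) + frechet_derivative (b t) (at z) v)"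
      by (simp add: ff Y1[OF t] fd[OF t] sum.distrib)
    ultimately have "((\<lambda>t. snd (Y t v)) has_vector_derivative
        (\<Sum>i\<in>Basis. (frechet_derivative (u t) (at z) v \<bullet> i) *\<^sub>R a i t z) +
        ((\<Sum>i\<in>Basis. (u t z \<bullet> i) *\<^sub>R frechet_derivative (a i t) (at z) v) + frechet_derivative (b t) (at z) v)) (at t within {0..1})"
      by simp
    then have "((\<lambda>t. frechet_derivative (u t) (at z) v) has_vector_derivative
        (\<Sum>i\<in>Basis. (frechet_derivative (u t) (at z) v \<bullet> i) *\<^sub>R a i t z) +
        ((\<Sum>i\<in>Basis. (u t z \<bullet> i) *\<^sub>R frechet_derivative (a i t) (at z) v) + frechet_derivative (b t) (at z) v)) (at t within {0..1})"
      by (rule has_vector_derivative_transform[OF t, rotated]) (simp add: fd)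
    then show ?thesis using Yu[OF t] by (auto simp: differentiable_def)
  qed
  have "pCk k (\<lambda>t z. frechet_derivative (u t) (at z) v) ?W" for v
  proof (rule Suc.IH[of "\<lambda>t z. (\<Sum>i\<in>Basis. (u t z \<bullet> i) *\<^sub>R frechet_derivative (a i t) (at z) v) + frechet_derivative (b t) (at z) v"
        "\<lambda>t z. frechet_derivative (u t) (at z) v"])
    show "pCk k (a i) ?W" if "i \<in> Basis" for i by (rule pCk_Suc_imp[OF Suc.prems(1)[OF that]])
    show "pCk k (\<lambda>t z. (\<Sum>i\<in>Basis. (u t z \<bullet> i) *\<^sub>R frechet_derivative (a i t) (at z) v) + frechet_derivative (b t) (at z) v) ?W"
      by (intro pCk_add pCk_sum pCk_scaleR pCk_inner pCk_const u_k W pCk_SucD Suc.prems)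
    show "pCk k (\<lambda>t z. frechet_derivative (u 0) (at z) v) ?W" by (rule pCk_SucD[OF Suc.prems(3)])
  qed (use main in blast)
  then show ?case using main pCk_continuous[OF u_k] by auto
qed

text \<open>The derivative of the flow solves the linearised equation, whose coefficients are as smooth as the
  flow is already known to be; the induction on the order stays within one type.\<close>

theorem flow_pCk:
  fixes f :: "real \<Rightarrow> 'e::euclidean_space \<Rightarrow> 'e" and x :: "real \<Rightarrow> 'z::euclidean_space \<Rightarrow> 'e"
  assumes U: "open U" and Z: "open Z" and f: "\<And>k. pCk k f ({0..1} \<times> U)"
    and sol: "\<And>z t. z \<in> Z \<Longrightarrow> t \<in> {0..1} \<Longrightarrow> ((\<lambda>t. x t z) has_vector_derivative f t (x t z)) (at t within {0..1})"
    and sub: "\<And>z t. z \<in> Z \<Longrightarrow> t \<in> {0..1} \<Longrightarrow> x t z \<in> U"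
    and init: "\<And>k. pCk k (\<lambda>t. x 0) ({0..1::real} \<times> Z)"
  shows "pCk k x ({0..1} \<times> Z)"
    and "z \<in> Z \<Longrightarrow> t \<in> {0..1} \<Longrightarrow> ((\<lambda>t. frechet_derivative (x t) (at z) v) has_vector_derivative
      frechet_derivative (f t) (at (x t z)) (frechet_derivative (x t) (at z) v)) (at t within {0..1})"
proof -
  let ?W = "{0..1::real} \<times> Z"
  have W: "open_slices ?W" by (rule open_slices_Times[OF Z])
  have x0: "x 0 differentiable (at z)" if "z \<in> Z" for z
    using pCk_has_derivative[OF init[of "Suc 0"], of 0 z] that by (auto simp: differentiable_def)
  have main: "x t differentiable (at z) \<and> ((\<lambda>t. frechet_derivative (x t) (at z) v) has_vector_derivative
      frechet_derivative (f t) (at (x t z)) (frechet_derivative (x t) (at z) v)) (at t within {0..1})"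
    if z: "z \<in> Z" and t: "t \<in> {0..1}" for z t v
  proof -
    obtain Y where Y: "\<And>t. t \<in> {0..1} \<Longrightarrow> (x t has_derivative Y t) (at z)"
      "\<And>t v. t \<in> {0..1} \<Longrightarrow>
        ((\<lambda>t. Y t v) has_vector_derivative frechet_derivative (f t) (at (x t z)) (Y t v)) (at t within {0..1})"
      by (rule flow_differentiable[OF U Z f[of 1] sol sub z x0[OF z]]) blast+
    have fd: "frechet_derivative (x t) (at z) = Y t" if "t \<in> {0..1}" for t
      using frechet_derivative_at[OF Y(1)[OF that]] by simp
    have "((\<lambda>t. frechet_derivative (x t) (at z) v) has_vector_derivative frechet_derivative (f t) (at (x t z)) (Y t v)) (at t within {0..1})"
      by (rule has_vector_derivative_transform[OF t _ Y(2)[OF t]]) (simp add: fd)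
    then show ?thesis using Y(1)[OF t] by (auto simp: fd[OF t] differentiable_def)
  qed
  then show "z \<in> Z \<Longrightarrow> t \<in> {0..1} \<Longrightarrow> ((\<lambda>t. frechet_derivative (x t) (at z) v) has_vector_derivative
      frechet_derivative (f t) (at (x t z)) (frechet_derivative (x t) (at z) v)) (at t within {0..1})" by blast
  have c: "continuous_on ?W (\<lambda>p. x (fst p) (snd p))"
    by (rule flow_continuous[OF U Z f[of 1] sol sub x0])
  show "pCk k x ?W"
  proof (induction k)
    case 0
    show ?case using c by simp
  next
    case (Suc k)
    have "pCk k (\<lambda>t z. frechet_derivative (x t) (at z) v) ?W" for v
    proof (rule linear_ode_pCk[OF Z, where a = "\<lambda>i t z. frechet_derivative (f t) (at (x t z)) i" and b = "\<lambda>t z. 0"])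
      show "pCk k (\<lambda>t z. frechet_derivative (f t) (at (x t z)) i) ?W" for i
        by (rule pCk_compose[OF W _ pCk_SucD[OF f] Suc]) (use sub in auto)
      show "pCk k (\<lambda>t z. 0) ?W" by (rule pCk_const[OF W])
      show "pCk k (\<lambda>t z. frechet_derivative (x 0) (at z) v) ?W" by (rule pCk_SucD[OF init])
      fix z and t :: real assume zt: "z \<in> Z" "t \<in> {0..1}"
      have "linear (frechet_derivative (f t) (at (x t z)))"
        by (rule has_derivative_linear[OF pCk_has_derivative[OF f[of "Suc 0"]]]) (use zt sub in auto)
      from linear_sum_Basis[OF this, of "frechet_derivative (x t) (at z) v"] main[OF zt, of v]
      show "((\<lambda>t. frechet_derivative (x t) (at z) v) has_vector_derivative
          (\<Sum>i\<in>Basis. (frechet_derivative (x t) (at z) v \<bullet> i) *\<^sub>R frechet_derivative (f t) (at (x t z)) i) + 0) (at t within {0..1})"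
        by simp
    qed
    then show ?case using c main by auto
  qed
qed

section \<open>Geometry of the sphere\<close>

lemma S2_iff: "p \<in> S2 \<longleftrightarrow> p \<bullet> p = 1"
  by (simp add: S2_def norm_eq_1)

lemma S2_iff_coords: "p \<in> S2 \<longleftrightarrow> (p$1)\<^sup>2 + (p$2)\<^sup>2 + (p$3)\<^sup>2 = 1"
  by (simp add: S2_iff inner_vec_def sum_3 power2_eq_square)

lemma bounded_bilinear_cross3: "bounded_bilinear cross3"
  using bilinear_cross by (simp add: bilinear_conv_bounded_bilinear)

subsection \<open>The Lambert chart\<close>

text \<open>Inverse of \<open>hemi\<close>. Both formulas reach beyond the hemisphere,
  \<open>hemi\<close> to \<open>(norm z)\<^sup>2 < 2\<close> and \<open>lambert\<close> to the
  complement of the south pole, so the closed disk lies in the interior of the chart.\<close>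

definition lambert :: "R3 \<Rightarrow> real \<times> real" where
  "lambert p = (p$1 / sqrt (1 + p$3), p$2 / sqrt (1 + p$3))"

lemma norm_sq_prod: "(norm (z::real\<times>real))\<^sup>2 = (fst z)\<^sup>2 + (snd z)\<^sup>2"
  by (cases z) (simp add: norm_Pair)

lemma hemi_nth:
  "hemi z $ 1 = fst z * sqrt (2 - (norm z)\<^sup>2)" "hemi z $ 2 = snd z * sqrt (2 - (norm z)\<^sup>2)"
  "hemi z $ 3 = 1 - (norm z)\<^sup>2"
  by (simp_all add: hemi_def norm_sq_prod split_beta diff_diff_eq)

lemma lambert_hemi:
  assumes "(norm z)\<^sup>2 < 2" shows "lambert (hemi z) = z"
proof -
  have "sqrt (2 - (norm z)\<^sup>2) \<noteq> 0" using assms by simp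
  then show ?thesis by (simp add: lambert_def hemi_nth prod_eq_iff)
qed

lemma hemi_in_S2:
  assumes "(norm z)\<^sup>2 \<le> 2" shows "hemi z \<in> S2"
proof -
  define n where "n = (norm z)\<^sup>2"
  have "(sqrt (2 - n))\<^sup>2 = 2 - n" "(fst z)\<^sup>2 + (snd z)\<^sup>2 = n"
    using assms by (simp_all add: n_def norm_sq_prod)
  then have "(fst z * sqrt (2 - n))\<^sup>2 + (snd z * sqrt (2 - n))\<^sup>2 + (1 - n)\<^sup>2 = 1"
    by algebra
  then show ?thesis by (simp add: S2_iff_coords hemi_nth n_def)
qed

lemma norm_lambert:
  assumes "p \<in> S2" "-1 < p$3" shows "(norm (lambert p))\<^sup>2 = 1 - p$3"
proof -
  have "(p$1)\<^sup>2 + (p$2)\<^sup>2 = (1 - p$3) * (1 + p$3)"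
    using assms by (simp add: S2_iff_coords power2_eq_square algebra_simps)
  then have "((p$1)\<^sup>2 + (p$2)\<^sup>2) / (1 + p$3) = 1 - p$3" using assms by simp
  then show ?thesis using assms by (simp add: norm_sq_prod lambert_def power_divide add_divide_distrib)
qed

lemma hemi_lambert:
  assumes "p \<in> S2" "-1 < p$3" shows "hemi (lambert p) = p"
proof -
  have "sqrt (2 - (norm (lambert p))\<^sup>2) = sqrt (1 + p$3)" using norm_lambert[OF assms] by simp
  moreover have "0 < sqrt (1 + p$3)" using assms by simp
  ultimately show ?thesis using norm_lambert[OF assms]
    by (simp add: vec_eq_iff forall_3 hemi_nth) (simp add: lambert_def)
qed

lemma open_norm_sq_less: "open {z::'a::real_normed_vector. (norm z)\<^sup>2 < c}"
  by (intro open_Collect_less continuous_intros)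

lemma pCk_nth:
  fixes f :: "'t::topological_space \<Rightarrow> 'a::euclidean_space \<Rightarrow> real^3"
  shows "open_slices W \<Longrightarrow> pCk k f W \<Longrightarrow> pCk k (\<lambda>t x. f t x $ i) W"
  by (rule pCk_linear[OF _ bounded_linear_vec_nth])

lemma pCk_real_compose:
  fixes h :: "real \<Rightarrow> real" and f :: "'t::topological_space \<Rightarrow> 'a::euclidean_space \<Rightarrow> real"
  assumes "open_slices W" "pCk k (\<lambda>_::'t. h) (UNIV \<times> S)" "pCk k f W" "\<And>t x. (t, x) \<in> W \<Longrightarrow> f t x \<in> S"
  shows "pCk k (\<lambda>t x. h (f t x)) W"
  by (rule pCk_compose[OF assms(1) _ assms(2,3)]) (use assms(4) in auto)

lemma pCk_hemi: "pCk k (\<lambda>_. hemi) (T \<times> {z. (norm z)\<^sup>2 < 2})"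
proof -
  let ?W = "T \<times> {z::real\<times>real. (norm z)\<^sup>2 < 2}"
  have W: "open_slices ?W" by (rule open_slices_Times[OF open_norm_sq_less])
  have eq: "hemi z = (fst z * sqrt (2 - z \<bullet> z)) *\<^sub>R axis 1 1 + (snd z * sqrt (2 - z \<bullet> z)) *\<^sub>R axis 2 1 + (1 - z \<bullet> z) *\<^sub>R axis 3 1" for z
    by (simp add: vec_eq_iff forall_3 hemi_nth axis_def dot_square_norm)
  have s: "pCk k (\<lambda>_ z. sqrt (2 - z \<bullet> z)) ?W"
  proof (rule pCk_real_compose[OF W pCk_sqrt])
    show "pCk k (\<lambda>_ z. 2 - z \<bullet> z) ?W" by (intro pCk_diff pCk_const pCk_inner pCk_ident W)
  qed (simp add: dot_square_norm)
  show ?thesis unfolding eq[abs_def]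
    by (intro pCk_add pCk_scaleR pCk_mult pCk_fst pCk_snd pCk_diff pCk_inner pCk_ident pCk_const s W)
qed

lemma open_lambert_domain: "open {p::R3. -1 < p$3}"
  by (intro open_Collect_less continuous_intros)

lemma pCk_lambert: "pCk k (\<lambda>_. lambert) (T \<times> {p. -1 < p$3})"
proof -
  let ?W = "T \<times> {p::R3. -1 < p$3}"
  have W: "open_slices ?W" by (rule open_slices_Times[OF open_lambert_domain])
  have s: "pCk k (\<lambda>_ p. sqrt (1 + p$3)) ?W"
    by (rule pCk_real_compose[OF W pCk_sqrt]) (auto intro!: pCk_add pCk_const pCk_nth pCk_ident W)
  have i: "pCk k (\<lambda>_ p. inverse (sqrt (1 + p$3))) ?W"
    by (rule pCk_real_compose[OF W pCk_inverse s]) auto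
  show ?thesis unfolding lambert_def[abs_def] divide_inverse
    by (intro pCk_Pair pCk_mult pCk_nth pCk_ident i W)
qed

subsection \<open>Radial retraction\<close>

text \<open>Composition with this map extends functions on \<open>S2_prod\<close> to an open subset
  of the ambient space, where ordinary derivatives and differential equations are available.\<close>

definition retr :: "R3 \<times> R3 \<Rightarrow> R3 \<times> R3" where
  "retr x = (inverse (sqrt (fst x \<bullet> fst x)) *\<^sub>R fst x, inverse (sqrt (snd x \<bullet> snd x)) *\<^sub>R snd x)"

definition retr_dom :: "(R3 \<times> R3) set" where
  "retr_dom = {x. fst x \<noteq> 0 \<and> snd x \<noteq> 0}"

lemma open_retr_dom: "open retr_dom"
  unfolding retr_dom_def by (intro open_Collect_conj open_Collect_neq continuous_intros)

lemma S2_prod_iff: "x \<in> S2_prod \<longleftrightarrow> fst x \<bullet> fst x = 1 \<and> snd x \<bullet> snd x = 1"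
  by (cases x) (simp add: S2_prod_def S2_iff)

lemma S2_prod_subset_retr_dom: "S2_prod \<subseteq> retr_dom"
  by (auto simp: S2_prod_iff retr_dom_def)

lemma retr_in_S2_prod: "x \<in> retr_dom \<Longrightarrow> retr x \<in> S2_prod"
  by (auto simp: S2_prod_iff retr_dom_def retr_def field_simps)

lemma retr_ident: "x \<in> S2_prod \<Longrightarrow> retr x = x"
  by (simp add: S2_prod_iff retr_def)

lemma pCk_retr: "pCk k (\<lambda>_. retr) (T \<times> retr_dom)"
proof -
  let ?W = "T \<times> retr_dom"
  have W: "open_slices ?W" by (rule open_slices_Times[OF open_retr_dom])
  have s: "pCk k (\<lambda>_ x. inverse (sqrt (f x \<bullet> f x))) ?W"
    if f: "pCk k (\<lambda>_. f) ?W" and nz: "\<And>x. x \<in> retr_dom \<Longrightarrow> f x \<noteq> 0" for f :: "R3 \<times> R3 \<Rightarrow> R3"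
  proof -
    have "pCk k (\<lambda>_ x. sqrt (f x \<bullet> f x)) ?W"
      by (rule pCk_real_compose[OF W pCk_sqrt pCk_inner[OF W f f]]) (use nz in simp)
    then show ?thesis by (rule pCk_real_compose[OF W pCk_inverse]) (use nz in simp)
  qed
  have i: "pCk k (\<lambda>_ x. inverse (sqrt (fst x \<bullet> fst x))) ?W" "pCk k (\<lambda>_ x. inverse (sqrt (snd x \<bullet> snd x))) ?W"
    by (rule s; (intro pCk_fst pCk_snd pCk_ident W)?; simp add: retr_dom_def)+
  show ?thesis unfolding retr_def[abs_def]
    by (intro pCk_Pair pCk_scaleR pCk_fst pCk_snd pCk_ident i W)
qed

lemma retr_derivative_tangent:
  assumes "x \<in> S2_prod"
  obtains Dr where "(retr has_derivative Dr) (at x)" "\<And>w. w \<in> tangent_S2_prod x \<Longrightarrow> Dr w = w"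
proof -
  have x: "fst x \<bullet> fst x = 1" "snd x \<bullet> snd x = 1" using assms by (auto simp: S2_prod_iff)
  define Dr where "Dr w = (fst w - (fst x \<bullet> fst w) *\<^sub>R fst x, snd w - (snd x \<bullet> snd w) *\<^sub>R snd x)" for w
  have i: "((\<lambda>y. inverse (sqrt (f y \<bullet> f y))) has_derivative (\<lambda>w. - (f x \<bullet> f w))) (at x)"
    if f: "bounded_linear f" and fx: "f x \<bullet> f x = 1" for f :: "R3 \<times> R3 \<Rightarrow> R3"
  proof -
    have "((\<lambda>y. f y \<bullet> f y) has_derivative (\<lambda>w. f x \<bullet> f w + f w \<bullet> f x)) (at x)"
      by (rule has_derivative_inner[OF bounded_linear_imp_has_derivative[OF f] bounded_linear_imp_has_derivative[OF f]])
    moreover have "((\<lambda>s. inverse (sqrt s)) has_derivative (\<lambda>h. - (h / 2))) (at (f x \<bullet> f x))"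
    proof -
      have "((\<lambda>s. inverse (sqrt s)) has_real_derivative - (1/2)) (at 1)"
        by (auto intro!: derivative_eq_intros)
      then show ?thesis
        unfolding has_field_derivative_def fx by (rule has_derivative_eq_rhs) auto
    qed
    ultimately have "((\<lambda>y. inverse (sqrt (f y \<bullet> f y))) has_derivative (\<lambda>w. - ((f x \<bullet> f w + f w \<bullet> f x) / 2))) (at x)"
      by (rule has_derivative_compose)
    then show ?thesis by (simp add: inner_commute)
  qed
  have "(retr has_derivative (\<lambda>w. (inverse (sqrt (fst x \<bullet> fst x)) *\<^sub>R fst w + (- (fst x \<bullet> fst w)) *\<^sub>R fst x,
      inverse (sqrt (snd x \<bullet> snd x)) *\<^sub>R snd w + (- (snd x \<bullet> snd w)) *\<^sub>R snd x))) (at x)"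
    unfolding retr_def[abs_def]
    by (rule has_derivative_Pair[OF
          has_derivative_scaleR[OF i[OF bounded_linear_fst x(1)] has_derivative_fst[OF has_derivative_ident]]
          has_derivative_scaleR[OF i[OF bounded_linear_snd x(2)] has_derivative_snd[OF has_derivative_ident]]])
  then have "(retr has_derivative Dr) (at x)"
    by (simp add: Dr_def[abs_def] x)
  then show thesis by (rule that) (auto simp: Dr_def tangent_S2_prod_def)
qed

subsection \<open>Hamiltonian vector fields as ambient vector fields\<close>

text \<open>\<open>smooth_on\<close> supplies a possibly different extension \<open>F\<close> near
  each point. After composition with \<open>retr\<close> only the values on \<open>S2_prod\<close>
  matter, where every such \<open>F\<close> equals the Hamiltonian, so the local pieces fit into one
  function.\<close>

lemma pCk_extension:
  assumes "smooth_on ({0..1} \<times> S2_prod) (\<lambda>(t, x). H t x)"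
  shows "pCk k (\<lambda>t x. H t (retr x)) ({0..1::real} \<times> retr_dom)"
proof (rule pCk_local)
  let ?W = "{0..1::real} \<times> retr_dom"
  have W: "open_slices ?W" by (rule open_slices_Times[OF open_retr_dom])
  fix z assume z: "z \<in> ?W"
  then have "(fst z, retr (snd z)) \<in> {0..1} \<times> S2_prod" using retr_in_S2_prod by auto
  then obtain U F where U: "open U" "(fst z, retr (snd z)) \<in> U" and F: "\<And>k. Ck_on k F U"
    and FH: "\<And>y. y \<in> ({0..1} \<times> S2_prod) \<inter> U \<Longrightarrow> F y = (case y of (t, x) \<Rightarrow> H t x)"
    using assms unfolding smooth_on_def by metis
  have "continuous_on ({0..1::real} \<times> retr_dom) (\<lambda>p. (fst p, retr (snd p)))"
    by (intro continuous_intros) (use pCk_continuous[OF pCk_retr[of 0 "{0..1::real}"]] in simp)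
  then have "\<exists>S. open S \<and> S \<inter> ?W = (\<lambda>p. (fst p, retr (snd p))) -` U \<inter> ?W"
    using U(1) unfolding continuous_on_open_invariant by blast
  then obtain S where S: "open S" "S \<inter> ?W = (\<lambda>p. (fst p, retr (snd p))) -` U \<inter> ?W" by blast
  have WS: "open_slices (?W \<inter> S)" by (rule open_slices_Int_open[OF W S(1)])
  have inU: "(t, retr x) \<in> U \<and> t \<in> {0..1} \<and> x \<in> retr_dom" if "(t, x) \<in> ?W \<inter> S" for t x
  proof -
    have "(t, x) \<in> S \<inter> ?W" using that by blast
    then show ?thesis unfolding S(2) by simp
  qed
  have "pCk k (\<lambda>t x. F (t, retr x)) (?W \<inter> S)"
    by (rule pCk_compose[OF WS _ Ck_on_slice[OF U(1) F]])
      (use inU in \<open>auto intro: pCk_subset[OF pCk_retr]\<close>)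
  then have "pCk k (\<lambda>t x. H t (retr x)) (?W \<inter> S)"
  proof (rule pCk_cong[OF WS, rotated])
    fix t x assume "(t, x) \<in> ?W \<inter> S"
    from inU[OF this] show "F (t, retr x) = H t (retr x)" using FH[of "(t, retr x)"] retr_in_S2_prod by auto
  qed
  moreover have "z \<in> S"
  proof -
    have "z \<in> (\<lambda>p. (fst p, retr (snd p))) -` U \<inter> ?W" using U(2) z by auto
    then have "z \<in> S \<inter> ?W" unfolding S(2) .
    then show ?thesis by simp
  qed
  ultimately show "\<exists>S. open S \<and> z \<in> S \<and> pCk k (\<lambda>t x. H t (retr x)) (?W \<inter> S)" using S(1) by blast
qed

definition ham_grad :: "(real \<Rightarrow> R3 \<times> R3 \<Rightarrow> real) \<Rightarrow> real \<Rightarrow> R3 \<times> R3 \<Rightarrow> R3 \<times> R3" where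
  "ham_grad H t x = (\<Sum>i\<in>Basis. frechet_derivative (\<lambda>x. H t (retr x)) (at x) i *\<^sub>R i)"

text \<open>On the first factor the form is a / (4 pi) times \<open>p \<bullet> cross3 u v\<close>,
  and \<open>cross3 p\<close> is the quarter turn of the tangent plane at \<open>p\<close>; hence
  the factor \<open>4 * pi / a\<close>, and likewise with \<open>b\<close>. As the formula makes
  sense on the open set \<open>retr_dom\<close>, flows become solutions of an equation in Euclidean
  space.\<close>

definition ham_field :: "real \<Rightarrow> real \<Rightarrow> (real \<Rightarrow> R3 \<times> R3 \<Rightarrow> real) \<Rightarrow> real \<Rightarrow> R3 \<times> R3 \<Rightarrow> R3 \<times> R3" where
  "ham_field a b H t x = ((4 * pi / a) *\<^sub>R cross3 (fst x) (fst (ham_grad H t x)),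
     (4 * pi / b) *\<^sub>R cross3 (snd x) (snd (ham_grad H t x)))"

lemma pCk_ham_grad:
  assumes "smooth_on ({0..1} \<times> S2_prod) (\<lambda>(t, x). H t x)"
  shows "pCk k (ham_grad H) ({0..1} \<times> retr_dom)"
  unfolding ham_grad_def[abs_def]
  by (intro pCk_sum pCk_scaleR pCk_const pCk_SucD[OF pCk_extension[OF assms]] open_slices_Times open_retr_dom)

lemma pCk_ham_field:
  assumes "smooth_on ({0..1} \<times> S2_prod) (\<lambda>(t, x). H t x)"
  shows "pCk k (ham_field a b H) ({0..1} \<times> retr_dom)"
  unfolding ham_field_def[abs_def]
  by (intro pCk_Pair pCk_scaleR pCk_const pCk_bilinear[OF _ bounded_bilinear_cross3] pCk_fst pCk_snd
      pCk_ident pCk_ham_grad[OF assms] open_slices_Times open_retr_dom)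

lemma ham_grad_inner:
  assumes "smooth_on ({0..1} \<times> S2_prod) (\<lambda>(t, x). H t x)" "t \<in> {0..1}" "x \<in> retr_dom"
  shows "frechet_derivative (\<lambda>x. H t (retr x)) (at x) v = ham_grad H t x \<bullet> v"
proof -
  have "linear (frechet_derivative (\<lambda>x. H t (retr x)) (at x))"
    by (rule has_derivative_linear[OF pCk_has_derivative[OF pCk_extension[OF assms(1), of "Suc 0"]]])
      (use assms in auto)
  from linear_sum_Basis[OF this, of v] show ?thesis
    by (simp add: ham_grad_def inner_sum_left inner_commute[of v] mult.commute)
qed

lemma cross3_sympl_identity:
  fixes p :: R3
  shows "p \<bullet> cross3 (cross3 p n) w = (p \<bullet> w) * (p \<bullet> n) - (p \<bullet> p) * (n \<bullet> w)"
  by (simp add: cross3_simps)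

lemma ham_field_tangent:
  "ham_field a b H t x \<in> tangent_S2_prod x"
  by (simp add: tangent_S2_prod_def ham_field_def dot_cross_self)

lemma symp_form_ham_field:
  assumes "0 < a" "0 < b" "x \<in> S2_prod" "w \<in> tangent_S2_prod x"
  shows "symp_form a b x (ham_field a b H t x) w = - (ham_grad H t x \<bullet> w)"
proof -
  have "fst x \<bullet> cross3 (cross3 (fst x) n) (fst w) = - (n \<bullet> fst w)"
    "snd x \<bullet> cross3 (cross3 (snd x) n) (snd w) = - (n \<bullet> snd w)" for n
    using assms(3,4) unfolding cross3_sympl_identity by (simp_all add: S2_prod_iff tangent_S2_prod_def)
  then show ?thesis using assms(1,2)
    by (simp add: symp_form_def S2_area_form_def ham_field_def cross_mult_left inner_prod_def)
qed

text \<open>Turning \<open>V\<close> by a right angle in both factors gives a tangent vector whose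
  pairing with \<open>V\<close> is a combination, with positive coefficients, of the squared norms
  of the two components of \<open>V\<close>.\<close>

lemma symp_form_nondegenerate:
  assumes "0 < a" "0 < b" "x \<in> S2_prod" "V \<in> tangent_S2_prod x"
    and "\<And>w. w \<in> tangent_S2_prod x \<Longrightarrow> symp_form a b x V w = 0"
  shows "V = 0"
proof -
  have id: "p \<bullet> cross3 v (cross3 p v) = (p \<bullet> p) * (v \<bullet> v) - (p \<bullet> v)\<^sup>2" for p v :: R3
    by (simp add: cross3_simps power2_eq_square)
  have "symp_form a b x V (cross3 (fst x) (fst V), cross3 (snd x) (snd V)) = 0"
    by (rule assms(5)) (simp add: tangent_S2_prod_def dot_cross_self)
  moreover have "fst x \<bullet> fst x = 1" "snd x \<bullet> snd x = 1" "fst x \<bullet> fst V = 0" "snd x \<bullet> snd V = 0"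
    using assms(3,4) by (auto simp: S2_prod_iff tangent_S2_prod_def)
  ultimately have "a * (fst V \<bullet> fst V / (4 * pi)) + b * (snd V \<bullet> snd V / (4 * pi)) = 0"
    by (simp add: symp_form_def S2_area_form_def id)
  moreover have "0 \<le> a * (fst V \<bullet> fst V / (4 * pi))" "0 \<le> b * (snd V \<bullet> snd V / (4 * pi))"
    using assms(1,2) by simp_all
  ultimately have "a * (fst V \<bullet> fst V / (4 * pi)) = 0" "b * (snd V \<bullet> snd V / (4 * pi)) = 0" by linarith+
  then show ?thesis using assms(1,2) by (simp add: prod_eq_iff)
qed

lemma symp_form_diff: "symp_form a b x (u - v) w = symp_form a b x u w - symp_form a b x v w"
  by (simp add: symp_form_def S2_area_form_def bounded_bilinear.diff_left[OF bounded_bilinear_cross3]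
      inner_diff_right diff_divide_distrib right_diff_distrib)

lemma tangent_diff: "u \<in> tangent_S2_prod x \<Longrightarrow> v \<in> tangent_S2_prod x \<Longrightarrow> u - v \<in> tangent_S2_prod x"
  by (simp add: tangent_S2_prod_def inner_diff_right)

lemma is_ham_vector_eq_ham_field:
  assumes "0 < a" "0 < b" and H: "smooth_on ({0..1} \<times> S2_prod) (\<lambda>(t, x). H t x)"
    and t: "t \<in> {0..1}" and x: "x \<in> S2_prod" and V: "is_ham_vector a b (H t) x V"
  shows "V = ham_field a b H t x"
proof -
  obtain dh where Vt: "V \<in> tangent_S2_prod x" and dh: "(H t has_derivative dh) (at x within S2_prod)"
    "\<And>w. w \<in> tangent_S2_prod x \<Longrightarrow> symp_form a b x V w = - dh w"
    using V unfolding is_ham_vector_def by blast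
  have xd: "x \<in> retr_dom" using x S2_prod_subset_retr_dom by blast
  obtain Dr where Dr: "(retr has_derivative Dr) (at x)" "\<And>w. w \<in> tangent_S2_prod x \<Longrightarrow> Dr w = w"
    using retr_derivative_tangent[OF x] by blast
  have "((\<lambda>x. H t (retr x)) has_derivative (\<lambda>w. dh (Dr w))) (at x within retr_dom)"
  proof -
    have "(H t has_derivative dh) (at (retr x) within retr ` retr_dom)"
    proof -
      have "retr ` retr_dom \<subseteq> S2_prod" using retr_in_S2_prod by blast
      from has_derivative_subset[OF dh(1) this] show ?thesis by (simp add: retr_ident[OF x])
    qed
    from diff_chain_within[OF has_derivative_at_withinI[OF Dr(1)] this] show ?thesis by (simp add: o_def)
  qed
  then have "((\<lambda>x. H t (retr x)) has_derivative (\<lambda>w. dh (Dr w))) (at x)"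
    using at_within_open[OF xd open_retr_dom] by simp
  then have "frechet_derivative (\<lambda>x. H t (retr x)) (at x) = (\<lambda>w. dh (Dr w))"
    by (rule frechet_derivative_at[symmetric])
  then have grad: "ham_grad H t x \<bullet> w = dh w" if "w \<in> tangent_S2_prod x" for w
    using ham_grad_inner[OF H t xd, of w] Dr(2)[OF that] by simp
  have "V - ham_field a b H t x = 0"
    by (rule symp_form_nondegenerate[OF assms(1,2) x])
      (use Vt ham_field_tangent in \<open>auto simp: tangent_diff symp_form_diff dh(2) symp_form_ham_field[OF assms(1,2) x] grad\<close>)
  then show ?thesis by simp
qed

section \<open>Hamiltonian flows\<close>

lemma HamE:
  assumes "g \<in> Ham a b" "0 < a" "0 < b"
  obtains H \<phi> where "smooth_on ({0..1} \<times> S2_prod) (\<lambda>(t, x). H t x)"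
    "\<And>x. x \<in> S2_prod \<Longrightarrow> \<phi> 0 x = x" "\<And>x t. x \<in> S2_prod \<Longrightarrow> t \<in> {0..1} \<Longrightarrow> \<phi> t x \<in> S2_prod"
    "\<And>x t. x \<in> S2_prod \<Longrightarrow> t \<in> {0..1} \<Longrightarrow>
      ((\<lambda>s. \<phi> s x) has_vector_derivative ham_field a b H t (\<phi> t x)) (at t within {0..1})"
    "\<And>x. x \<in> S2_prod \<Longrightarrow> g x = \<phi> 1 x"
proof -
  obtain H \<phi> where H: "smooth_on ({0..1} \<times> S2_prod) (\<lambda>(t, x). H t x)"
    and \<phi>: "is_ham_flow a b H \<phi>" and g: "\<forall>x\<in>S2_prod. g x = \<phi> 1 x"
    using assms(1) unfolding Ham_def by blast
  show thesis
  proof (rule that[OF H])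
    fix x assume x: "x \<in> S2_prod"
    show "\<phi> 0 x = x" "g x = \<phi> 1 x" using \<phi> g x by (auto simp: is_ham_flow_def)
    fix t :: real assume t: "t \<in> {0..1}"
    show p: "\<phi> t x \<in> S2_prod" using \<phi> x t by (auto simp: is_ham_flow_def)
    obtain V where "is_ham_vector a b (H t) (\<phi> t x) V" "((\<lambda>s. \<phi> s x) has_vector_derivative V) (at t within {0..1})"
      using \<phi> x t unfolding is_ham_flow_def by blast
    then show "((\<lambda>s. \<phi> s x) has_vector_derivative ham_field a b H t (\<phi> t x)) (at t within {0..1})"
      using is_ham_vector_eq_ham_field[OF assms(2,3) H t p] by simp
  qed
qed

lemma Ham_in_S2_prod: "g \<in> Ham a b \<Longrightarrow> x \<in> S2_prod \<Longrightarrow> g x \<in> S2_prod"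
  unfolding Ham_def is_ham_flow_def by force

lemma has_vector_derivative_reverse:
  assumes "(x has_vector_derivative v) (at (1 - t) within {0..1})"
  shows "((\<lambda>s. x (1 - s)) has_vector_derivative - v) (at t within {0..1::real})"
proof -
  have "((\<lambda>s. 1 - s) has_vector_derivative - 1) (at t within {0..1::real})"
    by (auto intro!: derivative_eq_intros)
  moreover have "(\<lambda>s. 1 - s) ` {0..1::real} = {0..1}"
    by (auto intro!: image_eqI[where x = "1 - _"])
  ultimately show ?thesis
    using vector_diff_chain_within[of "\<lambda>s. 1 - s" "-1" t "{0..1}" x v] assms by (simp add: o_def)
qed

text \<open>Run backwards, two trajectories with the same end point start together; continuous
  dependence with initial distance 0 makes them agree at all times.\<close>

lemma Ham_inj_on:
  assumes "g \<in> Ham a b" "0 < a" "0 < b"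
  shows "inj_on g S2_prod"
proof (rule inj_onI)
  fix p q assume p: "p \<in> S2_prod" and q: "q \<in> S2_prod" and eq: "g p = g q"
  obtain H \<phi> where H: "smooth_on ({0..1} \<times> S2_prod) (\<lambda>(t, x). H t x)"
    and \<phi>: "\<And>x. x \<in> S2_prod \<Longrightarrow> \<phi> 0 x = x" "\<And>x t. x \<in> S2_prod \<Longrightarrow> t \<in> {0..1} \<Longrightarrow> \<phi> t x \<in> S2_prod"
      "\<And>x t. x \<in> S2_prod \<Longrightarrow> t \<in> {0..1} \<Longrightarrow>
        ((\<lambda>s. \<phi> s x) has_vector_derivative ham_field a b H t (\<phi> t x)) (at t within {0..1})"
      "\<And>x. x \<in> S2_prod \<Longrightarrow> g x = \<phi> 1 x"
    by (rule HamE[OF assms]) blast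
  define f where "f t y = - ham_field a b H (1 - t) y" for t y
  have W: "open_slices ({0..1::real} \<times> retr_dom)" by (rule open_slices_Times[OF open_retr_dom])
  have f: "pCk 1 f ({0..1} \<times> retr_dom)"
    unfolding f_def
    by (rule pCk_minus[OF W pCk_reparam[OF _ _ pCk_ham_field[OF H], where T = "{0..1}"]])
      (auto intro!: continuous_intros)
  have rev: "((\<lambda>s. \<phi> (1 - s) x) has_vector_derivative f t (\<phi> (1 - t) x)) (at t within {0..1})"
    if "x \<in> S2_prod" "t \<in> {0..1}" for x t
    unfolding f_def by (rule has_vector_derivative_reverse[OF \<phi>(3)]) (use that in auto)
  obtain M \<rho> where M: "0 < M" "0 < \<rho>"
    "\<And>x t. (\<And>t. t \<in> {0..1} \<Longrightarrow> (x has_vector_derivative f t (x t)) (at t within {0..1})) \<Longrightarrow>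
      norm (x 0 - \<phi> (1 - 0) p) < \<rho> \<Longrightarrow> t \<in> {0..1} \<Longrightarrow> norm (x t - \<phi> (1 - t) p) \<le> M * norm (x 0 - \<phi> (1 - 0) p)"
  proof (rule ode_continuous_dependence[OF open_retr_dom f, of "\<lambda>s. \<phi> (1 - s) p"])
    show "((\<lambda>s. \<phi> (1 - s) p) has_vector_derivative f t (\<phi> (1 - t) p)) (at t within {0..1})" if "t \<in> {0..1}" for t
      by (rule rev[OF p that])
    show "\<phi> (1 - t) p \<in> retr_dom" if "t \<in> {0..1}" for t
      using \<phi>(2)[OF p, of "1 - t"] that S2_prod_subset_retr_dom by auto
  qed blast
  have "norm (\<phi> (1 - 1) q - \<phi> (1 - 1) p) \<le> M * norm (\<phi> (1 - 0) q - \<phi> (1 - 0) p)"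
    by (rule M(3)[of "\<lambda>s. \<phi> (1 - s) q" 1]) (use rev[OF q] eq \<phi>(4) p q M in auto)
  then show "p = q" using eq \<phi>(1,4) p q by simp
qed

section \<open>Preservation of the symplectic form\<close>

lemma ham_grad_derivative_symmetric:
  assumes H: "smooth_on ({0..1} \<times> S2_prod) (\<lambda>(t, x). H t x)" and t: "t \<in> {0..1}" and x: "x \<in> retr_dom"
  shows "frechet_derivative (ham_grad H t) (at x) u \<bullet> v = frechet_derivative (ham_grad H t) (at x) v \<bullet> u"
proof -
  have W: "open_slices ({0..1::real} \<times> retr_dom)" by (rule open_slices_Times[OF open_retr_dom])
  have "frechet_derivative (\<lambda>x. frechet_derivative (\<lambda>x. H t (retr x)) (at x) v) (at x) =
      (\<lambda>w. frechet_derivative (ham_grad H t) (at x) w \<bullet> v)" for v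
  proof -
    have "(ham_grad H t has_derivative frechet_derivative (ham_grad H t) (at x)) (at x)"
      by (rule pCk_has_derivative[OF pCk_ham_grad[OF H, of "Suc 0"]]) (use t x in auto)
    then have "((\<lambda>x. ham_grad H t x \<bullet> v) has_derivative (\<lambda>w. frechet_derivative (ham_grad H t) (at x) w \<bullet> v)) (at x)"
      by (rule bounded_linear.has_derivative[OF bounded_linear_inner_left])
    then have "((\<lambda>x. frechet_derivative (\<lambda>x. H t (retr x)) (at x) v) has_derivative
        (\<lambda>w. frechet_derivative (ham_grad H t) (at x) w \<bullet> v)) (at x)"
      by (rule has_derivative_transform_within_open[OF _ open_retr_dom x])
        (simp add: ham_grad_inner[OF H t])
    then show ?thesis by (rule frechet_derivative_at[symmetric])
  qed
  then show ?thesis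
    using frechet_derivative_symmetric[OF W pCk_extension[OF H, of 2], of t x v u] t x by simp
qed

lemma ham_field_derivative:
  assumes H: "smooth_on ({0..1} \<times> S2_prod) (\<lambda>(t, x). H t x)" and t: "t \<in> {0..1}" and x: "x \<in> retr_dom"
  shows "frechet_derivative (ham_field a b H t) (at x) w =
    ((4 * pi / a) *\<^sub>R (cross3 (fst x) (fst (frechet_derivative (ham_grad H t) (at x) w)) + cross3 (fst w) (fst (ham_grad H t x))),
     (4 * pi / b) *\<^sub>R (cross3 (snd x) (snd (frechet_derivative (ham_grad H t) (at x) w)) + cross3 (snd w) (snd (ham_grad H t x))))"
proof -
  have g: "(ham_grad H t has_derivative frechet_derivative (ham_grad H t) (at x)) (at x)"
    by (rule pCk_has_derivative[OF pCk_ham_grad[OF H, of "Suc 0"]]) (use t x in auto)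
  have "(ham_field a b H t has_derivative (\<lambda>w.
    ((4 * pi / a) *\<^sub>R (cross3 (fst x) (fst (frechet_derivative (ham_grad H t) (at x) w)) + cross3 (fst w) (fst (ham_grad H t x))),
     (4 * pi / b) *\<^sub>R (cross3 (snd x) (snd (frechet_derivative (ham_grad H t) (at x) w)) + cross3 (snd w) (snd (ham_grad H t x)))))) (at x)"
    unfolding ham_field_def[abs_def]
    by (intro has_derivative_Pair has_derivative_scaleR_right bounded_bilinear.FDERIV[OF bounded_bilinear_cross3]
        has_derivative_fst has_derivative_snd has_derivative_ident g)
  from fun_cong[OF frechet_derivative_at[OF this], of w] show ?thesis by (rule sym)
qed

text \<open>Derivative of the triple product of \<open>p\<close>, \<open>u\<close>, \<open>v\<close>
  along a flow with velocity \<open>cross3 p n\<close>. The terms containing \<open>n\<close> come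
  from one infinitesimal rotation applied to all three vectors, which preserves the triple product;
  what remains are the second derivatives \<open>l\<close> and \<open>m\<close> of the Hamiltonian
  in the directions \<open>v\<close> and \<open>u\<close>.\<close>

lemma cross3_flow_identity:
  fixes p u v m l n :: R3
  assumes "p \<bullet> p = 1" "p \<bullet> u = 0" "p \<bullet> v = 0"
  shows "p \<bullet> (cross3 u (cross3 p l + cross3 v n) + cross3 (cross3 p m + cross3 u n) v) + cross3 p n \<bullet> cross3 u v
    = u \<bullet> l - m \<bullet> v"
proof -
  have 1: "cross3 p n \<bullet> cross3 u v + p \<bullet> cross3 (cross3 u n) v + p \<bullet> cross3 u (cross3 v n) = 0"
    by (simp add: cross3_simps)
  have 2: "p \<bullet> cross3 (cross3 p m) v = (p \<bullet> v) * (p \<bullet> m) - (p \<bullet> p) * (m \<bullet> v)"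
    by (simp add: cross3_simps)
  have 3: "p \<bullet> cross3 u (cross3 p l) = (p \<bullet> p) * (u \<bullet> l) - (p \<bullet> u) * (p \<bullet> l)"
    by (simp add: cross3_simps)
  show ?thesis
    using 1 2 3 assms
    by (simp add: bounded_bilinear.add_left[OF bounded_bilinear_cross3] bounded_bilinear.add_right[OF bounded_bilinear_cross3]
        inner_add_right)
qed

lemma tangent_of_S2_prod_valued:
  assumes D: "(\<xi> has_derivative D) (at z)" and U: "open U" "z \<in> U" and S: "\<And>y. y \<in> U \<Longrightarrow> \<xi> y \<in> S2_prod"
  shows "D w \<in> tangent_S2_prod (\<xi> z)"
proof -
  have c: "f (\<xi> z) \<bullet> f (D w) = 0" if f: "bounded_linear f" and one: "\<And>y. y \<in> S2_prod \<Longrightarrow> f y \<bullet> f y = 1"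
    for f :: "R3 \<times> R3 \<Rightarrow> R3"
  proof -
    have fd: "((\<lambda>z. f (\<xi> z)) has_derivative (\<lambda>w. f (D w))) (at z)"
      by (rule bounded_linear.has_derivative[OF f D])
    have "((\<lambda>z. f (\<xi> z) \<bullet> f (\<xi> z)) has_derivative (\<lambda>w. f (\<xi> z) \<bullet> f (D w) + f (D w) \<bullet> f (\<xi> z))) (at z)"
      by (rule has_derivative_inner[OF fd fd])
    moreover have "((\<lambda>z. f (\<xi> z) \<bullet> f (\<xi> z)) has_derivative (\<lambda>w. 0)) (at z)"
      by (rule has_derivative_transform_within_open[OF has_derivative_const[of 1] U])
        (use one S in auto)
    ultimately have "(\<lambda>w. f (\<xi> z) \<bullet> f (D w) + f (D w) \<bullet> f (\<xi> z)) = (\<lambda>w. 0)"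
      by (rule has_derivative_unique)
    from fun_cong[OF this, of w] show ?thesis by (simp add: inner_commute)
  qed
  show ?thesis
    using c[OF bounded_linear_fst] c[OF bounded_linear_snd] by (simp add: tangent_S2_prod_def S2_prod_iff)
qed

text \<open>Stated for a parametrisation \<open>\<xi>\<close> of a piece of \<open>S2_prod\<close>, since \<open>S2_prod\<close> is not open in the
  ambient space.\<close>

lemma Ham_smooth_symplectic:
  fixes \<xi> :: "'z::euclidean_space \<Rightarrow> R3 \<times> R3"
  assumes "g \<in> Ham a b" "0 < a" "0 < b" and Z: "open Z"
    and \<xi>: "\<And>k. pCk k (\<lambda>_. \<xi>) ({0..1::real} \<times> Z)" and sub: "\<And>z. z \<in> Z \<Longrightarrow> \<xi> z \<in> S2_prod"
  shows "pCk k (\<lambda>_ z. g (\<xi> z)) ({0..1::real} \<times> Z)"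
    and "z \<in> Z \<Longrightarrow> symp_form a b (g (\<xi> z)) (frechet_derivative (\<lambda>z. g (\<xi> z)) (at z) u) (frechet_derivative (\<lambda>z. g (\<xi> z)) (at z) v)
      = symp_form a b (\<xi> z) (frechet_derivative \<xi> (at z) u) (frechet_derivative \<xi> (at z) v)"
proof -
  obtain H \<phi> where H: "smooth_on ({0..1} \<times> S2_prod) (\<lambda>(t, x). H t x)"
    and \<phi>: "\<And>x. x \<in> S2_prod \<Longrightarrow> \<phi> 0 x = x" "\<And>x t. x \<in> S2_prod \<Longrightarrow> t \<in> {0..1} \<Longrightarrow> \<phi> t x \<in> S2_prod"
      "\<And>x t. x \<in> S2_prod \<Longrightarrow> t \<in> {0..1} \<Longrightarrow>
        ((\<lambda>s. \<phi> s x) has_vector_derivative ham_field a b H t (\<phi> t x)) (at t within {0..1})"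
      "\<And>x. x \<in> S2_prod \<Longrightarrow> g x = \<phi> 1 x"
    by (rule HamE[OF assms(1-3)]) blast
  let ?W = "{0..1::real} \<times> Z"
  have W: "open_slices ?W" by (rule open_slices_Times[OF Z])
  define x where "x t z = \<phi> t (\<xi> z)" for t z
  have xS: "x t z \<in> S2_prod" if "z \<in> Z" "t \<in> {0..1}" for t z
    using \<phi>(2) sub that by (auto simp: x_def)
  then have xr: "x t z \<in> retr_dom" if "z \<in> Z" "t \<in> {0..1}" for t z
    using S2_prod_subset_retr_dom that by blast
  have sol: "((\<lambda>t. x t z) has_vector_derivative ham_field a b H t (x t z)) (at t within {0..1})"
    if "z \<in> Z" "t \<in> {0..1}" for z t
    unfolding x_def by (rule \<phi>(3)) (use sub that in auto)
  have init: "pCk k (\<lambda>t. x 0) ?W" for k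
    by (rule pCk_cong[OF W _ \<xi>]) (use \<phi>(1) sub in \<open>auto simp: x_def\<close>)
  have flow1: "pCk k x ?W" for k
    by (rule flow_pCk(1)[OF open_retr_dom Z pCk_ham_field[OF H] sol xr init])
  have flow2: "((\<lambda>t. frechet_derivative (x t) (at z) v) has_vector_derivative
      frechet_derivative (ham_field a b H t) (at (x t z)) (frechet_derivative (x t) (at z) v)) (at t within {0..1})"
    if "z \<in> Z" "t \<in> {0..1}" for z t v
    by (rule flow_pCk(2)[OF open_retr_dom Z pCk_ham_field[OF H] sol xr init that])
  have x1: "pCk k (\<lambda>_. x 1) ?W" for k
    by (rule pCk_reparam[where \<tau> = "\<lambda>_. 1" and T = UNIV, OF _ _ flow1]) auto
  have gx: "g (\<xi> z) = x 1 z" if "z \<in> Z" for z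
    using \<phi>(4) sub that by (auto simp: x_def)
  show "pCk k (\<lambda>_ z. g (\<xi> z)) ?W" for k
    by (rule pCk_cong[OF W _ x1]) (use gx in auto)
  assume z: "z \<in> Z"
  define D where "D t = frechet_derivative (x t) (at z)" for t
  have D: "(x t has_derivative D t) (at z)" if "t \<in> {0..1}" for t
    unfolding D_def by (rule pCk_has_derivative[OF flow1[of "Suc 0"]]) (use that z in auto)
  have tangent: "fst (x t z) \<bullet> fst (D t w) = 0" "snd (x t z) \<bullet> snd (D t w) = 0" if t: "t \<in> {0..1}" for t w
    using tangent_of_S2_prod_valued[OF D[OF t] Z z xS[OF _ t], of w] by (simp_all add: tangent_S2_prod_def)
  define s where "s t = symp_form a b (x t z) (D t u) (D t v)" for t
  have "(s has_derivative (\<lambda>h. 0)) (at t within {0..1})" if t: "t \<in> {0..1}" for t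
  proof -
    define N where "N = ham_grad H t (x t z)"
    define DN where "DN = frechet_derivative (ham_grad H t) (at (x t z))"
    have S: "fst (x t z) \<bullet> fst (x t z) = 1" "snd (x t z) \<bullet> snd (x t z) = 1"
      using xS[OF z t] by (auto simp: S2_prod_iff)
    have dx: "((\<lambda>t. x t z) has_vector_derivative
        ((4 * pi / a) *\<^sub>R cross3 (fst (x t z)) (fst N), (4 * pi / b) *\<^sub>R cross3 (snd (x t z)) (snd N))) (at t within {0..1})"
      using sol[OF z t] by (simp add: ham_field_def N_def)
    have dD: "((\<lambda>t. D t w) has_vector_derivative
        ((4 * pi / a) *\<^sub>R (cross3 (fst (x t z)) (fst (DN (D t w))) + cross3 (fst (D t w)) (fst N)),
         (4 * pi / b) *\<^sub>R (cross3 (snd (x t z)) (snd (DN (D t w))) + cross3 (snd (D t w)) (snd N)))) (at t within {0..1})" for w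
      using flow2[OF z t, of w] unfolding ham_field_derivative[OF H t xr[OF z t]] by (simp add: D_def N_def DN_def)
    have part: "((\<lambda>t. f (x t z) \<bullet> cross3 (f (D t u)) (f (D t v))) has_vector_derivative
        k * (f (D t u) \<bullet> f (DN (D t v)) - f (DN (D t u)) \<bullet> f (D t v))) (at t within {0..1})"
      if f: "bounded_linear f" "f (x t z) \<bullet> f (x t z) = 1" "\<And>w. f (x t z) \<bullet> f (D t w) = 0"
        and fx: "((\<lambda>t. f (x t z)) has_vector_derivative k *\<^sub>R cross3 (f (x t z)) (f N)) (at t within {0..1})"
        and fD: "\<And>w. ((\<lambda>t. f (D t w)) has_vector_derivative
          k *\<^sub>R (cross3 (f (x t z)) (f (DN (D t w))) + cross3 (f (D t w)) (f N))) (at t within {0..1})"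
      for f :: "R3 \<times> R3 \<Rightarrow> R3" and k
    proof -
      have "((\<lambda>t. f (x t z) \<bullet> cross3 (f (D t u)) (f (D t v))) has_vector_derivative
        f (x t z) \<bullet> (cross3 (f (D t u)) (k *\<^sub>R (cross3 (f (x t z)) (f (DN (D t v))) + cross3 (f (D t v)) (f N))) +
          cross3 (k *\<^sub>R (cross3 (f (x t z)) (f (DN (D t u))) + cross3 (f (D t u)) (f N))) (f (D t v))) +
        (k *\<^sub>R cross3 (f (x t z)) (f N)) \<bullet> cross3 (f (D t u)) (f (D t v))) (at t within {0..1})"
        by (intro bounded_bilinear.has_vector_derivative[OF bounded_bilinear_inner]
            bounded_bilinear.has_vector_derivative[OF bounded_bilinear_cross3] fx fD)
      moreover have "f (x t z) \<bullet> (cross3 (f (D t u)) (k *\<^sub>R (cross3 (f (x t z)) (f (DN (D t v))) + cross3 (f (D t v)) (f N))) +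
          cross3 (k *\<^sub>R (cross3 (f (x t z)) (f (DN (D t u))) + cross3 (f (D t u)) (f N))) (f (D t v))) +
        (k *\<^sub>R cross3 (f (x t z)) (f N)) \<bullet> cross3 (f (D t u)) (f (D t v)) =
        k * (f (D t u) \<bullet> f (DN (D t v)) - f (DN (D t u)) \<bullet> f (D t v))"
        unfolding cross3_flow_identity[where p = "f (x t z)" and u = "f (D t u)" and v = "f (D t v)" and n = "f N"
            and l = "f (DN (D t v))" and m = "f (DN (D t u))", OF f(2,3,3), symmetric]
        by (simp add: bounded_bilinear.scaleR_left[OF bounded_bilinear_cross3]
            bounded_bilinear.scaleR_right[OF bounded_bilinear_cross3] inner_add_right distrib_left)
      ultimately show ?thesis by simp
    qed
    have 1: "((\<lambda>t. fst (x t z) \<bullet> cross3 (fst (D t u)) (fst (D t v))) has_vector_derivative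
        (4 * pi / a) * (fst (D t u) \<bullet> fst (DN (D t v)) - fst (DN (D t u)) \<bullet> fst (D t v))) (at t within {0..1})"
      by (rule part[OF bounded_linear_fst S(1) tangent(1)[OF t]])
        (use bounded_linear.has_vector_derivative[OF bounded_linear_fst dx]
          bounded_linear.has_vector_derivative[OF bounded_linear_fst dD] in auto)
    have 2: "((\<lambda>t. snd (x t z) \<bullet> cross3 (snd (D t u)) (snd (D t v))) has_vector_derivative
        (4 * pi / b) * (snd (D t u) \<bullet> snd (DN (D t v)) - snd (DN (D t u)) \<bullet> snd (D t v))) (at t within {0..1})"
      by (rule part[OF bounded_linear_snd S(2) tangent(2)[OF t]])
        (use bounded_linear.has_vector_derivative[OF bounded_linear_snd dx]
          bounded_linear.has_vector_derivative[OF bounded_linear_snd dD] in auto)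
    have s: "s = (\<lambda>t. (a / (4 * pi)) * (fst (x t z) \<bullet> cross3 (fst (D t u)) (fst (D t v))) +
        (b / (4 * pi)) * (snd (x t z) \<bullet> cross3 (snd (D t u)) (snd (D t v))))"
      by (simp add: s_def symp_form_def S2_area_form_def fun_eq_iff)
    have "(s has_vector_derivative
        (a / (4 * pi)) * ((4 * pi / a) * (fst (D t u) \<bullet> fst (DN (D t v)) - fst (DN (D t u)) \<bullet> fst (D t v))) +
        (b / (4 * pi)) * ((4 * pi / b) * (snd (D t u) \<bullet> snd (DN (D t v)) - snd (DN (D t u)) \<bullet> snd (D t v)))) (at t within {0..1})"
      unfolding s by (intro has_vector_derivative_add has_vector_derivative_mult_right 1 2)
    moreover have "(a / (4 * pi)) * ((4 * pi / a) * (fst (D t u) \<bullet> fst (DN (D t v)) - fst (DN (D t u)) \<bullet> fst (D t v))) +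
        (b / (4 * pi)) * ((4 * pi / b) * (snd (D t u) \<bullet> snd (DN (D t v)) - snd (DN (D t u)) \<bullet> snd (D t v))) = 0"
    proof -
      \<comment> \<open>The area form of a single factor need not be preserved. The contributions
        cancel only in the sum, by the symmetry of the full Hessian, which includes mixed
        derivatives.\<close>
      have "DN (D t v) \<bullet> D t u = DN (D t u) \<bullet> D t v"
        unfolding DN_def by (rule ham_grad_derivative_symmetric[OF H t xr[OF z t]])
      then have "fst (D t u) \<bullet> fst (DN (D t v)) + snd (D t u) \<bullet> snd (DN (D t v)) =
          fst (DN (D t u)) \<bullet> fst (D t v) + snd (DN (D t u)) \<bullet> snd (D t v)"
        by (simp add: inner_prod_def inner_commute)
      then show ?thesis using assms(2,3) by simp
    qed
    ultimately show ?thesis by (simp add: has_vector_derivative_def)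
  qed
  then obtain c where c: "\<And>t. t \<in> {0..1} \<Longrightarrow> s t = c"
    using has_derivative_zero_constant[of "{0..1::real}" s] by auto
  then have "s 1 = s 0" by simp
  moreover have "frechet_derivative (\<lambda>z. g (\<xi> z)) (at z) = D 1"
    by (rule frechet_derivative_at[symmetric], rule has_derivative_transform_within_open[OF D Z z]) (use gx in auto)
  moreover have "frechet_derivative \<xi> (at z) = D 0"
    by (rule frechet_derivative_at[symmetric], rule has_derivative_transform_within_open[OF D Z z])
      (use \<phi>(1) sub in \<open>auto simp: x_def\<close>)
  moreover have "x 0 z = \<xi> z" using \<phi>(1) sub z by (simp add: x_def)
  ultimately show "symp_form a b (g (\<xi> z)) (frechet_derivative (\<lambda>z. g (\<xi> z)) (at z) u) (frechet_derivative (\<lambda>z. g (\<xi> z)) (at z) v)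
      = symp_form a b (\<xi> z) (frechet_derivative \<xi> (at z) u) (frechet_derivative \<xi> (at z) v)"
    using gx[OF z] by (simp add: s_def)
qed

section \<open>Cutting off in \<open>\<real>\<^sup>4\<close>\<close>

type_synonym R4 = "(real \<times> real) \<times> (real \<times> real)"

section \<open>The symplectic form and Hamiltonian vectors in R^4\<close>

definition omega :: "real \<Rightarrow> real \<Rightarrow> R4 \<Rightarrow> R4 \<Rightarrow> real" where
  "omega a b u v = D2_area_form (a / 2) (fst u) (fst v) + D2_area_form (b / 2) (snd u) (snd v)"

text \<open>Turns a gradient into the Hamiltonian vector. On the two factors \<open>omega\<close> is
  a / (2 pi) and b / (2 pi) times the standard form, so the quarter turn of the gradient is scaled
  by the inverse factors.\<close>

definition sharp :: "real \<Rightarrow> real \<Rightarrow> R4 \<Rightarrow> R4" where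
  "sharp a b n = ((2 * pi / a) *\<^sub>R (- snd (fst n), fst (fst n)), (2 * pi / b) *\<^sub>R (- snd (snd n), fst (snd n)))"

definition grad :: "('a::euclidean_space \<Rightarrow> real) \<Rightarrow> 'a \<Rightarrow> 'a" where
  "grad F p = (\<Sum>i\<in>Basis. frechet_derivative F (at p) i *\<^sub>R i)"

lemma grad_eqI:
  assumes "(F has_derivative (\<lambda>w. n \<bullet> w)) (at p)" shows "grad F p = n"
  using frechet_derivative_at[OF assms, symmetric] by (simp add: grad_def euclidean_representation)

lemma grad_inner:
  assumes "(F has_derivative D) (at p)" shows "grad F p \<bullet> w = D w"
proof -
  have "D w = (\<Sum>i\<in>Basis. (w \<bullet> i) *\<^sub>R D i)" by (rule linear_sum_Basis[OF has_derivative_linear[OF assms]])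
  then show ?thesis
    by (simp add: grad_def frechet_derivative_at[OF assms, symmetric] inner_sum_left inner_commute[of w] mult.commute)
qed

lemma bounded_bilinear_omega: "bounded_bilinear (omega a b)"
proof -
  have "bilinear (omega a b)"
    unfolding bilinear_def
    by (auto intro!: linearI simp: omega_def D2_area_form_def algebra_simps add_divide_distrib diff_divide_distrib)
  then show ?thesis by (simp add: bilinear_conv_bounded_bilinear)
qed

lemmas omega_simps = bounded_bilinear.add_left[OF bounded_bilinear_omega] bounded_bilinear.add_right[OF bounded_bilinear_omega]
  bounded_bilinear.diff_left[OF bounded_bilinear_omega] bounded_bilinear.diff_right[OF bounded_bilinear_omega]
  bounded_bilinear.scaleR_left[OF bounded_bilinear_omega] bounded_bilinear.scaleR_right[OF bounded_bilinear_omega]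
  bounded_bilinear.zero_left[OF bounded_bilinear_omega] bounded_bilinear.zero_right[OF bounded_bilinear_omega]

lemma omega_sharp: "a \<noteq> 0 \<Longrightarrow> b \<noteq> 0 \<Longrightarrow> omega a b (sharp a b n) w = - (n \<bullet> w)"
  by (simp add: omega_def sharp_def D2_area_form_def inner_prod_def field_simps)

lemma omega_nondegenerate:
  assumes "a \<noteq> 0" "b \<noteq> 0" "\<And>w. omega a b V w = 0" shows "V = 0"
  using assms(3)[of "((1, 0), (0, 0))"] assms(3)[of "((0, 1), (0, 0))"]
    assms(3)[of "((0, 0), (1, 0))"] assms(3)[of "((0, 0), (0, 1))"] assms(1,2)
  by (simp add: omega_def D2_area_form_def prod_eq_iff)

lemma bounded_linear_sharp: "bounded_linear (sharp a b)"
  by (rule linear_conv_bounded_linear[THEN iffD1]) (auto intro!: linearI simp: sharp_def algebra_simps add_divide_distrib diff_divide_distrib)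

lemma pCk_exp: "pCk k (\<lambda>_. exp :: real \<Rightarrow> real) (T \<times> UNIV)"
proof (induction k)
  case 0 show ?case by (auto intro!: continuous_intros)
next
  case (Suc k)
  have o: "open_slices (T \<times> (UNIV::real set))" by (rule open_slices_Times) auto
  show ?case
  proof (rule pCk_SucI[where D = "\<lambda>_ x v. v * exp x"])
    show "pCk k (\<lambda>_ x. v * exp x) (T \<times> UNIV)" for v :: real by (intro pCk_mult pCk_const Suc o)
  qed (auto intro!: o continuous_intros derivative_eq_intros)
qed

text \<open>Supplies the global Lipschitz constant under which solutions exist on all of
  \<open>{0..1}\<close>: the derivative is bounded on \<open>K\<close> and vanishes
  elsewhere.\<close>

lemma lipschitz_of_compact_support:
  fixes X :: "'a::euclidean_space \<Rightarrow> 'b::real_normed_vector"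
  assumes X: "pCk 1 (\<lambda>_. X) ({0..1::real} \<times> UNIV)" and K: "compact K" "\<And>p. p \<notin> K \<Longrightarrow> X p = 0"
  obtains L where "0 < L" "\<And>p q. norm (X p - X q) \<le> L * norm (p - q)"
proof -
  have X1: "pCk (Suc 0) (\<lambda>_. X) ({0..1::real} \<times> UNIV)" using X by (simp only: One_nat_def)
  define D where "D p = frechet_derivative X (at p)" for p
  have D: "(X has_derivative D p) (at p)" for p
    unfolding D_def by (rule pCk_has_derivative[OF X1, of 0]) auto
  have D0: "D p = (\<lambda>_. 0)" if "p \<notin> K" for p
  proof -
    have o: "open (- K)" "p \<in> - K" using compact_imp_closed[OF K(1)] that by (auto simp: open_Compl)
    have "(X has_derivative (\<lambda>_. 0)) (at p)"
      by (rule has_derivative_transform_within_open[OF has_derivative_const[of 0] o]) (use K(2) in auto)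
    then show ?thesis using D has_derivative_unique by blast
  qed
  have "continuous_on UNIV (\<lambda>p. D p i)" for i
    using Ck_on_continuous[OF pCk_imp_Ck_on[OF pCk_SucD[OF X1], of 0]] by (simp add: D_def)
  then have "continuous_on K (\<lambda>p. \<Sum>i\<in>Basis. norm (D p i))"
    by (intro continuous_intros) (auto intro: continuous_on_subset)
  then have "compact ((\<lambda>p. \<Sum>i\<in>Basis. norm (D p i)) ` K)" by (rule compact_continuous_image[OF _ K(1)])
  from bounded_pos[THEN iffD1, OF compact_imp_bounded[OF this]]
  obtain L where L: "0 < L" "\<And>p. p \<in> K \<Longrightarrow> norm (\<Sum>i\<in>Basis. norm (D p i)) \<le> L" by blast
  have "onorm (D p) \<le> L" for p
  proof (cases "p \<in> K")
    case True
    show ?thesis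
    proof (rule onorm_bound)
      fix v
      have "norm (D p v) \<le> (\<Sum>i\<in>Basis. norm (D p i)) * norm v"
        by (rule linear_norm_bound_Basis[OF has_derivative_linear[OF D]])
      also have "\<dots> \<le> L * norm v" using L(2)[OF True] by (intro mult_right_mono) auto
      finally show "norm (D p v) \<le> L * norm v" .
    qed (use L in simp)
  next
    case False
    then show ?thesis using L(1) by (simp add: D0 onorm_zero)
  qed
  then have "norm (X p - X q) \<le> L * norm (p - q)" for p q
    by (intro differentiable_bound[of UNIV X D]) (auto intro: D)
  with L(1) show thesis by (rule that)
qed

text \<open>Write \<lambda> for the form \<open>omega a b (p - c) w / 2\<close>. In the derivative
  of f^*\<lambda> - \<lambda> the terms without second derivatives of \<open>f\<close> cancel
  because \<open>f\<close> is symplectic, and the remaining term is symmetric because second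
  derivatives are. So the form is closed and has a primitive by \<open>poincare_lemma\<close>. Off
  \<open>K\<close> the form vanishes, so the primitive is constant there and can be normalised to
  0.\<close>

lemma area_primitive:
  fixes f :: "R4 \<Rightarrow> R4"
  assumes f: "\<And>k. pCk k (\<lambda>_. f) ({0..1::real} \<times> UNIV)"
    and sympl: "\<And>p u v. omega a b (frechet_derivative f (at p) u) (frechet_derivative f (at p) v) = omega a b u v"
    and supp: "\<And>p. p \<notin> K \<Longrightarrow> f p = p" and K: "compact K" "convex K"
  obtains h where "\<And>k. pCk k (\<lambda>_. h) ({0..1::real} \<times> UNIV)" "\<And>p. p \<notin> K \<Longrightarrow> h p = 0"
    "\<And>p. (h has_derivative (\<lambda>w. omega a b (p - c) w / 2 - omega a b (f p - c) (frechet_derivative f (at p) w) / 2)) (at p)"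
proof -
  let ?W = "{0..1::real} \<times> (UNIV::R4 set)"
  have W: "open_slices ?W" by (rule open_slices_Times) auto
  define Df where "Df p = frechet_derivative f (at p)" for p
  have Df: "(f has_derivative Df p) (at p)" for p
    unfolding Df_def by (rule pCk_has_derivative[OF f[of "Suc 0"], of 0]) auto
  have Df_smooth: "pCk k (\<lambda>_ p. Df p v) ?W" for k v
    unfolding Df_def by (rule pCk_SucD[OF f])
  define D2 where "D2 p v = frechet_derivative (\<lambda>p. Df p v) (at p)" for p v
  have D2: "((\<lambda>p. Df p v) has_derivative D2 p v) (at p)" for p v
    unfolding D2_def by (rule pCk_has_derivative[OF Df_smooth[of "Suc 0"], of 0]) auto
  have D2_smooth: "pCk k (\<lambda>_ p. D2 p v w) ?W" for k v w
    unfolding D2_def by (rule pCk_SucD[OF Df_smooth])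
  have D2_sym: "D2 p v w = D2 p w v" for p v w
    using frechet_derivative_symmetric[OF W f, of 0 p v w] by (simp add: D2_def Df_def)
  define \<alpha> where "\<alpha> p w = omega a b (f p - c) (Df p w) / 2 - omega a b (p - c) w / 2" for p w
  define D\<alpha> where "D\<alpha> p v w = omega a b (f p - c) (D2 p v w) / 2" for p v w
  have \<alpha>_smooth: "pCk k (\<lambda>_ p. \<alpha> p w) ?W" for k w
  proof -
    have "pCk k (\<lambda>_ p. (1/2) * omega a b (f p - c) (Df p w) - (1/2) * omega a b (p - c) w) ?W"
      by (intro pCk_diff pCk_mult pCk_bilinear[OF _ bounded_bilinear_omega] pCk_const pCk_ident f Df_smooth W)
    then show ?thesis by (simp add: \<alpha>_def)
  qed
  have \<alpha>_der: "((\<lambda>p. \<alpha> p v) has_derivative D\<alpha> p v) (at p)" for p v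
  proof -
    have "((\<lambda>p. (1/2) * omega a b (f p - c) (Df p v) - (1/2) * omega a b (p - c) v) has_derivative
        (\<lambda>w. (1/2) * (omega a b (f p - c) (D2 p v w) + omega a b (Df p w - 0) (Df p v)) - (1/2) * (omega a b (p - c) 0 + omega a b (w - 0) v))) (at p)"
      by (intro has_derivative_diff has_derivative_mult_right bounded_bilinear.FDERIV[OF bounded_bilinear_omega]
          has_derivative_const has_derivative_ident Df D2)
    then show ?thesis
      by (simp add: \<alpha>_def D\<alpha>_def[abs_def] omega_simps sympl[folded Df_def] add_divide_distrib)
  qed
  define h0 where "h0 p = integral {0..1} (\<lambda>s. \<alpha> (s *\<^sub>R p) p)" for p
  have h0: "(h0 has_derivative \<alpha> p) (at p)" for p
    unfolding h0_def[abs_def]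
  proof (rule poincare_lemma[OF _ \<alpha>_der])
    show "linear (\<alpha> x)" for x
    proof -
      have "linear (Df x)" by (rule has_derivative_linear[OF Df])
      then show ?thesis unfolding \<alpha>_def
        by (intro linearI) (simp_all add: linear_add linear_cmul omega_simps algebra_simps diff_divide_distrib add_divide_distrib)
    qed
    show "continuous_on UNIV (\<lambda>x. D\<alpha> x v w)" for v w
    proof -
      have "pCk 0 (\<lambda>_ p. omega a b (f p - c) (D2 p v w)) ?W"
        by (intro pCk_diff pCk_bilinear[OF _ bounded_bilinear_omega] pCk_const pCk_ident f D2_smooth W)
      from Ck_on_continuous[OF pCk_imp_Ck_on[OF this, of 0]]
      show ?thesis unfolding D\<alpha>_def by (intro continuous_intros) auto
    qed
    show "D\<alpha> x v w = D\<alpha> x w v" for x v w by (simp add: D\<alpha>_def D2_sym[of x v w])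
  qed
  have \<alpha>0: "\<alpha> p w = 0" if p: "p \<notin> K" for p w
  proof -
    have o: "open (- K)" "p \<in> - K" using compact_imp_closed[OF K(1)] p by (auto simp: open_Compl)
    have "(f has_derivative (\<lambda>w. w)) (at p)"
      by (rule has_derivative_transform_within_open[OF has_derivative_ident o]) (use supp in auto)
    then have "Df p = (\<lambda>w. w)" using Df has_derivative_unique by blast
    then show ?thesis by (simp add: \<alpha>_def supp[OF p])
  qed
  \<comment> \<open>The primitive is locally constant off \<open>K\<close>; a single constant
    results because the complement of a bounded convex set is connected in dimension above
    1.\<close>
  have "connected (- K)"
    by (rule connected_complement_bounded_convex[OF compact_imp_bounded[OF K(1)] K(2)]) simp
  moreover have "open (- K)" using compact_imp_closed[OF K(1)] by (simp add: open_Compl)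
  ultimately have "\<exists>C. \<forall>p\<in>-K. h0 p = C"
  proof (cases "- K = {}")
    case False
    then obtain p0 where p0: "p0 \<in> - K" by blast
    have "h0 p = h0 p0" if "p \<in> - K" for p
    proof (rule has_derivative_zero_unique_connected[OF \<open>open (- K)\<close> \<open>connected (- K)\<close> _ that p0])
      show "(h0 has_derivative (\<lambda>h. 0)) (at x)" if "x \<in> - K" for x
      proof -
        have "\<alpha> x = (\<lambda>h. 0)" using \<alpha>0[of x] that by auto
        then show ?thesis using h0[of x] by simp
      qed
    qed
    then show ?thesis by blast
  qed auto
  then obtain C where C: "\<And>p. p \<notin> K \<Longrightarrow> h0 p = C" by blast
  define h where "h p = C - h0 p" for p
  have h: "(h has_derivative (\<lambda>w. - \<alpha> p w)) (at p)" for p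
    unfolding h_def[abs_def] using has_derivative_diff[OF has_derivative_const[of C] h0[of p]] by simp
  have ch: "continuous_on ?W (\<lambda>z. h (snd z))"
  proof -
    have "continuous_on UNIV h" by (rule has_derivative_continuous_on) (use h in auto)
    then show ?thesis by (rule continuous_on_compose2) (auto intro!: continuous_intros)
  qed
  show thesis
  proof (rule that[of h])
    show "pCk k (\<lambda>_. h) ?W" for k
    proof (cases k)
      case 0 then show ?thesis using ch by simp
    next
      case (Suc j)
      show ?thesis unfolding Suc
        by (rule pCk_SucI[OF W _ h]) (use ch in \<open>auto intro!: pCk_minus W \<alpha>_smooth\<close>)
    qed
    show "h p = 0" if "p \<notin> K" for p using C[OF that] by (simp add: h_def)
    show "(h has_derivative (\<lambda>w. omega a b (p - c) w / 2 - omega a b (f p - c) (frechet_derivative f (at p) w) / 2)) (at p)" for p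
      using h[of p] by (simp add: \<alpha>_def Df_def)
  qed
qed


definition bidisk :: "real \<Rightarrow> R4 set" where
  "bidisk r = cball 0 r \<times> cball 0 r"

lemma compact_bidisk: "compact (bidisk r)" and convex_bidisk: "convex (bidisk r)"
  by (auto simp: bidisk_def intro!: compact_Times convex_Times)

text \<open>With \<open>\<eta> t\<close> the time-\<open>S (1 - t)\<close> map of the Liouville field \<open>(p - c) / 2\<close>, the curve
  \<open>\<eta> t\<^sup>-\<^sup>1 (f\<^sup>-\<^sup>1 (\<eta> t q))\<close> joins \<open>q\<close> to \<open>f\<^sup>-\<^sup>1 q\<close> and, where the cut-off function is 1, is a trajectory of
  the cut-off Hamiltonian.\<close>

lemma cut_R4:
  fixes f :: "R4 \<Rightarrow> R4"
  assumes ab: "0 < a" "0 < b"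
    and f: "\<And>k. pCk k (\<lambda>_. f) ({0..1::real} \<times> UNIV)"
    and sympl: "\<And>p u v. omega a b (frechet_derivative f (at p) u) (frechet_derivative f (at p) v) = omega a b u v"
    and bij: "bij f"
    and supp: "\<And>p. p \<notin> bidisk r \<Longrightarrow> f p = p" and r: "0 < r" "r < 1"
    and \<sigma>: "\<sigma> = 1 \<or> \<sigma> = -1" and e: "0 < e1" "e1 < e2" "e2 < e3" "e2 \<le> r"
    and cond: "\<And>p. e3 \<le> \<sigma> * snd (snd (f p)) \<Longrightarrow> e2 \<le> \<sigma> * snd (snd p)"
  obtains G \<rho> where "\<And>k. pCk k (\<lambda>_ z. G (fst z) (snd z)) ({0..1::real} \<times> UNIV)"
    "\<And>t p. t \<in> {0..1} \<Longrightarrow> p \<notin> bidisk r \<Longrightarrow> G t p = 0"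
    "\<And>p. \<rho> 0 p = p"
    "\<And>t p. t \<in> {0..1} \<Longrightarrow> ((\<lambda>s. \<rho> s p) has_vector_derivative sharp a b (grad (G t) (\<rho> t p))) (at t within {0..1})"
    "\<And>t p. t \<in> {0..1} \<Longrightarrow> p \<in> bidisk r \<Longrightarrow> \<rho> t p \<in> bidisk r"
    "\<And>p. p \<notin> bidisk r \<Longrightarrow> \<rho> 1 p = p"
    "\<And>p. \<sigma> * snd (snd p) \<le> e1 \<Longrightarrow> \<rho> 1 p = p"
    "\<And>q. e3 \<le> \<sigma> * snd (snd q) \<Longrightarrow> f (\<rho> 1 q) = q"
proof -
  let ?W = "{0..1::real} \<times> (UNIV::R4 set)"
  have W: "open_slices ?W" by (rule open_slices_Times) auto
  have ab0: "a \<noteq> 0" "b \<noteq> 0" using ab by auto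
  have \<sigma>2: "\<sigma> * \<sigma> = 1" using \<sigma> by auto
  define y where "y p = \<sigma> * snd (snd p)" for p :: R4
  define c :: R4 where "c = (0, (0, \<sigma> * e2))"
  have yc: "y c = e2" using \<sigma>2 by (simp add: y_def c_def mult.assoc[symmetric])
  \<comment> \<open>The bidisk is convex, so once it contains the centre, an expansion about the
    centre cannot bring an outer point into it. This is where \<open>e2 \<le> r\<close>
    enters.\<close>
  have c_in: "c \<in> bidisk r" using e r \<sigma> by (auto simp: bidisk_def c_def norm_Pair)
  have y_aff: "y (c + m *\<^sub>R (p - c)) = e2 + m * (y p - e2)" for m p
    using yc by (simp add: y_def algebra_simps)
  have y_out: "p \<notin> bidisk r" if "1 \<le> y p" for p
  proof -
    have "1 \<le> \<bar>snd (snd p)\<bar>" using that \<sigma> by (auto simp: y_def)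
    also have "\<dots> \<le> norm (snd p)" using norm_snd_le[of "snd (snd p)" "fst (snd p)"] by simp
    finally show ?thesis using r by (cases p) (auto simp: bidisk_def)
  qed
  have y_smooth: "pCk k (\<lambda>_. y) ?W" for k
    unfolding y_def[abs_def] by (intro pCk_mult pCk_const pCk_snd pCk_ident W)
  have y_cont: "continuous_on UNIV y"
    unfolding y_def[abs_def] by (intro continuous_intros)

  define Df where "Df p = frechet_derivative f (at p)" for p
  have Df: "(f has_derivative Df p) (at p)" for p
    unfolding Df_def by (rule pCk_has_derivative[OF f[of "Suc 0"], of 0]) auto
  note linDf = has_derivative_linear[OF Df]
  note sympl' = sympl[folded Df_def]

  obtain h where h: "\<And>k. pCk k (\<lambda>_. h) ?W" "\<And>p. p \<notin> bidisk r \<Longrightarrow> h p = 0"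
    "\<And>p. (h has_derivative (\<lambda>w. omega a b (p - c) w / 2 - omega a b (f p - c) (Df p w) / 2)) (at p)"
    using area_primitive[OF f sympl supp compact_bidisk convex_bidisk, where c = c] unfolding Df_def by blast

  \<comment> \<open>By the margins of \<open>smooth_step\<close>, \<open>F\<close> vanishes on a
    neighbourhood of the points with \<open>y p \<le> e1\<close> and equals \<open>h\<close> on a
    neighbourhood of those with \<open>e2 \<le> y p\<close>, so the derivatives agree there as
    well.\<close>
  define F where "F p = smooth_step ((y p - e1) / (e2 - e1)) * h p" for p
  have F_smooth: "pCk k (\<lambda>_. F) ?W" for k
  proof -
    have "pCk k (\<lambda>_ p. smooth_step ((y p - e1) * inverse (e2 - e1))) ?W"
      by (rule pCk_real_compose[OF W pCk_smooth_step]) (intro pCk_mult pCk_diff pCk_const y_smooth W, simp)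
    then show ?thesis unfolding F_def[abs_def] divide_inverse by (intro pCk_mult h(1) W)
  qed
  define DF where "DF p = frechet_derivative F (at p)" for p
  have DF: "(F has_derivative DF p) (at p)" for p
    unfolding DF_def by (rule pCk_has_derivative[OF F_smooth[of "Suc 0"], of 0]) auto
  have F_out: "F p = 0" if "p \<notin> bidisk r" for p using h(2)[OF that] by (simp add: F_def)
  define XF where "XF p = sharp a b (grad F p)" for p
  have XF_smooth: "pCk k (\<lambda>_. XF) ?W" for k
    unfolding XF_def[abs_def] grad_def[abs_def]
    by (intro pCk_linear[OF W bounded_linear_sharp] pCk_sum pCk_scaleR pCk_const W pCk_SucD[OF F_smooth])
  have omega_XF: "omega a b (XF p) w = - DF p w" for p w
    using omega_sharp[OF ab0] grad_inner[OF DF] by (simp add: XF_def)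
  have XF_0: "XF p = 0" if "open S" "p \<in> S" "\<And>q. q \<in> S \<Longrightarrow> F q = 0" for S p
  proof -
    have "(F has_derivative (\<lambda>w. 0 \<bullet> w)) (at p)"
      by (rule has_derivative_transform_within_open[OF _ that(1,2), of "\<lambda>_. 0"]) (use that(3) in auto)
    then have "grad F p = 0" by (rule grad_eqI)
    then show ?thesis by (simp add: XF_def sharp_def zero_prod_def)
  qed
  have open_out: "open (- bidisk r)"
    using compact_imp_closed[OF compact_bidisk] by (simp add: open_Compl)
  have XF_out: "XF p = 0" if "p \<notin> bidisk r" for p
    by (rule XF_0[OF open_out]) (use that F_out in auto)
  have XF_low: "XF p = 0" if "y p \<le> e1" for p
  proof (rule XF_0)
    show "open {p. y p < e1 + (e2 - e1) / 3}"
      using open_Collect_less[OF y_cont continuous_on_const] by simp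
    show "p \<in> {p. y p < e1 + (e2 - e1) / 3}" unfolding mem_Collect_eq by (rule le_less_trans[OF that]) (use e in simp)
    show "F q = 0" if "q \<in> {p. y p < e1 + (e2 - e1) / 3}" for q
    proof -
      have "(y q - e1) / (e2 - e1) \<le> 1/3" using that e by (simp add: field_simps)
      then show ?thesis by (simp add: F_def smooth_step_eq_0)
    qed
  qed
  \<comment> \<open>Adding \<open>omega a b (p - c) w / 2\<close>, the dual of the Liouville field,
    leaves its pull-back by \<open>f\<close>. So from level \<open>e2\<close> on, the Liouville
    field plus \<open>XF\<close> is the Liouville field pulled back by \<open>f\<close>.\<close>
  have omega_XF_high: "omega a b (XF p) w = omega a b (f p - c) (Df p w) / 2 - omega a b (p - c) w / 2"
    if p: "e2 \<le> y p" for p w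
  proof -
    have o: "open {p. e2 - (e2 - e1) / 3 < y p}"
      using open_Collect_less[OF continuous_on_const y_cont] by simp
    have "(F has_derivative (\<lambda>w. omega a b (p - c) w / 2 - omega a b (f p - c) (Df p w) / 2)) (at p)"
    proof (rule has_derivative_transform_within_open[OF h(3) o])
      show "p \<in> {p. e2 - (e2 - e1) / 3 < y p}" unfolding mem_Collect_eq by (rule less_le_trans[OF _ p]) (use e in simp)
      show "h q = F q" if "q \<in> {p. e2 - (e2 - e1) / 3 < y p}" for q
      proof -
        have "2/3 \<le> (y q - e1) / (e2 - e1)" using that e by (simp add: field_simps)
        then show ?thesis by (simp add: F_def smooth_step_eq_1)
      qed
    qed
    with DF have "DF p = (\<lambda>w. omega a b (p - c) w / 2 - omega a b (f p - c) (Df p w) / 2)"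
      by (rule has_derivative_unique)
    then show ?thesis by (simp add: omega_XF)
  qed
  obtain L where L: "0 < L" "\<And>p q. norm (XF p - XF q) \<le> L * norm (p - q)"
    by (rule lipschitz_of_compact_support[OF XF_smooth compact_bidisk XF_out]) blast+

  \<comment> \<open>The largest dilation factor is then \<open>exp (1 / (e3 - e2))\<close>, which
    exceeds \<open>1 / (e3 - e2)\<close>. It lifts level \<open>e3\<close>, at height
    \<open>e3 - e2\<close> above the centre, to a level above 1 and so out of the bidisk.\<close>
  define S where "S = 2 / (e3 - e2)"
  have S: "0 < S" using e by (simp add: S_def)
  define m where "m t = exp (S * (1 - t) / 2)" for t
  have m_pos: "0 < m t" for t by (simp add: m_def)
  have m_ge1: "1 \<le> m t" if "t \<in> {0..1}" for t using that S by (simp add: m_def)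
  have m_der: "(m has_real_derivative - (S / 2) * m t) (at t within T)" for t T
    unfolding m_def[abs_def] by (auto intro!: derivative_eq_intros)
  have m0: "1 \<le> m 0 * (e3 - e2)"
  proof -
    have "S * (1 - 0) / 2 = 1 / (e3 - e2)" using e by (simp add: S_def field_simps)
    then have "1 + 1 / (e3 - e2) \<le> m 0" unfolding m_def using exp_ge_add_one_self[of "1 / (e3 - e2)"] by presburger
    then have "1 / (e3 - e2) * (e3 - e2) \<le> m 0 * (e3 - e2)" using e by (intro mult_right_mono) auto
    then show ?thesis using e by simp
  qed
  define \<eta> where "\<eta> t p = c + m t *\<^sub>R (p - c)" for t p
  have \<eta>_inv: "\<eta> t (c + inverse (m t) *\<^sub>R (p - c)) = p" for t p
    using m_pos[of t] by (simp add: \<eta>_def)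
  have \<eta>_out: "\<eta> t p \<notin> bidisk r" if p: "p \<notin> bidisk r" and t: "t \<in> {0..1}" for t p
  proof
    assume "\<eta> t p \<in> bidisk r"
    then have "(1 - inverse (m t)) *\<^sub>R c + inverse (m t) *\<^sub>R \<eta> t p \<in> bidisk r"
      using c_in m_ge1[OF t] m_pos[of t] convexD[OF convex_bidisk] by (simp add: field_simps)
    moreover have "(1 - inverse (m t)) *\<^sub>R c + inverse (m t) *\<^sub>R \<eta> t p = p"
      using m_pos[of t] by (simp add: \<eta>_def algebra_simps)
    ultimately show False using p by simp
  qed
  \<comment> \<open>The pull-back of \<open>XF\<close> by the dilation \<open>\<eta> t\<close> is
    \<open>inverse (m t)\<close> times \<open>XF\<close> after \<open>\<eta> t\<close>. As the
    dilation multiplies \<open>omega\<close> by the square of \<open>m t\<close>, the corresponding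
    Hamiltonian carries the inverse square. The factor \<open>- S\<close> is the speed of the
    parameter \<open>S * (1 - t)\<close>.\<close>
  define G where "G t p = - (S * (inverse (m t) * inverse (m t)) * F (\<eta> t p))" for t p
  define V where "V t p = (- (S * inverse (m t))) *\<^sub>R XF (\<eta> t p)" for t p
  have VG: "sharp a b (grad (G t) p) = V t p" for t p
  proof -
    have "((\<lambda>p. \<eta> t p) has_derivative (\<lambda>w. m t *\<^sub>R w)) (at p)"
      unfolding \<eta>_def[abs_def] by (auto intro!: derivative_eq_intros)
    from diff_chain_at[OF this DF[of "\<eta> t p"]]
    have "((\<lambda>p. F (\<eta> t p)) has_derivative (\<lambda>w. DF (\<eta> t p) (m t *\<^sub>R w))) (at p)" by (simp add: o_def)
    then have "(G t has_derivative (\<lambda>w. - (S * (inverse (m t) * inverse (m t)) * DF (\<eta> t p) (m t *\<^sub>R w)))) (at p)"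
      unfolding G_def[abs_def] by (intro has_derivative_minus has_derivative_mult_right)
    moreover have "- (S * (inverse (m t) * inverse (m t)) * DF (\<eta> t p) (m t *\<^sub>R w)) = (- (S * inverse (m t))) *\<^sub>R grad F (\<eta> t p) \<bullet> w" for w
      using grad_inner[OF DF, of "\<eta> t p" w] m_pos[of t] by (simp add: linear_cmul[OF has_derivative_linear[OF DF]])
    ultimately have "grad (G t) p = (- (S * inverse (m t))) *\<^sub>R grad F (\<eta> t p)"
      by (intro grad_eqI) simp
    then show ?thesis unfolding V_def XF_def by (simp only: linear_cmul[OF bounded_linear.linear[OF bounded_linear_sharp]])
  qed
  \<comment> \<open>The dilation stretches distances by \<open>m t\<close> and the prefactor of
    \<open>V\<close> contains its inverse, so the constant is the same for all times.\<close>
  have V_lip: "norm (V t p - V t q) \<le> (S * L) * norm (p - q)" for t p q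
  proof -
    have "norm (V t p - V t q) = S * inverse (m t) * norm (XF (\<eta> t p) - XF (\<eta> t q))"
    proof -
      have "V t p - V t q = (- (S * inverse (m t))) *\<^sub>R (XF (\<eta> t p) - XF (\<eta> t q))"
        unfolding V_def by (rule scaleR_diff_right[symmetric])
      then show ?thesis using S m_pos[of t] by simp
    qed
    also have "\<dots> \<le> S * inverse (m t) * (L * norm (\<eta> t p - \<eta> t q))"
      using S m_pos[of t] L(2) by (intro mult_left_mono) auto
    also have "\<eta> t p - \<eta> t q = m t *\<^sub>R (p - q)" by (simp add: \<eta>_def algebra_simps)
    also have "S * inverse (m t) * (L * norm (m t *\<^sub>R (p - q))) = S * L * norm (p - q)"
      using m_pos[of t] by simp
    finally show ?thesis .
  qed
  have V_cont: "continuous_on ({0..1} \<times> UNIV) (\<lambda>z. V (fst z) (snd z))"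
  proof -
    have XFc: "continuous_on UNIV XF" using Ck_on_continuous[OF pCk_imp_Ck_on[OF XF_smooth, of 0]] by simp
    have m': "continuous_on ({0..1} \<times> (UNIV::R4 set)) (\<lambda>z. m (fst z))"
      unfolding m_def by (intro continuous_intros) auto
    have "continuous_on ({0..1} \<times> (UNIV::R4 set)) (\<lambda>z. \<eta> (fst z) (snd z))"
      unfolding \<eta>_def by (intro continuous_intros m')
    from continuous_on_compose2[OF XFc this]
    have XF\<eta>: "continuous_on ({0..1} \<times> (UNIV::R4 set)) (\<lambda>z. XF (\<eta> (fst z) (snd z)))" by simp
    have "\<forall>z\<in>{0..1} \<times> (UNIV::R4 set). m (fst z) \<noteq> 0" using m_pos by (simp add: less_imp_neq[symmetric])
    then show ?thesis unfolding V_def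
      by (intro continuous_on_scaleR continuous_on_minus continuous_on_mult continuous_on_const
          continuous_on_inverse m' XF\<eta>)
  qed
  have "\<exists>x. x 0 = p \<and> (\<forall>t\<in>{0..1}. (x has_vector_derivative V t (x t)) (at t within {0..1}))" for p
    using picard_lindelof[OF V_cont V_lip, of p] S L by (metis mult_pos_pos)
  then obtain R where R: "\<And>p. R p 0 = p"
    "\<And>p t. t \<in> {0..1} \<Longrightarrow> (R p has_vector_derivative V t (R p t)) (at t within {0..1})" by metis
  have unique: "R p t = x t"
    if "\<And>t. t \<in> {0..1} \<Longrightarrow> (x has_vector_derivative V t (x t)) (at t within {0..1})"
      "t0 \<in> {0..1}" "R p t0 = x t0" "t \<in> {0..1}" for p x t0 t
    by (rule ode_unique[of 0 1 "R p" V x "S * L" t0 t]) (use that R V_lip in auto)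
  have const: "R p t = q"
    if "\<And>t. t \<in> {0..1} \<Longrightarrow> V t q = 0" "t0 \<in> {0..1}" "R p t0 = q" "t \<in> {0..1}" for p q t0 t
    by (rule unique[of "\<lambda>_. q" t0 p t]) (use that in auto)
  have V_out: "V t p = 0" if "p \<notin> bidisk r" "t \<in> {0..1}" for t p
    using XF_out[OF \<eta>_out[OF that]] by (simp add: V_def)
  \<comment> \<open>Levels below that of the centre only sink under an expansion, hence
    \<open>\<eta> t p\<close> stays where \<open>XF\<close> vanishes.\<close>
  have V_low: "V t p = 0" if "y p \<le> e1" "t \<in> {0..1}" for t p
  proof -
    have "y (\<eta> t p) = e2 + m t * (y p - e2)" unfolding \<eta>_def by (rule y_aff)
    also have "\<dots> \<le> e2 + 1 * (y p - e2)"
      using m_ge1[OF that(2)] that(1) e by (intro add_left_mono mult_right_mono_neg) auto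
    finally show ?thesis using XF_low[of "\<eta> t p"] that(1) by (simp add: V_def)
  qed
  show thesis
  proof (rule that[of G "\<lambda>t p. R p t"])
    show "pCk k (\<lambda>_ z. G (fst z) (snd z)) ({0..1::real} \<times> UNIV)" for k
    proof -
      let ?U = "{0..1::real} \<times> (UNIV::(real \<times> R4) set)"
      have U: "open_slices ?U" by (rule open_slices_Times) auto
      have lin: "pCk k (\<lambda>_ z. (S / 2) * (1 - fst z)) ?U"
        by (intro pCk_mult pCk_diff pCk_const pCk_fst pCk_ident U)
      have ms: "pCk k (\<lambda>_ z. exp ((S / 2) * (1 - fst z))) ?U"
        by (rule pCk_real_compose[OF U pCk_exp lin]) simp
      have ims: "pCk k (\<lambda>_ z. exp (- ((S / 2) * (1 - fst z)))) ?U"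
        by (rule pCk_real_compose[OF U pCk_exp pCk_minus[OF U lin]]) simp
      have m_eq: "m t = exp ((S / 2) * (1 - t))" "inverse (m t) = exp (- ((S / 2) * (1 - t)))" for t
        by (simp_all add: m_def exp_minus)
      have \<eta>s: "pCk k (\<lambda>_ z. \<eta> (fst z) (snd z)) ?U"
        unfolding \<eta>_def m_eq by (intro pCk_add pCk_scaleR pCk_diff pCk_const pCk_snd pCk_ident ms U)
      have F\<eta>: "pCk k (\<lambda>_ z. F (\<eta> (fst z) (snd z))) ?U"
        by (rule pCk_compose[OF U _ F_smooth \<eta>s]) auto
      show ?thesis
        unfolding G_def m_eq(2) by (intro pCk_minus pCk_mult pCk_const ims F\<eta> U)
    qed
    show "G t p = 0" if "t \<in> {0..1}" "p \<notin> bidisk r" for t p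
      using F_out[OF \<eta>_out[OF that(2,1)]] by (simp add: G_def)
    show "R p 0 = p" for p by (rule R)
    show "((\<lambda>s. R p s) has_vector_derivative sharp a b (grad (G t) (R p t))) (at t within {0..1})"
      if "t \<in> {0..1}" for t p unfolding VG by (rule R(2)[OF that])
    show "R p t \<in> bidisk r" if t: "t \<in> {0..1}" and p: "p \<in> bidisk r" for t p
    proof (rule ccontr)
      \<comment> \<open>The field vanishes outside the bidisk at all times, so a trajectory that is
        outside once is constant, also backwards to its start.\<close>
      assume n: "R p t \<notin> bidisk r"
      have "R p 0 = R p t" by (rule const[OF V_out[OF n] t refl]) auto
      then show False using n p R(1) by simp
    qed
    show "R p 1 = p" if "p \<notin> bidisk r" for p
      by (rule const[OF V_out[OF that], of 0]) (auto simp: R)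
    show "R p 1 = p" if "\<sigma> * snd (snd p) \<le> e1" for p
      by (rule const[OF V_low, of _ 0]) (use that in \<open>auto simp: R y_def\<close>)
    show "f (R q 1) = q" if "e3 \<le> \<sigma> * snd (snd q)" for q
    proof -
      have yq: "e3 \<le> y q" using that by (simp add: y_def)
      define finv where "finv = inv f"
      have ff: "f (finv p) = p" "finv (f p) = p" for p
        using bij by (simp_all add: finv_def bij_is_surj surj_f_inv_f bij_is_inj)
      \<comment> \<open>Levels above that of the centre only rise. Hence \<open>cond\<close> applies
        to the preimage of \<open>\<eta> t q\<close> at every time and keeps it in the region where
        \<open>F\<close> equals \<open>h\<close>.\<close>
      have y\<eta>: "e3 \<le> y (\<eta> t q)" if "t \<in> {0..1}" for t
      proof -
        have "e2 + 1 * (y q - e2) \<le> e2 + m t * (y q - e2)"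
          using m_ge1[OF that] yq e by (intro add_left_mono mult_right_mono) auto
        then show ?thesis using yq y_aff[of "m t" q] by (simp add: \<eta>_def)
      qed
      define x where "x t = c + inverse (m t) *\<^sub>R (finv (\<eta> t q) - c)" for t
      have "(x has_vector_derivative V t (x t)) (at t within {0..1})" if t: "t \<in> {0..1}" for t
      proof -
        define p where "p = finv (\<eta> t q)"
        have fp: "f p = \<eta> t q" by (simp add: p_def ff)
        have yp: "e2 \<le> y p" using cond[of p] y\<eta>[OF t] by (simp add: y_def fp)
        have injD: "inj (Df p)"
        proof (rule linear_injective_0[OF linDf, THEN iffD2], intro allI impI)
          fix w assume "Df p w = 0"
          then have "omega a b w v = 0" for v using sympl'[of p w v] by (simp add: omega_simps)
          then show "w = 0" by (rule omega_nondegenerate[OF ab0])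
        qed
        obtain E where E: "linear E" "\<And>w. E (Df p w) = w" "\<And>w. Df p (E w) = w"
          using linear_injective_isomorphism[OF linDf injD] by blast
        have "(finv has_derivative E) (at (f p))"
        proof (rule has_derivative_inverse_strong[where f = f and x = p and f' = "Df p", OF open_UNIV UNIV_I])
          show "continuous_on UNIV f" by (rule has_derivative_continuous_on) (use Df in auto)
          show "Df p \<circ> E = id" using E(3) by auto
        qed (use ff Df in auto)
        then have dfinv: "(finv has_derivative E) (at (\<eta> t q))" by (simp add: fp)
        have Df_field: "Df p ((1/2) *\<^sub>R (p - c) + XF p) = (1/2) *\<^sub>R (f p - c)"
        proof -
          have "omega a b (Df p ((1/2) *\<^sub>R (p - c) + XF p) - (1/2) *\<^sub>R (f p - c)) w = 0" for w
          proof -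
            have "omega a b (Df p ((1/2) *\<^sub>R (p - c) + XF p) - (1/2) *\<^sub>R (f p - c)) (Df p (E w)) = 0"
              by (simp only: omega_simps sympl' omega_XF_high[OF yp]) simp
            then show ?thesis by (simp add: E(3))
          qed
          from omega_nondegenerate[OF ab0 this] show ?thesis by simp
        qed
        have "((\<lambda>t. \<eta> t q) has_vector_derivative ((- (S / 2) * m t) *\<^sub>R (q - c))) (at t within {0..1})"
          unfolding \<eta>_def
          by (rule has_vector_derivative_eq_rhs)
            (rule has_vector_derivative_add[OF has_vector_derivative_const
              has_vector_derivative_scaleR[OF m_der has_vector_derivative_const]], simp)
        moreover have "(- (S / 2) * m t) *\<^sub>R (q - c) = (- S) *\<^sub>R ((1/2) *\<^sub>R (f p - c))"
          by (simp add: fp \<eta>_def)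
        ultimately have "((\<lambda>t. \<eta> t q) has_vector_derivative (- S) *\<^sub>R Df p ((1/2) *\<^sub>R (p - c) + XF p)) (at t within {0..1})"
          by (simp only: Df_field)
        from vector_derivative_diff_chain_within[OF this has_derivative_at_withinI[OF dfinv]]
        have "((\<lambda>t. finv (\<eta> t q)) has_vector_derivative E ((- S) *\<^sub>R Df p ((1/2) *\<^sub>R (p - c) + XF p))) (at t within {0..1})"
          by (simp only: o_def)
        then have dr: "((\<lambda>t. finv (\<eta> t q)) has_vector_derivative (- S) *\<^sub>R ((1/2) *\<^sub>R (p - c) + XF p)) (at t within {0..1})"
          by (simp only: linear_cmul[OF E(1)] E(2))
        have im: "((\<lambda>t. inverse (m t)) has_real_derivative (S / 2) * inverse (m t)) (at t within {0..1})"
          using DERIV_inverse'[OF m_der, of t "{0..1}"] m_pos[of t] by (simp add: field_simps)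
        have "(x has_vector_derivative (inverse (m t) *\<^sub>R ((- S) *\<^sub>R ((1/2) *\<^sub>R (p - c) + XF p) - 0) + ((S / 2) * inverse (m t)) *\<^sub>R (finv (\<eta> t q) - c))) (at t within {0..1})"
          unfolding x_def
          by (rule has_vector_derivative_eq_rhs)
            (rule has_vector_derivative_add[OF has_vector_derivative_const
              has_vector_derivative_scaleR[OF im has_vector_derivative_diff[OF dr has_vector_derivative_const]]], simp)
        \<comment> \<open>The radial term from the velocity of \<open>finv (\<eta> t q)\<close> and
          the one from the derivative of \<open>inverse (m t)\<close> cancel; only the multiple of
          \<open>XF p\<close> survives.\<close>
        moreover have "inverse (m t) *\<^sub>R ((- S) *\<^sub>R ((1/2) *\<^sub>R (p - c) + XF p) - 0) + ((S / 2) * inverse (m t)) *\<^sub>R (finv (\<eta> t q) - c)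
            = (- (S * inverse (m t))) *\<^sub>R XF p"
          unfolding p_def[symmetric] by (simp add: algebra_simps)
        moreover have "V t (x t) = (- (S * inverse (m t))) *\<^sub>R XF p"
          unfolding V_def x_def \<eta>_inv p_def[symmetric] ..
        ultimately show ?thesis by simp
      qed
      moreover have "R q 0 = x 0"
      proof -
        \<comment> \<open>At time 0 the dilated point has left the support of \<open>f\<close>, so
          dilating back returns the curve to \<open>q\<close>: it starts where the trajectory
          does.\<close>
        have "1 \<le> y (\<eta> 0 q)"
        proof -
          have "m 0 * (e3 - e2) \<le> m 0 * (y q - e2)" using yq m_pos[of 0] by (intro mult_left_mono) auto
          then show ?thesis using m0 y_aff[of "m 0" q] e by (simp add: \<eta>_def)
        qed
        then have "f (\<eta> 0 q) = \<eta> 0 q" by (intro supp y_out)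
        then have "finv (\<eta> 0 q) = \<eta> 0 q" using ff(2)[of "\<eta> 0 q"] by simp
        then show ?thesis using m_pos[of 0] by (simp add: x_def \<eta>_def R)
      qed
      ultimately have "R q 1 = x 1" by (intro unique[of x 0 q 1]) auto
      also have "x 1 = finv q" by (simp add: x_def \<eta>_def m_def)
      finally show ?thesis by (simp add: ff)
    qed
  qed
qed

section \<open>The chart \<open>\<D>\<^sup>2 \<times> \<D>\<^sup>2\<close>\<close>

definition chart :: "R4 \<Rightarrow> R3 \<times> R3" where
  "chart z = (hemi (fst z), hemi (snd z))"

definition chart_inv :: "R3 \<times> R3 \<Rightarrow> R4" where
  "chart_inv x = (lambert (fst x), lambert (snd x))"

definition chart_dom :: "R4 set" where
  "chart_dom = {z. (norm (fst z))\<^sup>2 < 2} \<inter> {z. (norm (snd z))\<^sup>2 < 2}"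

definition chart_ran :: "(R3 \<times> R3) set" where
  "chart_ran = {x. -1 < fst x $ 3} \<inter> {x. -1 < snd x $ 3}"

lemma open_chart_dom: "open chart_dom"
  unfolding chart_dom_def by (intro open_Int open_Collect_less continuous_intros)

lemma open_chart_ran: "open chart_ran"
  unfolding chart_ran_def by (intro open_Int open_Collect_less continuous_intros)

lemma bidisk_subset_chart_dom: "0 < r \<Longrightarrow> r < 1 \<Longrightarrow> bidisk r \<subseteq> chart_dom"
proof
  fix z assume r: "0 < r" "r < 1" and z: "z \<in> bidisk r"
  have "(norm u)\<^sup>2 < 2" if "norm u \<le> r" for u :: "real \<times> real"
  proof -
    have "(norm u)\<^sup>2 \<le> 1" using that r by (intro power_le_one) auto
    then show ?thesis by simp
  qed
  then show "z \<in> chart_dom" using z by (auto simp: bidisk_def chart_dom_def)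
qed

lemma chart_in_S2_prod: "z \<in> chart_dom \<Longrightarrow> chart z \<in> S2_prod"
  using hemi_in_S2 by (auto simp: chart_dom_def chart_def S2_prod_def)

lemma chart_in_ran: "z \<in> chart_dom \<Longrightarrow> chart z \<in> chart_ran"
  by (auto simp: chart_dom_def chart_def chart_ran_def hemi_nth)

lemma chart_inv_chart: "z \<in> chart_dom \<Longrightarrow> chart_inv (chart z) = z"
  by (auto simp: chart_dom_def chart_def chart_inv_def lambert_hemi)

lemma chart_chart_inv: "x \<in> S2_prod \<Longrightarrow> x \<in> chart_ran \<Longrightarrow> chart (chart_inv x) = x"
  by (auto simp: chart_ran_def chart_def chart_inv_def hemi_lambert S2_prod_def)

lemma inj_on_chart: "inj_on chart chart_dom"
  by (rule inj_on_inverseI[of _ chart_inv]) (rule chart_inv_chart)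

lemma chart_bidisk:
  assumes "0 < r" "r < 1"
  shows "x \<in> chart ` bidisk r \<longleftrightarrow> x \<in> S2_prod \<and> 1 - r\<^sup>2 \<le> fst x $ 3 \<and> 1 - r\<^sup>2 \<le> snd x $ 3"
proof
  assume "x \<in> chart ` bidisk r"
  then obtain z where z: "x = chart z" "z \<in> bidisk r" by blast
  have "(norm (fst z))\<^sup>2 \<le> r\<^sup>2" "(norm (snd z))\<^sup>2 \<le> r\<^sup>2"
    using z(2) assms by (auto simp: bidisk_def intro!: power_mono)
  then show "x \<in> S2_prod \<and> 1 - r\<^sup>2 \<le> fst x $ 3 \<and> 1 - r\<^sup>2 \<le> snd x $ 3"
    using chart_in_S2_prod[OF subsetD[OF bidisk_subset_chart_dom[OF assms] z(2)]] unfolding z(1)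
    by (simp add: chart_def hemi_nth)
next
  assume x: "x \<in> S2_prod \<and> 1 - r\<^sup>2 \<le> fst x $ 3 \<and> 1 - r\<^sup>2 \<le> snd x $ 3"
  have "r\<^sup>2 < 1" using assms by (simp add: power_less_one_iff abs_square_less_1)
  then have ran: "x \<in> chart_ran" using x by (auto simp: chart_ran_def)
  then have "(norm (fst (chart_inv x)))\<^sup>2 = 1 - fst x $ 3" "(norm (snd (chart_inv x)))\<^sup>2 = 1 - snd x $ 3"
    using x by (auto simp: chart_inv_def chart_ran_def S2_prod_def norm_lambert)
  then have "(norm (fst (chart_inv x)))\<^sup>2 \<le> r\<^sup>2" "(norm (snd (chart_inv x)))\<^sup>2 \<le> r\<^sup>2" using x by auto
  then have "norm (fst (chart_inv x)) \<le> r" "norm (snd (chart_inv x)) \<le> r"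
    using assms by (auto intro: power2_le_imp_le)
  then have "chart_inv x \<in> bidisk r" by (cases "chart_inv x") (auto simp: bidisk_def)
  then show "x \<in> chart ` bidisk r" using chart_chart_inv[of x] x ran by (metis image_eqI)
qed

lemma pCk_chart: "pCk k (\<lambda>_. chart) (T \<times> chart_dom)"
proof -
  let ?W = "T \<times> chart_dom"
  have W: "open_slices ?W" by (rule open_slices_Times[OF open_chart_dom])
  have 1: "pCk k (\<lambda>_ z. hemi (fst z)) ?W"
    by (rule pCk_compose[OF W _ pCk_hemi[where T = T] pCk_fst[OF W pCk_ident[OF W]]]) (auto simp: chart_dom_def)
  have 2: "pCk k (\<lambda>_ z. hemi (snd z)) ?W"
    by (rule pCk_compose[OF W _ pCk_hemi[where T = T] pCk_snd[OF W pCk_ident[OF W]]]) (auto simp: chart_dom_def)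
  show ?thesis unfolding chart_def[abs_def] by (rule pCk_Pair[OF W 1 2])
qed

lemma pCk_chart_inv: "pCk k (\<lambda>_. chart_inv) (T \<times> chart_ran)"
proof -
  let ?W = "T \<times> chart_ran"
  have W: "open_slices ?W" by (rule open_slices_Times[OF open_chart_ran])
  have 1: "pCk k (\<lambda>_ z. lambert (fst z)) ?W"
    by (rule pCk_compose[OF W _ pCk_lambert[where T = T] pCk_fst[OF W pCk_ident[OF W]]]) (auto simp: chart_ran_def)
  have 2: "pCk k (\<lambda>_ z. lambert (snd z)) ?W"
    by (rule pCk_compose[OF W _ pCk_lambert[where T = T] pCk_snd[OF W pCk_ident[OF W]]]) (auto simp: chart_ran_def)
  show ?thesis unfolding chart_inv_def[abs_def] by (rule pCk_Pair[OF W 1 2])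
qed

lemma chart_has_derivative:
  "z \<in> chart_dom \<Longrightarrow> (chart has_derivative frechet_derivative chart (at z)) (at z)"
  by (rule pCk_has_derivative[OF pCk_chart[of "Suc 0" UNIV], of "0::real"]) simp

lemma chart_inv_has_derivative:
  "x \<in> chart_ran \<Longrightarrow> (chart_inv has_derivative frechet_derivative chart_inv (at x)) (at x)"
  by (rule pCk_has_derivative[OF pCk_chart_inv[of "Suc 0" UNIV], of "0::real"]) simp

lemma continuous_on_chart: "continuous_on chart_dom chart"
  using Ck_on_continuous[OF pCk_imp_Ck_on[OF pCk_chart[of 0 UNIV], of "0::real"]] by simp

lemma compact_chart_image:
  "0 < r \<Longrightarrow> r < 1 \<Longrightarrow> compact K \<Longrightarrow> K \<subseteq> bidisk r \<Longrightarrow> compact (chart ` K)"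
  using bidisk_subset_chart_dom continuous_on_chart
  by (intro compact_continuous_image) (auto intro: continuous_on_subset)

lemma chart_symplectic:
  assumes "norm (fst z) \<le> 1" "norm (snd z) \<le> 1"
  shows "symp_form a b (chart z) (frechet_derivative chart (at z) u) (frechet_derivative chart (at z) v) = omega a b u v"
proof -
  have D: "fst z \<in> D2" "snd z \<in> D2" using assms by (auto simp: D2_def)
  obtain d1 where d1: "(hemi has_derivative d1) (at (fst z))"
    "\<And>u v. a * S2_area_form (hemi (fst z)) (d1 u) (d1 v) = D2_area_form (a / 2) u v"
    using hemi_area_preserving[OF D(1)] by metis
  obtain d2 where d2: "(hemi has_derivative d2) (at (snd z))"
    "\<And>u v. b * S2_area_form (hemi (snd z)) (d2 u) (d2 v) = D2_area_form (b / 2) u v"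
    using hemi_area_preserving[OF D(2)] by metis
  have "(chart has_derivative (\<lambda>u. (d1 (fst u), d2 (snd u)))) (at z)"
    unfolding chart_def[abs_def]
    using diff_chain_at[OF has_derivative_fst[OF has_derivative_ident] d1(1)]
      diff_chain_at[OF has_derivative_snd[OF has_derivative_ident] d2(1)]
    by (intro has_derivative_Pair) (simp_all add: o_def)
  from frechet_derivative_at[OF this, symmetric]
  show ?thesis by (simp add: symp_form_def chart_def d1(2) d2(2) omega_def)
qed

text \<open>\<open>chart\<close> after \<open>chart_inv\<close> is the identity only on the sphere
  product, which is not open. Near \<open>x\<close> it equals \<open>retr\<close> once composed with
  \<open>retr\<close>; this identity can be differentiated, and the derivative of
  \<open>retr\<close> fixes tangent vectors.\<close>

lemma chart_derivative_surj_tangent: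
  assumes x: "x \<in> S2_prod" "x \<in> chart_ran" and W: "w \<in> tangent_S2_prod x"
  shows "frechet_derivative chart (at (chart_inv x)) (frechet_derivative chart_inv (at x) w) = w"
proof -
  obtain Dr where Dr: "(retr has_derivative Dr) (at x)" "\<And>w. w \<in> tangent_S2_prod x \<Longrightarrow> Dr w = w"
    using retr_derivative_tangent[OF x(1)] by blast
  have xr: "retr x = x" by (rule retr_ident[OF x(1)])
  have dom: "chart_inv x \<in> chart_dom"
    using x norm_lambert by (auto simp: chart_dom_def chart_inv_def chart_ran_def S2_prod_def)
  have "(chart_inv has_derivative frechet_derivative chart_inv (at x)) (at (retr x))"
    using chart_inv_has_derivative[OF x(2)] by (simp add: xr)
  from diff_chain_at[OF Dr(1) this]
  have 1: "((\<lambda>y. chart_inv (retr y)) has_derivative (\<lambda>w. frechet_derivative chart_inv (at x) (Dr w))) (at x)" by (simp add: o_def)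
  have "(chart has_derivative frechet_derivative chart (at (chart_inv x))) (at (chart_inv (retr x)))"
    using chart_has_derivative[OF dom] by (simp add: xr)
  from diff_chain_at[OF 1 this]
  have 2: "((\<lambda>y. chart (chart_inv (retr y))) has_derivative
      (\<lambda>w. frechet_derivative chart (at (chart_inv x)) (frechet_derivative chart_inv (at x) (Dr w)))) (at x)" by (simp add: o_def)
  have "continuous (at x) retr" by (rule has_derivative_continuous[OF Dr(1)])
  then have "\<exists>N. open N \<and> x \<in> N \<and> (\<forall>y\<in>N. retr y \<in> chart_ran)"
    using open_chart_ran x(2) unfolding continuous_at_open by (metis xr)
  then obtain N where N: "open N" "x \<in> N" "\<forall>y\<in>N. retr y \<in> chart_ran" by blast
  have "(retr has_derivative (\<lambda>w. frechet_derivative chart (at (chart_inv x)) (frechet_derivative chart_inv (at x) (Dr w)))) (at x)"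
  proof (rule has_derivative_transform_within_open[OF 2, of "N \<inter> retr_dom"])
    show "open (N \<inter> retr_dom)" using N(1) open_retr_dom by blast
    show "x \<in> N \<inter> retr_dom" using N(2) x(1) S2_prod_subset_retr_dom by blast
    show "chart (chart_inv (retr y)) = retr y" if "y \<in> N \<inter> retr_dom" for y
      using that N(3) by (intro chart_chart_inv retr_in_S2_prod) auto
  qed
  from fun_cong[OF has_derivative_unique[OF this Dr(1)], of w] Dr(2)[OF W] show ?thesis by simp
qed

text \<open>The Hamiltonian is \<open>G\<close> read through the chart, and 0 outside the chart. It
  is smooth because \<open>G\<close> vanishes off a compact bidisk, so that the chart and the
  complement of the image of the bidisk form an open cover with a formula on each. \<open>G\<close>
  is assumed smooth in time as well, since membership in \<open>Ham\<close> asks for joint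
  smoothness.\<close>

lemma Ham_transplant:
  fixes G :: "real \<Rightarrow> R4 \<Rightarrow> real" and \<rho> :: "real \<Rightarrow> R4 \<Rightarrow> R4"
  assumes ab: "0 < a" "0 < b" and r: "0 < r" "r < 1"
    and G: "\<And>k. pCk k (\<lambda>_ z. G (fst z) (snd z)) ({0..1::real} \<times> UNIV)"
    and G0: "\<And>t p. t \<in> {0..1} \<Longrightarrow> p \<notin> bidisk r \<Longrightarrow> G t p = 0"
    and \<rho>0: "\<And>p. \<rho> 0 p = p"
    and \<rho>: "\<And>t p. t \<in> {0..1} \<Longrightarrow> ((\<lambda>s. \<rho> s p) has_vector_derivative sharp a b (grad (G t) (\<rho> t p))) (at t within {0..1})"
    and \<rho>_in: "\<And>t p. t \<in> {0..1} \<Longrightarrow> p \<in> bidisk r \<Longrightarrow> \<rho> t p \<in> bidisk r"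
  shows "(\<lambda>x. if x \<in> chart ` bidisk r then chart (\<rho> 1 (chart_inv x)) else x) \<in> Ham a b"
proof -
  let ?K = "chart ` bidisk r"
  have Kcl: "open (- ?K)"
    using compact_imp_closed[OF compact_chart_image[OF r compact_bidisk subset_refl]] by (simp add: open_Compl)
  note dom = bidisk_subset_chart_dom[OF r, THEN subsetD]
  define H where "H t x = (if x \<in> chart_ran then G t (chart_inv x) else 0)" for t x
  define \<phi> where "\<phi> t x = (if x \<in> ?K then chart (\<rho> t (chart_inv x)) else x)" for t x
  have H_out: "H t x = 0" if "t \<in> {0..1}" "x \<in> S2_prod" "x \<notin> ?K" for t x
  proof (cases "x \<in> chart_ran")
    case True
    have "chart_inv x \<notin> bidisk r" using chart_chart_inv[OF that(2) True] that(3) by (metis image_eqI)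
    then show ?thesis using G0 that(1) by (simp add: H_def True)
  qed (simp add: H_def)
  have "smooth_on ({0..1} \<times> S2_prod) (\<lambda>(t, x). H t x)"
    unfolding smooth_on_def
  proof (intro ballI)
    fix tx :: "real \<times> R3 \<times> R3" assume tx: "tx \<in> {0..1} \<times> S2_prod"
    show "\<exists>U F. open U \<and> tx \<in> U \<and> (\<forall>k. Ck_on k F U) \<and> (\<forall>y\<in>({0..1} \<times> S2_prod) \<inter> U. F y = (case y of (t, x) \<Rightarrow> H t x))"
    proof (cases "snd tx \<in> chart_ran")
      case True
      let ?U = "(UNIV :: real set) \<times> chart_ran"
      have U: "open ?U" by (intro open_Times open_UNIV open_chart_ran)
      have sl: "open_slices ({0..1::real} \<times> ?U)" by (rule open_slices_Times[OF U])
      have "Ck_on k (\<lambda>z. G (fst z) (chart_inv (snd z))) ?U" for k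
      proof (rule pCk_imp_Ck_on[where T = "{0..1::real}" and t = 0])
        have "pCk k (\<lambda>_ z. chart_inv (snd z)) ({0..1::real} \<times> ?U)"
          by (rule pCk_compose[OF sl _ pCk_chart_inv[where T = "{0..1}"] pCk_snd[OF sl pCk_ident[OF sl]]]) auto
        then have p: "pCk k (\<lambda>_ z. (fst z, chart_inv (snd z))) ({0..1::real} \<times> ?U)"
          by (intro pCk_Pair pCk_fst pCk_ident sl)
        have "pCk k (\<lambda>_ z. (\<lambda>z. G (fst z) (snd z)) (fst z, chart_inv (snd z))) ({0..1::real} \<times> ?U)"
          by (rule pCk_compose[OF sl _ G p]) auto
        then show "pCk k (\<lambda>_ z. G (fst z) (chart_inv (snd z))) ({0..1::real} \<times> ?U)" by simp
      qed simp
      then show ?thesis using U True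
        by (intro exI[of _ ?U] exI[of _ "\<lambda>z. G (fst z) (chart_inv (snd z))"]) (auto simp: H_def mem_Times_iff)
    next
      case False
      let ?U = "(UNIV :: real set) \<times> - ?K"
      have U: "open ?U" by (intro open_Times open_UNIV Kcl)
      have "snd tx \<notin> ?K" using False chart_in_ran dom by auto
      moreover have "Ck_on k (\<lambda>_. 0::real) ?U" for k
        by (rule pCk_imp_Ck_on[where T = "{0..1::real}" and t = 0]) (auto intro!: pCk_const open_slices_Times U)
      ultimately show ?thesis using U H_out
        by (intro exI[of _ ?U] exI[of _ "\<lambda>_. 0"]) (auto simp: mem_Times_iff)
    qed
  qed
  moreover have "is_ham_flow a b H \<phi>"
    unfolding is_ham_flow_def
  proof (intro ballI conjI)
    fix x assume x: "x \<in> S2_prod"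
    show "\<phi> 0 x = x"
      using dom by (auto simp: \<phi>_def \<rho>0 chart_inv_chart)
    fix t :: real assume t: "t \<in> {0..1}"
    show "\<phi> t x \<in> S2_prod"
    proof (cases "x \<in> ?K")
      case True
      then obtain z where z: "x = chart z" "z \<in> bidisk r" by blast
      then have "\<phi> t x = chart (\<rho> t z)" using dom by (simp add: \<phi>_def chart_inv_chart)
      then show ?thesis using chart_in_S2_prod[OF dom[OF \<rho>_in[OF t z(2)]]] by simp
    qed (use x in \<open>simp add: \<phi>_def\<close>)
    show "\<exists>V. is_ham_vector a b (H t) (\<phi> t x) V \<and> ((\<lambda>s. \<phi> s x) has_vector_derivative V) (at t within {0..1})"
    proof (cases "x \<in> ?K")
      case False
      obtain d where d: "0 < d" "ball x d \<subseteq> - ?K" using Kcl False open_contains_ball by blast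
      have "(H t has_derivative (\<lambda>_. 0)) (at x within S2_prod)"
        by (rule has_derivative_transform_within[OF has_derivative_const[of 0] d(1) x])
          (use H_out[OF t] d(2) in \<open>force simp: dist_commute\<close>)
      moreover have "symp_form a b x 0 w = 0" for w
        using symp_form_diff[of a b x 0 0 w] by simp
      ultimately have "is_ham_vector a b (H t) (\<phi> t x) 0"
        unfolding is_ham_vector_def using False by (auto simp: \<phi>_def tangent_S2_prod_def)
      then show ?thesis using False by (intro exI[of _ 0]) (simp add: \<phi>_def)
    next
      case True
      then obtain z where z: "x = chart z" "z \<in> bidisk r" by blast
      define p where "p = \<rho> t z"
      define n where "n = grad (G t) p"
      define V where "V = frechet_derivative chart (at p) (sharp a b n)"
      have p: "p \<in> bidisk r" using \<rho>_in[OF t z(2)] by (simp add: p_def)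
      have pd: "p \<in> chart_dom" using dom p by blast
      have \<phi>t: "\<phi> s x = chart (\<rho> s z)" for s
        using True dom z by (simp add: \<phi>_def chart_inv_chart)
      have y: "\<phi> t x = chart p" by (simp add: \<phi>t p_def)
      have yS: "chart p \<in> S2_prod" and yr: "chart p \<in> chart_ran" using pd chart_in_S2_prod chart_in_ran by auto
      have cy: "chart_inv (chart p) = p" by (rule chart_inv_chart[OF pd])
      have Gd: "(G t has_derivative (\<lambda>w. n \<bullet> w)) (at p)"
      proof -
        have "Ck_on (Suc 0) (\<lambda>z. G (fst z) (snd z)) UNIV" by (rule pCk_imp_Ck_on[OF G, of 0]) auto
        from pCk_has_derivative[OF Ck_on_slice[OF open_UNIV this], of t p]
        have "(G t has_derivative frechet_derivative (G t) (at p)) (at p)" by simp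
        from this grad_inner[OF this] show ?thesis unfolding n_def by (auto elim!: has_derivative_eq_rhs)
      qed
      define dh where "dh w = n \<bullet> frechet_derivative chart_inv (at (chart p)) w" for w
      have "((\<lambda>y. G t (chart_inv y)) has_derivative dh) (at (chart p))"
        using diff_chain_at[OF chart_inv_has_derivative[OF yr], of "G t" "\<lambda>w. n \<bullet> w"] Gd
        by (simp add: o_def dh_def[abs_def] cy)
      then have "(H t has_derivative dh) (at (chart p))"
        by (rule has_derivative_transform_within_open[OF _ open_chart_ran yr]) (simp add: H_def)
      then have "(H t has_derivative dh) (at (chart p) within S2_prod)" by (rule has_derivative_at_withinI)
      moreover have "V \<in> tangent_S2_prod (chart p)"
        unfolding V_def by (rule tangent_of_S2_prod_valued[OF chart_has_derivative[OF pd] open_chart_dom pd chart_in_S2_prod])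
      moreover have "symp_form a b (chart p) V w = - dh w" if w: "w \<in> tangent_S2_prod (chart p)" for w
      proof -
        define u where "u = frechet_derivative chart_inv (at (chart p)) w"
        \<comment> \<open>Every tangent vector at \<open>chart p\<close> is the image of a vector of
          R^4, so the defining identity can be checked there, where \<open>chart_symplectic\<close>
          and \<open>omega_sharp\<close> apply.\<close>
        have wu: "w = frechet_derivative chart (at p) u"
          using chart_derivative_surj_tangent[OF yS yr w] by (simp add: u_def cy)
        have "symp_form a b (chart p) V w = omega a b (sharp a b n) u"
          unfolding V_def wu by (rule chart_symplectic) (use p r in \<open>auto simp: bidisk_def\<close>)
        also have "\<dots> = - (n \<bullet> u)" by (rule omega_sharp) (use ab in auto)
        finally show ?thesis by (simp add: dh_def u_def)
      qed
      ultimately have "is_ham_vector a b (H t) (\<phi> t x) V"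
        unfolding is_ham_vector_def y by blast
      moreover have "((\<lambda>s. \<phi> s x) has_vector_derivative V) (at t within {0..1})"
      proof -
        have c: "(chart has_derivative frechet_derivative chart (at p)) (at (\<rho> t z) within (\<lambda>s. \<rho> s z) ` {0..1})"
          by (rule has_derivative_at_withinI) (use chart_has_derivative[OF pd] in \<open>simp add: p_def\<close>)
        from vector_derivative_diff_chain_within[OF \<rho>[OF t, of z] c]
        show ?thesis by (simp add: o_def \<phi>t V_def n_def p_def)
      qed
      ultimately show ?thesis by blast
    qed
  qed
  ultimately show ?thesis
    unfolding Ham_def by (intro CollectI exI[of _ H] exI[of _ \<phi>]) (auto simp: \<phi>_def)
qed

section \<open>Concatenation and cutting on \<open>S\<^sup>2 \<times> S\<^sup>2\<close>\<close>

lemma smooth_on_add: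
  assumes "smooth_on S f" "smooth_on S g"
  shows "smooth_on S (\<lambda>x. f x + g x)"
  unfolding smooth_on_def
proof
  fix x assume x: "x \<in> S"
  obtain U F where F: "open U" "x \<in> U" "\<And>k. Ck_on k F U" "\<And>y. y \<in> S \<inter> U \<Longrightarrow> F y = f y"
    using assms(1) x unfolding smooth_on_def by metis
  obtain V G where G: "open V" "x \<in> V" "\<And>k. Ck_on k G V" "\<And>y. y \<in> S \<inter> V \<Longrightarrow> G y = g y"
    using assms(2) x unfolding smooth_on_def by metis
  let ?T = "{0..1::real}"
  have UV: "open (U \<inter> V)" using F(1) G(1) by blast
  have "Ck_on k (\<lambda>x. F x + G x) (U \<inter> V)" for k
  proof (rule pCk_imp_Ck_on[where T = ?T and t = 0])
    show "pCk k (\<lambda>_ x. F x + G x) (?T \<times> (U \<inter> V))"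
      by (intro pCk_add open_slices_Times UV pCk_subset[OF Ck_on_imp_pCk[OF F(3)]] pCk_subset[OF Ck_on_imp_pCk[OF G(3)]])
        auto
  qed simp
  then show "\<exists>U Fa. open U \<and> x \<in> U \<and> (\<forall>k. Ck_on k Fa U) \<and> (\<forall>y\<in>S \<inter> U. Fa y = f y + g y)"
    using UV F G by (intro exI[of _ "U \<inter> V"] exI[of _ "\<lambda>x. F x + G x"]) auto
qed

text \<open>With \<open>c\<close> the derivative of \<open>\<sigma>\<close> this is the Hamiltonian
  of the flow run along the time change \<open>\<sigma>\<close>.\<close>

lemma smooth_on_reparam:
  fixes H :: "real \<Rightarrow> 'a::euclidean_space \<Rightarrow> real" and c \<sigma> :: "real \<Rightarrow> real"
  assumes H: "smooth_on ({0..1} \<times> S) (\<lambda>(t, x). H t x)"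
    and c: "\<And>k. pCk k (\<lambda>_::real. c) ({0..1} \<times> UNIV)" and \<sigma>: "\<And>k. pCk k (\<lambda>_::real. \<sigma>) ({0..1} \<times> UNIV)"
    and \<sigma>01: "\<And>t. \<sigma> t \<in> {0..1::real}"
  shows "smooth_on ({0..1} \<times> S) (\<lambda>(t, x). c t * H (\<sigma> t) x)"
  unfolding smooth_on_def
proof
  fix z assume z: "z \<in> {0..1::real} \<times> S"
  then have "(\<sigma> (fst z), snd z) \<in> {0..1} \<times> S" using \<sigma>01 by auto
  then obtain U F where F: "open U" "(\<sigma> (fst z), snd z) \<in> U" "\<And>k. Ck_on k F U"
    "\<And>y. y \<in> ({0..1} \<times> S) \<inter> U \<Longrightarrow> F y = (case y of (t, x) \<Rightarrow> H t x)"
    using H unfolding smooth_on_def by metis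
  let ?T = "{0..1::real}"
  define \<sigma>' where "\<sigma>' y = (\<sigma> (fst y), snd y)" for y :: "real \<times> 'a"
  define V where "V = \<sigma>' -` U"
  have WU: "open_slices (?T \<times> (UNIV::(real \<times> 'a) set))" by (rule open_slices_Times) auto
  have lift: "pCk k (\<lambda>_ y. h (fst y)) (?T \<times> (UNIV::(real \<times> 'a) set))" if "pCk k (\<lambda>_::real. h) (?T \<times> UNIV)"
    for h :: "real \<Rightarrow> real" and k
    by (rule pCk_compose[OF WU _ that pCk_fst[OF WU pCk_ident[OF WU]]]) auto
  have \<sigma>'s: "pCk k (\<lambda>_. \<sigma>') (?T \<times> UNIV)" for k
    unfolding \<sigma>'_def[abs_def] by (intro pCk_Pair lift \<sigma> pCk_snd pCk_ident WU)
  have V: "open V"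
  proof -
    have "continuous_on UNIV \<sigma>'" using Ck_on_continuous[OF pCk_imp_Ck_on[OF \<sigma>'s, of 0]] by simp
    then show ?thesis unfolding V_def using F(1) by (simp add: open_vimage)
  qed
  have WV: "open_slices (?T \<times> V)" by (rule open_slices_Times[OF V])
  have "Ck_on k (\<lambda>y. c (fst y) * F (\<sigma>' y)) V" for k
  proof (rule pCk_imp_Ck_on[where T = ?T and t = 0])
    have "pCk k (\<lambda>_ y. F (\<sigma>' y)) (?T \<times> V)"
      by (rule pCk_compose[OF WV _ Ck_on_imp_pCk[OF F(3), where T = ?T] pCk_subset[OF \<sigma>'s]]) (auto simp: V_def)
    moreover have "pCk k (\<lambda>_ y. c (fst y)) (?T \<times> V)" by (rule pCk_subset[OF lift[OF c]]) auto
    ultimately show "pCk k (\<lambda>_ y. c (fst y) * F (\<sigma>' y)) (?T \<times> V)" by (intro pCk_mult WV)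
  qed simp
  moreover have "z \<in> V" using F(2) by (simp add: V_def \<sigma>'_def)
  moreover have "c (fst y) * F (\<sigma>' y) = (case y of (t, x) \<Rightarrow> c t * H (\<sigma> t) x)" if "y \<in> ({0..1} \<times> S) \<inter> V" for y
    using that F(4)[of "\<sigma>' y"] \<sigma>01 by (auto simp: V_def \<sigma>'_def)
  ultimately show "\<exists>U Fa. open U \<and> z \<in> U \<and> (\<forall>k. Ck_on k Fa U) \<and>
      (\<forall>y\<in>({0..1} \<times> S) \<inter> U. Fa y = (case y of (t, x) \<Rightarrow> c t * H (\<sigma> t) x))"
    using V by blast
qed

definition step_deriv :: "real \<Rightarrow> real" where
  "step_deriv x = frechet_derivative smooth_step (at x) 1"

lemma pCk_step_deriv: "pCk k (\<lambda>_. step_deriv) (T \<times> UNIV)"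
  unfolding step_deriv_def[abs_def] by (rule pCk_SucD[OF pCk_smooth_step])

lemma smooth_step_has_derivative: "(smooth_step has_real_derivative step_deriv x) (at x)"
proof -
  have D: "(smooth_step has_derivative frechet_derivative smooth_step (at x)) (at x)"
    by (rule pCk_has_derivative[OF pCk_smooth_step[of "Suc 0" UNIV], of "0::real"]) simp
  have "frechet_derivative smooth_step (at x) h = step_deriv x * h" for h
    using linear_cmul[OF has_derivative_linear[OF D], of h 1] by (simp add: step_deriv_def mult.commute)
  then show ?thesis using D by (simp add: has_field_derivative_def) (metis (no_types, lifting) ext)
qed

lemma step_deriv_eq_0:
  assumes "x < 1/3 \<or> 2/3 < x" shows "step_deriv x = 0"
proof -
  have "((\<lambda>_. smooth_step x) has_real_derivative 0) (at x)" by simp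
  then have "(smooth_step has_real_derivative 0) (at x)"
  proof (rule has_field_derivative_transform_within_open)
    show "open (if x < 1/3 then {..<1/3} else {2/3<..} :: real set)" by auto
    show "x \<in> (if x < 1/3 then {..<1/3} else {2/3<..})" using assms by auto
    show "smooth_step x = smooth_step y" if "y \<in> (if x < 1/3 then {..<1/3} else {2/3<..})" for y
      using that assms by (auto simp: smooth_step_eq_0 smooth_step_eq_1 split: if_splits)
  qed
  then show ?thesis using smooth_step_has_derivative DERIV_unique by blast
qed

lemma is_ham_vector_scale:
  assumes "is_ham_vector a b h x V"
  shows "is_ham_vector a b (\<lambda>y. c * h y) x (c *\<^sub>R V)"
proof -
  obtain dh where dh: "V \<in> tangent_S2_prod x" "(h has_derivative dh) (at x within S2_prod)"
    "\<forall>w\<in>tangent_S2_prod x. symp_form a b x V w = - dh w"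
    using assms unfolding is_ham_vector_def by blast
  have "symp_form a b x (c *\<^sub>R V) w = c * symp_form a b x V w" for w
    by (simp add: symp_form_def S2_area_form_def cross_mult_left distrib_left mult_ac)
  then show ?thesis unfolding is_ham_vector_def using dh
    by (intro conjI exI[of _ "\<lambda>w. c * dh w"] has_derivative_mult_right)
      (auto simp: tangent_S2_prod_def)
qed

text \<open>Reparametrised by \<open>smooth_step\<close>, the two isotopies are constant near the time 1/2 at which they
  are joined.\<close>

lemma Ham_comp:
  assumes "g \<in> Ham a b" "k \<in> Ham a b"
  shows "(\<lambda>x. g (k x)) \<in> Ham a b"
proof -
  obtain H2 \<phi>2 where 2: "smooth_on ({0..1} \<times> S2_prod) (\<lambda>(t, x). H2 t x)" "is_ham_flow a b H2 \<phi>2"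
    "\<And>x. x \<in> S2_prod \<Longrightarrow> g x = \<phi>2 1 x"
    using assms(1) unfolding Ham_def by blast
  obtain H1 \<phi>1 where 1: "smooth_on ({0..1} \<times> S2_prod) (\<lambda>(t, x). H1 t x)" "is_ham_flow a b H1 \<phi>1"
    "\<And>x. x \<in> S2_prod \<Longrightarrow> k x = \<phi>1 1 x"
    using assms(2) unfolding Ham_def by blast
  \<comment> \<open>\<open>\<tau> 0\<close> climbs from 0 to 1 between the times 1/6 and 1/3,
    \<open>\<tau> 1\<close> between 2/3 and 5/6. Before time 2/3 only the first isotopy can move,
    and from time 1/3 on only the second.\<close>
  define \<tau> where "\<tau> s t = smooth_step (2 * t - s)" for s t
  define \<tau>' where "\<tau>' s t = 2 * step_deriv (2 * t - s)" for s t
  have W: "open_slices ({0..1::real} \<times> (UNIV::real set))" by (rule open_slices_Times) auto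
  have \<tau>_smooth: "pCk k (\<lambda>_::real. \<tau> s) ({0..1} \<times> UNIV)" for k s
    unfolding \<tau>_def[abs_def]
    by (rule pCk_real_compose[OF W pCk_smooth_step]) (intro pCk_diff pCk_mult pCk_const pCk_ident W, simp)
  have \<tau>'_smooth: "pCk k (\<lambda>_::real. \<tau>' s) ({0..1} \<times> UNIV)" for k s
  proof -
    have "pCk k (\<lambda>(_::real) t. step_deriv (2 * t - s)) ({0..1} \<times> UNIV)"
      by (rule pCk_real_compose[OF W pCk_step_deriv]) (intro pCk_diff pCk_mult pCk_const pCk_ident W, simp)
    then show ?thesis unfolding \<tau>'_def[abs_def] by (intro pCk_mult pCk_const W)
  qed
  have \<tau>01: "\<tau> s t \<in> {0..1}" for s t using smooth_step_bounds by (simp add: \<tau>_def)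
  have \<tau>_der: "(\<tau> s has_vector_derivative \<tau>' s t) (at t within T)" for s t T
  proof -
    have "((\<lambda>t. 2 * t - s) has_real_derivative 2) (at t within T)" by (auto intro!: derivative_eq_intros)
    from DERIV_chain2[OF smooth_step_has_derivative this]
    show ?thesis by (simp add: \<tau>_def[abs_def] \<tau>'_def has_real_derivative_iff_has_vector_derivative mult.commute)
  qed
  have part: "is_ham_vector a b (\<lambda>x. \<tau>' s t * H (\<tau> s t) x) (\<phi> (\<tau> s t) x) (\<tau>' s t *\<^sub>R V) \<and>
      ((\<lambda>t. \<phi> (\<tau> s t) x) has_vector_derivative \<tau>' s t *\<^sub>R V) (at t within {0..1})"
    if "is_ham_vector a b (H (\<tau> s t)) (\<phi> (\<tau> s t) x) V"
      "((\<lambda>s. \<phi> s x) has_vector_derivative V) (at (\<tau> s t) within {0..1})" for H \<phi> x V s t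
  proof
    have "((\<lambda>s. \<phi> s x) has_vector_derivative V) (at (\<tau> s t) within \<tau> s ` {0..1})"
      by (rule has_vector_derivative_within_subset[OF that(2)]) (use \<tau>01 in auto)
    from vector_diff_chain_within[OF \<tau>_der this]
    show "((\<lambda>t. \<phi> (\<tau> s t) x) has_vector_derivative \<tau>' s t *\<^sub>R V) (at t within {0..1})" by (simp add: o_def)
  qed (rule is_ham_vector_scale[OF that(1)])
  define H where "H t x = \<tau>' 0 t * H1 (\<tau> 0 t) x + \<tau>' 1 t * H2 (\<tau> 1 t) x" for t x
  define \<phi> where "\<phi> t x = \<phi>2 (\<tau> 1 t) (\<phi>1 (\<tau> 0 t) x)" for t x
  have "smooth_on ({0..1} \<times> S2_prod) (\<lambda>(t, x). H t x)"
    using smooth_on_add[OF smooth_on_reparam[OF 1(1) \<tau>'_smooth[of _ 0] \<tau>_smooth[of _ 0] \<tau>01]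
        smooth_on_reparam[OF 2(1) \<tau>'_smooth[of _ 1] \<tau>_smooth[of _ 1] \<tau>01]]
    by (simp add: H_def case_prod_unfold)
  moreover have "is_ham_flow a b H \<phi>"
    unfolding is_ham_flow_def
  proof (intro ballI conjI)
    fix x assume x: "x \<in> S2_prod"
    have \<phi>1x: "\<phi>1 t x \<in> S2_prod" if "t \<in> {0..1}" for t using 1(2) x that by (auto simp: is_ham_flow_def)
    have \<phi>20: "\<phi>2 0 y = y" if "y \<in> S2_prod" for y using 2(2) that by (auto simp: is_ham_flow_def)
    show "\<phi> 0 x = x"
      using 1(2) x \<phi>20[OF x] by (simp add: \<phi>_def \<tau>_def smooth_step_eq_0 is_ham_flow_def)
    fix t :: real assume t: "t \<in> {0..1}"
    show "\<phi> t x \<in> S2_prod" using 2(2) \<phi>1x[OF \<tau>01] \<tau>01 by (auto simp: \<phi>_def is_ham_flow_def)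
    show "\<exists>V. is_ham_vector a b (H t) (\<phi> t x) V \<and> ((\<lambda>s. \<phi> s x) has_vector_derivative V) (at t within {0..1})"
    proof (cases "t < 2/3")
      case True
      obtain V where V: "is_ham_vector a b (H1 (\<tau> 0 t)) (\<phi>1 (\<tau> 0 t) x) V"
        "((\<lambda>s. \<phi>1 s x) has_vector_derivative V) (at (\<tau> 0 t) within {0..1})"
        using 1(2) x \<tau>01[of 0 t] unfolding is_ham_flow_def by blast
      have eq: "\<phi>1 (\<tau> 0 s) x = \<phi> s x" if "s < 2/3" for s
        using \<phi>20[OF \<phi>1x[OF \<tau>01]] that by (simp add: \<phi>_def \<tau>_def[of 1] smooth_step_eq_0)
      have Ht: "(\<lambda>x. \<tau>' 0 t * H1 (\<tau> 0 t) x) = H t"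
        using True by (simp add: H_def \<tau>'_def[of 1] step_deriv_eq_0 fun_eq_iff)
      have "((\<lambda>s. \<phi> s x) has_vector_derivative \<tau>' 0 t *\<^sub>R V) (at t within {0..1})"
        by (rule has_vector_derivative_transform_within[OF conjunct2[OF part[of H1 0 t \<phi>1 x V, OF V]], of "2/3 - t"])
          (use True t eq in \<open>auto simp: dist_real_def\<close>)
      then show ?thesis using conjunct1[OF part[of H1 0 t \<phi>1 x V, OF V]] unfolding Ht eq[OF True] by blast
    next
      case False
      have y: "\<phi>1 1 x \<in> S2_prod" by (rule \<phi>1x) simp
      obtain V where V: "is_ham_vector a b (H2 (\<tau> 1 t)) (\<phi>2 (\<tau> 1 t) (\<phi>1 1 x)) V"
        "((\<lambda>s. \<phi>2 s (\<phi>1 1 x)) has_vector_derivative V) (at (\<tau> 1 t) within {0..1})"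
        using 2(2) y \<tau>01[of 1 t] unfolding is_ham_flow_def by blast
      have eq: "\<phi>2 (\<tau> 1 s) (\<phi>1 1 x) = \<phi> s x" if "1/3 \<le> s" for s
        using that by (simp add: \<phi>_def \<tau>_def[of 0] smooth_step_eq_1)
      \<comment> \<open>Radius 1/3 suffices: \<open>t\<close> is at least 2/3 here, and the first
        isotopy is at its end point from time 1/3 on.\<close>
      have near: "1/3 \<le> s" if "dist s t < 1/3" for s
        using that False unfolding dist_real_def by linarith
      have Ht: "(\<lambda>x. \<tau>' 1 t * H2 (\<tau> 1 t) x) = H t"
        using False by (simp add: H_def \<tau>'_def[of 0] step_deriv_eq_0 fun_eq_iff)
      have "((\<lambda>s. \<phi> s x) has_vector_derivative \<tau>' 1 t *\<^sub>R V) (at t within {0..1})"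
        by (rule has_vector_derivative_transform_within[OF conjunct2[OF part[of H2 1 t \<phi>2 "\<phi>1 1 x" V, OF V]], of "1/3"])
          (use t in \<open>auto intro!: eq near\<close>)
      moreover have "1/3 \<le> t" using False by simp
      ultimately show ?thesis using conjunct1[OF part[of H2 1 t \<phi>2 "\<phi>1 1 x" V, OF V]] eq[of t] unfolding Ht by (metis (no_types))
    qed
  qed
  moreover have "g (k x) = \<phi> 1 x" if x: "x \<in> S2_prod" for x
  proof -
    have "\<phi>1 1 x \<in> S2_prod" using 1(2) x by (auto simp: is_ham_flow_def)
    then show ?thesis using 1(3) 2(3) x by (simp add: \<phi>_def \<tau>_def smooth_step_eq_1)
  qed
  ultimately show ?thesis unfolding Ham_def by blast
qed

subsection \<open>Hamiltonian diffeomorphisms in the chart\<close>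

definition in_chart :: "real \<Rightarrow> (R3 \<times> R3 \<Rightarrow> R3 \<times> R3) \<Rightarrow> R4 \<Rightarrow> R4" where
  "in_chart r g z = (if z \<in> bidisk r then chart_inv (g (chart z)) else z)"

text \<open>The class of maps on which cutting off operates. \<open>cut\<close> returns a map of the
  same class with the same radius \<open>r\<close>, and so can be applied once per wall.\<close>

locale chart_Ham =
  fixes a b r :: real and g :: "R3 \<times> R3 \<Rightarrow> R3 \<times> R3"
  assumes ab: "0 < a" "0 < b" and r: "0 < r" "r < 1" and g: "g \<in> Ham a b"
    and supp: "\<And>x. x \<in> S2_prod \<Longrightarrow> x \<notin> chart ` bidisk r \<Longrightarrow> g x = x"
begin

lemmas dom = bidisk_subset_chart_dom[OF r, THEN subsetD]

lemma g_inj: "x \<in> S2_prod \<Longrightarrow> y \<in> S2_prod \<Longrightarrow> g x = g y \<Longrightarrow> x = y"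
  using inj_onD[OF Ham_inj_on[OF g ab]] by blast

text \<open>A point sent out of the bidisk would have a value that is fixed by \<open>g\<close>, and
  by injectivity it would equal that value.\<close>

lemma g_image: "x \<in> chart ` bidisk r \<Longrightarrow> g x \<in> chart ` bidisk r"
proof (rule ccontr)
  assume x: "x \<in> chart ` bidisk r" and n: "g x \<notin> chart ` bidisk r"
  have xS: "x \<in> S2_prod" using x chart_in_S2_prod dom by blast
  then have gS: "g x \<in> S2_prod" by (rule Ham_in_S2_prod[OF g])
  have "g (g x) = g x" by (rule supp[OF gS n])
  then have "g x = x" by (rule g_inj[OF gS xS])
  then show False using x n by simp
qed

lemma in_chart_bidisk: "z \<in> bidisk r \<Longrightarrow> in_chart r g z \<in> bidisk r"
  and chart_in_chart_bidisk: "z \<in> bidisk r \<Longrightarrow> chart (in_chart r g z) = g (chart z)"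
proof -
  assume z: "z \<in> bidisk r"
  then obtain w where w: "w \<in> bidisk r" "g (chart z) = chart w" using g_image by blast
  then have "in_chart r g z = w" using z dom by (simp add: in_chart_def chart_inv_chart)
  then show "in_chart r g z \<in> bidisk r" "chart (in_chart r g z) = g (chart z)" using w by simp_all
qed

lemma chart_in_chart: "z \<in> chart_dom \<Longrightarrow> chart (in_chart r g z) = g (chart z)"
proof (cases "z \<in> bidisk r")
  case False
  assume z: "z \<in> chart_dom"
  have "chart z \<notin> chart ` bidisk r" using False z dom inj_on_chart by (auto dest: inj_onD)
  then show ?thesis using supp[OF chart_in_S2_prod[OF z]] False by (simp add: in_chart_def)
qed (simp add: chart_in_chart_bidisk)

lemma in_chart_out: "z \<notin> bidisk r \<Longrightarrow> in_chart r g z = z"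
  by (simp add: in_chart_def)

lemma in_chart_dom: "z \<in> chart_dom \<Longrightarrow> in_chart r g z \<in> chart_dom"
  using in_chart_bidisk in_chart_out dom by (cases "z \<in> bidisk r") auto

lemma open_out: "open (- bidisk r)"
  using compact_imp_closed[OF compact_bidisk] by (simp add: open_Compl)

lemma in_chart_smooth: "pCk k (\<lambda>_. in_chart r g) ({0..1::real} \<times> UNIV)"
proof (rule pCk_local)
  let ?W = "{0..1::real} \<times> (UNIV::R4 set)"
  fix z assume z: "z \<in> ?W"
  show "\<exists>S. open S \<and> z \<in> S \<and> pCk k (\<lambda>_. in_chart r g) (?W \<inter> S)"
  proof (cases "snd z \<in> bidisk r")
    case True
    let ?V = "{0..1::real} \<times> chart_dom"
    have V: "open_slices ?V" by (rule open_slices_Times[OF open_chart_dom])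
    have gc: "pCk k (\<lambda>_ z. g (chart z)) ?V"
      by (rule Ham_smooth_symplectic(1)[OF g ab open_chart_dom pCk_chart chart_in_S2_prod])
    have "g (chart z) \<in> chart_ran" if "z \<in> chart_dom" for z
      using chart_in_ran[OF in_chart_dom[OF that]] chart_in_chart[OF that] by simp
    then have "pCk k (\<lambda>_ z. chart_inv (g (chart z))) ?V"
      by (intro pCk_compose[OF V _ pCk_chart_inv[where T = "{0..1::real}"] gc]) auto
    then have "pCk k (\<lambda>_. in_chart r g) ?V"
    proof (rule pCk_cong[OF V, rotated])
      fix t z assume "(t, z) \<in> ?V"
      then have zd: "z \<in> chart_dom" by simp
      show "chart_inv (g (chart z)) = in_chart r g z"
        unfolding chart_in_chart[OF zd, symmetric] by (rule chart_inv_chart[OF in_chart_dom[OF zd]])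
    qed
    moreover have "?W \<inter> (UNIV \<times> chart_dom) = ?V" by auto
    ultimately show ?thesis using True dom
      by (intro exI[of _ "UNIV \<times> chart_dom"]) (auto intro!: open_Times open_chart_dom simp: mem_Times_iff)
  next
    case False
    let ?V = "{0..1::real} \<times> - bidisk r"
    have V: "open_slices ?V" by (rule open_slices_Times[OF open_out])
    have "pCk k (\<lambda>_. in_chart r g) ?V"
      by (rule pCk_cong[OF V _ pCk_ident[OF V]]) (simp add: in_chart_out)
    moreover have "?W \<inter> (UNIV \<times> - bidisk r) = ?V" by auto
    ultimately show ?thesis using False
      by (intro exI[of _ "UNIV \<times> - bidisk r"]) (auto intro!: open_Times open_out simp: mem_Times_iff)
  qed
qed

lemma in_chart_has_derivative:
  "(in_chart r g has_derivative frechet_derivative (in_chart r g) (at z)) (at z)"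
  by (rule pCk_has_derivative[OF in_chart_smooth[of "Suc 0"], of 0]) auto

lemma in_chart_symplectic:
  "omega a b (frechet_derivative (in_chart r g) (at z) u) (frechet_derivative (in_chart r g) (at z) v) = omega a b u v"
proof (cases "z \<in> bidisk r")
  case True
  have zd: "z \<in> chart_dom" using dom[OF True] .
  let ?D = "frechet_derivative (in_chart r g) (at z)"
  have n1: "norm (fst z) \<le> 1" "norm (snd z) \<le> 1" using True r by (auto simp: bidisk_def)
  have n2: "norm (fst (in_chart r g z)) \<le> 1" "norm (snd (in_chart r g z)) \<le> 1"
    using in_chart_bidisk[OF True] r by (auto simp: bidisk_def mem_Times_iff)
  have "((\<lambda>z. chart (in_chart r g z)) has_derivative (\<lambda>w. frechet_derivative chart (at (in_chart r g z)) (?D w))) (at z)"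
    using diff_chain_at[OF in_chart_has_derivative chart_has_derivative[OF in_chart_dom[OF zd]]] by (simp add: o_def)
  then have "((\<lambda>z. g (chart z)) has_derivative (\<lambda>w. frechet_derivative chart (at (in_chart r g z)) (?D w))) (at z)"
    by (rule has_derivative_transform_within_open[OF _ open_chart_dom zd]) (rule chart_in_chart)
  note fd = frechet_derivative_at[OF this, symmetric]
  have "symp_form a b (g (chart z)) (frechet_derivative (\<lambda>z. g (chart z)) (at z) u) (frechet_derivative (\<lambda>z. g (chart z)) (at z) v)
      = symp_form a b (chart z) (frechet_derivative chart (at z) u) (frechet_derivative chart (at z) v)"
    by (rule Ham_smooth_symplectic(2)[OF g ab open_chart_dom pCk_chart chart_in_S2_prod zd])
  then show ?thesis
    unfolding fd chart_in_chart[OF zd, symmetric] chart_symplectic[OF n1] chart_symplectic[OF n2] .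
next
  case False
  have "(in_chart r g has_derivative (\<lambda>w. w)) (at z)"
    by (rule has_derivative_transform_within_open[OF has_derivative_ident open_out])
      (use False in_chart_out in auto)
  from frechet_derivative_at[OF this, symmetric] show ?thesis by simp
qed

text \<open>Injectivity comes from \<open>g\<close>. Surjectivity is topological: by Brouwer's
  theorem a continuous map that is the identity outside a bounded set is onto.\<close>

lemma in_chart_bij: "bij (in_chart r g)"
proof (rule bijI)
  show "inj (in_chart r g)"
  proof (rule injI)
    fix z w assume eq: "in_chart r g z = in_chart r g w"
    show "z = w"
    proof (cases "z \<in> bidisk r \<and> w \<in> bidisk r")
      case True
      have zw: "z \<in> chart_dom" "w \<in> chart_dom" using True dom by blast+
      have "g (chart z) = g (chart w)" using eq True chart_in_chart_bidisk by metis
      then have "chart z = chart w" by (rule g_inj[OF chart_in_S2_prod[OF zw(1)] chart_in_S2_prod[OF zw(2)]])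
      then show ?thesis by (rule inj_onD[OF inj_on_chart _ zw])
    next
      case False
      then show ?thesis using eq in_chart_bidisk in_chart_out by metis
    qed
  qed
  show "surj (in_chart r g)"
  proof -
    have cont: "continuous_on UNIV (in_chart r g)"
      by (rule has_derivative_continuous_on) (use in_chart_has_derivative in auto)
    have "\<exists>z. in_chart r g z = w" for w
    proof (cases "w \<in> bidisk r")
      case True
      have small: "norm p \<le> 2" if "p \<in> bidisk r" for p
        using that r norm_Pair_le[of "fst p" "snd p"] by (cases p) (auto simp: bidisk_def)
      \<comment> \<open>Points of the bidisk have norm at most 2, so for \<open>z\<close> in it
        \<open>w + (z - in_chart r g z)\<close> has norm at most 2 + 2 + 2; for other
        \<open>z\<close> this sum is \<open>w\<close>.\<close>
      have "\<exists>z\<in>cball 0 6. in_chart r g z = w"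
      proof (rule brouwer_surjective_cball[where S = "{w}"])
        show "continuous_on (cball 0 6) (in_chart r g)" by (rule continuous_on_subset[OF cont]) auto
        show "x + (z - in_chart r g z) \<in> cball 0 6" if "x \<in> {w}" "z \<in> cball 0 6" for x z
        proof (cases "z \<in> bidisk r")
          case zb: True
          have "norm (w + (z - in_chart r g z)) \<le> norm w + (norm z + norm (in_chart r g z))"
            by (intro order_trans[OF norm_triangle_ineq] add_left_mono norm_triangle_ineq4)
          also have "\<dots> \<le> 6" using small[OF True] small[OF zb] small[OF in_chart_bidisk[OF zb]] by simp
          finally show ?thesis using that by simp
        next
          case False
          then show ?thesis using that small[OF True] by (simp add: in_chart_out)
        qed
      qed auto
      then show ?thesis by blast
    qed (use in_chart_out in blast)
    then show ?thesis by (metis surjI)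
  qed
qed

text \<open>The end point \<open>\<kappa>\<close> of the isotopy from \<open>cut_R4\<close> is the
  identity up to level \<open>e1\<close> and a right inverse of \<open>g\<close> from level
  \<open>e3\<close> on. Hence \<open>g\<close> after \<open>\<kappa>\<close> is still
  \<open>g\<close> at the low levels and has become the identity at the high ones.\<close>

lemma cut:
  assumes \<sigma>: "\<sigma> = 1 \<or> \<sigma> = -1" and e: "0 < e1" "e1 < e2" "e2 < e3" "e2 \<le> r"
    and cond: "\<And>z. z \<in> bidisk r \<Longrightarrow> e3 \<le> \<sigma> * snd (snd (in_chart r g z)) \<Longrightarrow> e2 \<le> \<sigma> * snd (snd z)"
  obtains \<psi> where "chart_Ham a b r \<psi>"
    "\<And>z. z \<in> bidisk r \<Longrightarrow> \<sigma> * snd (snd z) \<le> e1 \<Longrightarrow> \<psi> (chart z) = g (chart z)"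
    "\<And>z. z \<in> bidisk r \<Longrightarrow> e3 \<le> \<sigma> * snd (snd z) \<Longrightarrow> \<psi> (chart z) = chart z"
proof -
  \<comment> \<open>Outside the bidisk the map is the identity and \<open>e2 < e3\<close> settles
    the claim, so the hypothesis is asked only inside.\<close>
  have cond': "e2 \<le> \<sigma> * snd (snd p)" if "e3 \<le> \<sigma> * snd (snd (in_chart r g p))" for p
    using cond[of p] that e in_chart_out[of p] by (cases "p \<in> bidisk r") auto
  obtain G \<rho> where G: "\<And>k. pCk k (\<lambda>_ z. G (fst z) (snd z)) ({0..1::real} \<times> UNIV)"
    "\<And>t p. t \<in> {0..1} \<Longrightarrow> p \<notin> bidisk r \<Longrightarrow> G t p = 0"
    "\<And>p. \<rho> 0 p = p"
    "\<And>t p. t \<in> {0..1} \<Longrightarrow> ((\<lambda>s. \<rho> s p) has_vector_derivative sharp a b (grad (G t) (\<rho> t p))) (at t within {0..1})"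
    "\<And>t p. t \<in> {0..1} \<Longrightarrow> p \<in> bidisk r \<Longrightarrow> \<rho> t p \<in> bidisk r"
    and low: "\<And>p. \<sigma> * snd (snd p) \<le> e1 \<Longrightarrow> \<rho> 1 p = p"
    and high: "\<And>q. e3 \<le> \<sigma> * snd (snd q) \<Longrightarrow> in_chart r g (\<rho> 1 q) = q"
    by (rule cut_R4[OF ab in_chart_smooth in_chart_symplectic in_chart_bij in_chart_out r \<sigma> e cond']) blast+
  define \<kappa> where "\<kappa> x = (if x \<in> chart ` bidisk r then chart (\<rho> 1 (chart_inv x)) else x)" for x
  have \<kappa>: "\<kappa> \<in> Ham a b"
    unfolding \<kappa>_def[abs_def] by (rule Ham_transplant[OF ab r G])
  have \<kappa>_chart: "\<kappa> (chart z) = chart (\<rho> 1 z)" if "z \<in> bidisk r" for z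
    using that dom by (simp add: \<kappa>_def chart_inv_chart)
  have in1: "\<rho> 1 z \<in> bidisk r" if "z \<in> bidisk r" for z using G(5)[of 1 z] that by simp
  show thesis
  proof (rule that[of "\<lambda>x. g (\<kappa> x)"])
    show "chart_Ham a b r (\<lambda>x. g (\<kappa> x))"
      by unfold_locales (use ab r supp Ham_comp[OF g \<kappa>] in \<open>auto simp: \<kappa>_def\<close>)
    show "g (\<kappa> (chart z)) = g (chart z)" if "z \<in> bidisk r" "\<sigma> * snd (snd z) \<le> e1" for z
      using \<kappa>_chart[OF that(1)] low[OF that(2)] by simp
    show "g (\<kappa> (chart z)) = chart z" if "z \<in> bidisk r" "e3 \<le> \<sigma> * snd (snd z)" for z
      using \<kappa>_chart[OF that(1)] chart_in_chart_bidisk[OF in1[OF that(1)]] high[OF that(2)] by simp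
  qed
qed

end

section \<open>The Riemannian distance\<close>

lemma smooth_on_imp_continuous_on:
  assumes "smooth_on S f" shows "continuous_on S f"
proof (rule continuous_on_local)
  fix x assume "x \<in> S"
  then obtain U F where U: "open U" "x \<in> U" "\<And>k. Ck_on k F U" "\<And>y. y \<in> S \<inter> U \<Longrightarrow> F y = f y"
    using assms unfolding smooth_on_def by metis
  have "continuous_on (S \<inter> U) f"
    by (rule continuous_on_eq[OF continuous_on_subset[OF Ck_on_continuous[OF U(3)]]]) (use U(4) in auto)
  then show "\<exists>U. open U \<and> x \<in> U \<and> continuous_on (S \<inter> U) f" using U by blast
qed

lemma compact_S2_prod: "compact S2_prod"
  unfolding S2_prod_def S2_def by (intro compact_Times compact_sphere)

section \<open>Comparison of the metric with the Euclidean norm\<close>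

definition tproj :: "R3 \<times> R3 \<Rightarrow> R3 \<times> R3 \<Rightarrow> R3 \<times> R3" where
  "tproj x w = (fst w - (fst x \<bullet> fst w) *\<^sub>R fst x, snd w - (snd x \<bullet> snd w) *\<^sub>R snd x)"

lemma tproj_tangent: "x \<in> S2_prod \<Longrightarrow> tproj x w \<in> tangent_S2_prod x"
  by (simp add: tproj_def tangent_S2_prod_def S2_prod_iff inner_diff_right)

lemma tproj_ident: "w \<in> tangent_S2_prod x \<Longrightarrow> tproj x w = w"
  by (simp add: tproj_def tangent_S2_prod_def)

lemma linear_tproj: "linear (tproj x)"
  by (rule linearI) (auto simp: tproj_def algebra_simps inner_add_right)

lemma smooth_on_tproj: "smooth_on S2_prod (\<lambda>x. tproj x w)"
proof -
  have W: "open_slices ({0..1::real} \<times> (UNIV::(R3 \<times> R3) set))" by (rule open_slices_Times) auto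
  have "Ck_on k (\<lambda>x. tproj x w) UNIV" for k
    unfolding tproj_def
    by (rule pCk_imp_Ck_on[where T = "{0..1::real}" and t = 0])
      (intro pCk_Pair pCk_diff pCk_scaleR pCk_inner pCk_const pCk_fst pCk_snd pCk_ident W, simp)
  then show ?thesis unfolding smooth_on_def by (intro ballI exI[of _ UNIV] exI[of _ "\<lambda>x. tproj x w"]) auto
qed

text \<open>Smoothness of \<open>G\<close> is known only along smooth tangent fields, and the
  projections of the basis vectors are such fields. Expanding in them gives a function that is
  continuous in point and vector together and equals \<open>G x u u\<close> for tangent
  \<open>u\<close>.\<close>

definition metric_quad :: "(R3 \<times> R3 \<Rightarrow> R3 \<times> R3 \<Rightarrow> R3 \<times> R3 \<Rightarrow> real) \<Rightarrow> R3 \<times> R3 \<Rightarrow> R3 \<times> R3 \<Rightarrow> real" where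
  "metric_quad G x u = (\<Sum>i\<in>Basis. \<Sum>j\<in>Basis. (u \<bullet> i) * (u \<bullet> j) * G x (tproj x i) (tproj x j))"

lemma zero_tangent: "0 \<in> tangent_S2_prod x"
  by (simp add: tangent_S2_prod_def)

lemma tangent_lincomb:
  "u \<in> tangent_S2_prod x \<Longrightarrow> v \<in> tangent_S2_prod x \<Longrightarrow> r *\<^sub>R u + s *\<^sub>R v \<in> tangent_S2_prod x"
  by (simp add: tangent_S2_prod_def inner_add_right)

lemma metric_sum_left:
  assumes G: "riemannian_metric G" and x: "x \<in> S2_prod" and w: "w \<in> tangent_S2_prod x"
    and U: "\<And>i. i \<in> A \<Longrightarrow> U i \<in> tangent_S2_prod x" and "finite A"
  shows "(\<Sum>i\<in>A. c i *\<^sub>R U i) \<in> tangent_S2_prod x \<and> G x (\<Sum>i\<in>A. c i *\<^sub>R U i) w = (\<Sum>i\<in>A. c i * G x (U i) w)"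
  using \<open>finite A\<close> U
proof (induction A rule: finite_induct)
  case empty
  have "G x (0 *\<^sub>R 0 + 0 *\<^sub>R 0) w = 0 * G x 0 w + 0 * G x 0 w"
    using G x w zero_tangent unfolding riemannian_metric_def by blast
  then show ?case by (simp add: zero_tangent)
next
  case (insert i A)
  then have IH: "(\<Sum>i\<in>A. c i *\<^sub>R U i) \<in> tangent_S2_prod x" "G x (\<Sum>i\<in>A. c i *\<^sub>R U i) w = (\<Sum>i\<in>A. c i * G x (U i) w)"
    and Ui: "U i \<in> tangent_S2_prod x" by auto
  have "G x (c i *\<^sub>R U i + 1 *\<^sub>R (\<Sum>i\<in>A. c i *\<^sub>R U i)) w = c i * G x (U i) w + 1 * G x (\<Sum>i\<in>A. c i *\<^sub>R U i) w"
    using G x w Ui IH(1) unfolding riemannian_metric_def by blast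
  then show ?case using insert.hyps IH tangent_lincomb[OF Ui IH(1), of "c i" 1] by simp
qed

lemma metric_quad_eq:
  assumes G: "riemannian_metric G" and x: "x \<in> S2_prod" and u: "u \<in> tangent_S2_prod x"
  shows "metric_quad G x u = G x u u"
proof -
  have tp: "tproj x i \<in> tangent_S2_prod x" for i by (rule tproj_tangent[OF x])
  have sym: "G x v w = G x w v" if "v \<in> tangent_S2_prod x" "w \<in> tangent_S2_prod x" for v w
    using G x that unfolding riemannian_metric_def by blast
  have ue: "(\<Sum>i\<in>Basis. (u \<bullet> i) *\<^sub>R tproj x i) = u"
    using linear_sum_Basis[OF linear_tproj, of x u] tproj_ident[OF u] by simp
  have left: "G x u w = (\<Sum>i\<in>Basis. (u \<bullet> i) * G x (tproj x i) w)" if "w \<in> tangent_S2_prod x" for w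
    using conjunct2[OF metric_sum_left[where U = "tproj x" and c = "\<lambda>i. u \<bullet> i", OF G x that tp finite_Basis]] unfolding ue .
  have "G x u u = (\<Sum>i\<in>Basis. (u \<bullet> i) * G x (tproj x i) u)" by (rule left[OF u])
  also have "\<dots> = (\<Sum>i\<in>Basis. (u \<bullet> i) * (\<Sum>j\<in>Basis. (u \<bullet> j) * G x (tproj x i) (tproj x j)))"
  proof (rule sum.cong[OF refl])
    fix i :: "R3 \<times> R3"
    have "G x (tproj x i) u = G x u (tproj x i)" by (rule sym[OF tp u])
    also have "\<dots> = (\<Sum>j\<in>Basis. (u \<bullet> j) * G x (tproj x j) (tproj x i))" by (rule left[OF tp])
    also have "\<dots> = (\<Sum>j\<in>Basis. (u \<bullet> j) * G x (tproj x i) (tproj x j))"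
      using sym[OF tp tp] by simp
    finally show "(u \<bullet> i) * G x (tproj x i) u = (u \<bullet> i) * (\<Sum>j\<in>Basis. (u \<bullet> j) * G x (tproj x i) (tproj x j))" by simp
  qed
  finally show ?thesis by (simp add: metric_quad_def sum_distrib_left mult.assoc)
qed

lemma continuous_metric_quad:
  assumes G: "riemannian_metric G"
  shows "continuous_on (S2_prod \<times> UNIV) (\<lambda>z. metric_quad G (fst z) (snd z))"
proof -
  have "smooth_on S2_prod (\<lambda>x. G x (tproj x i) (tproj x j))" for i j
    using G smooth_on_tproj tproj_tangent unfolding riemannian_metric_def by blast
  note c = smooth_on_imp_continuous_on[OF this]
  have "continuous_on (S2_prod \<times> (UNIV::(R3 \<times> R3) set)) (\<lambda>z. G (fst z) (tproj (fst z) i) (tproj (fst z) j))" for i j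
    by (rule continuous_on_compose2[OF c]) (auto intro!: continuous_intros)
  then show ?thesis unfolding metric_quad_def by (intro continuous_intros)
qed

text \<open>On unit tangent vectors, a compact set, the continuous function
  \<open>metric_quad\<close> has positive bounds; homogeneity carries them over to all tangent
  vectors.\<close>

lemma metric_bounds:
  assumes G: "riemannian_metric G"
  obtains c B where "0 < c" "0 < B"
    "\<And>x u. x \<in> S2_prod \<Longrightarrow> u \<in> tangent_S2_prod x \<Longrightarrow> c * norm u \<le> sqrt (G x u u) \<and> sqrt (G x u u) \<le> B * norm u"
proof -
  define T where "T = (S2_prod \<times> sphere (0::R3 \<times> R3) 1) \<inter> {z. fst (fst z) \<bullet> fst (snd z) = 0 \<and> snd (fst z) \<bullet> snd (snd z) = 0}"
  have T: "compact T" unfolding T_def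
    by (intro compact_Int_closed compact_Times compact_S2_prod compact_sphere closed_Collect_conj closed_Collect_eq continuous_intros)
  have T_iff: "(x, u) \<in> T \<longleftrightarrow> x \<in> S2_prod \<and> u \<in> tangent_S2_prod x \<and> norm u = 1" for x u
    by (auto simp: T_def tangent_S2_prod_def)
  let ?q = "\<lambda>z. metric_quad G (fst z) (snd z)"
  have cq: "continuous_on T ?q"
    by (rule continuous_on_subset[OF continuous_metric_quad[OF G]]) (auto simp: T_def)
  obtain m M where m: "0 < m" "0 < M" "\<And>z. z \<in> T \<Longrightarrow> m \<le> ?q z \<and> ?q z \<le> M"
  proof (cases "T = {}")
    case True
    then show thesis using that[of 1 1] by simp
  next
    case False
    obtain z0 where z0: "z0 \<in> T" "\<And>z. z \<in> T \<Longrightarrow> ?q z0 \<le> ?q z"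
      using continuous_attains_inf[OF T False cq] by blast
    obtain z1 where z1: "z1 \<in> T" "\<And>z. z \<in> T \<Longrightarrow> ?q z \<le> ?q z1"
      using continuous_attains_sup[OF T False cq] by blast
    have "0 < ?q z0"
    proof -
      obtain x u where xu: "z0 = (x, u)" by (cases z0)
      then have *: "x \<in> S2_prod" "u \<in> tangent_S2_prod x" "u \<noteq> 0" using z0(1) T_iff by auto
      then have "0 < G x u u" using G unfolding riemannian_metric_def by blast
      then show ?thesis using metric_quad_eq[OF G *(1,2)] by (simp add: xu)
    qed
    moreover have "?q z0 \<le> ?q z1" using z0(2)[OF z1(1)] .
    ultimately show thesis using that[of "?q z0" "?q z1"] z0(2) z1(2) by auto
  qed
  show thesis
  proof (rule that[of "sqrt m" "sqrt M"])
    fix x u assume x: "x \<in> S2_prod" and u: "u \<in> tangent_S2_prod x"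
    show "sqrt m * norm u \<le> sqrt (G x u u) \<and> sqrt (G x u u) \<le> sqrt M * norm u"
    proof (cases "u = 0")
      case True
      have "G x 0 0 = 0" using metric_quad_eq[OF G x zero_tangent] by (simp add: metric_quad_def)
      then show ?thesis using True by simp
    next
      case False
      define v where "v = inverse (norm u) *\<^sub>R u"
      have v: "v \<in> tangent_S2_prod x" "norm v = 1"
        using u False by (auto simp: v_def tangent_S2_prod_def)
      have "metric_quad G x (s *\<^sub>R v) = s\<^sup>2 * metric_quad G x v" for s
        by (simp add: metric_quad_def sum_distrib_left power2_eq_square mult_ac)
      from this[of "norm u"] have "metric_quad G x u = (norm u)\<^sup>2 * metric_quad G x v"
        using False by (simp add: v_def)
      then have q: "G x u u = (norm u)\<^sup>2 * metric_quad G x v" using metric_quad_eq[OF G x u] by simp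
      have "m \<le> metric_quad G x v" "metric_quad G x v \<le> M"
        using m(3)[of "(x, v)"] T_iff x v by auto
      then have "(norm u)\<^sup>2 * m \<le> G x u u" "G x u u \<le> (norm u)\<^sup>2 * M"
        unfolding q by (auto intro!: mult_left_mono)
      then have "sqrt ((norm u)\<^sup>2 * m) \<le> sqrt (G x u u)" "sqrt (G x u u) \<le> sqrt ((norm u)\<^sup>2 * M)"
        by (auto intro: real_sqrt_le_mono)
      then show ?thesis by (simp add: real_sqrt_mult mult.commute)
    qed
  qed (use m in auto)
qed

section \<open>Lengths of curves and the distance\<close>

lemma C1_curve_length:
  assumes G: "riemannian_metric G" and \<gamma>: "\<gamma> C1_differentiable_on {0..1}" and im: "path_image \<gamma> \<subseteq> S2_prod"
    and c: "\<And>x u. x \<in> S2_prod \<Longrightarrow> u \<in> tangent_S2_prod x \<Longrightarrow> c * norm u \<le> sqrt (G x u u) \<and> sqrt (G x u u) \<le> B * norm u"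
  shows "c * norm (pathfinish \<gamma> - pathstart \<gamma>) \<le> riemannian_length G \<gamma>"
    and "(\<And>t. t \<in> {0..1} \<Longrightarrow> norm (vector_derivative \<gamma> (at t)) \<le> M) \<Longrightarrow> 0 \<le> B \<Longrightarrow> riemannian_length G \<gamma> \<le> B * M"
proof -
  obtain D where D: "\<And>t. t \<in> {0..1} \<Longrightarrow> (\<gamma> has_vector_derivative D t) (at t)" and cD: "continuous_on {0..1} D"
    using \<gamma> unfolding C1_differentiable_on_def by blast
  have vd: "vector_derivative \<gamma> (at t) = D t" if "t \<in> {0..1}" for t
    using vector_derivative_at[OF D[OF that]] .
  have \<gamma>S: "\<gamma> t \<in> S2_prod" if "t \<in> {0..1}" for t using im that by (auto simp: path_image_def)
  have c\<gamma>: "continuous_on {0..1} \<gamma>"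
    by (rule continuous_on_vector_derivative[OF has_vector_derivative_at_within[OF D]])
  have tangent: "D t \<in> tangent_S2_prod (\<gamma> t)" if t: "t \<in> {0..1}" for t
  proof -
    have part: "f (\<gamma> t) \<bullet> f (D t) = 0" if f: "bounded_linear f" and one: "\<And>y. y \<in> S2_prod \<Longrightarrow> f y \<bullet> f y = 1"
      for f :: "R3 \<times> R3 \<Rightarrow> R3"
    proof -
      have fd: "((\<lambda>t. f (\<gamma> t)) has_vector_derivative f (D t)) (at t within {0..1})"
        by (rule bounded_linear.has_vector_derivative[OF f has_vector_derivative_at_within[OF D[OF t]]])
      have "((\<lambda>t. f (\<gamma> t) \<bullet> f (\<gamma> t)) has_vector_derivative (f (\<gamma> t) \<bullet> f (D t) + f (D t) \<bullet> f (\<gamma> t))) (at t within {0..1})"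
        by (rule bounded_bilinear.has_vector_derivative[OF bounded_bilinear_inner fd fd])
      moreover have "((\<lambda>t. f (\<gamma> t) \<bullet> f (\<gamma> t)) has_vector_derivative 0) (at t within {0..1})"
        by (rule has_vector_derivative_transform[OF t _ has_vector_derivative_const[of 1]]) (use one \<gamma>S in auto)
      ultimately have "f (\<gamma> t) \<bullet> f (D t) + f (D t) \<bullet> f (\<gamma> t) = 0"
        using vector_derivative_unique_within_closed_interval[of 0 1 t] t by fastforce
      then show ?thesis by (simp add: inner_commute)
    qed
    show ?thesis
      using part[OF bounded_linear_fst] part[OF bounded_linear_snd] by (simp add: tangent_S2_prod_def S2_prod_iff)
  qed
  \<comment> \<open>The integral of a function that is not integrable is 0 by convention, so the
    lower bound for the length requires the speed in a form known to be continuous.\<close>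
  define s where "s t = sqrt (metric_quad G (\<gamma> t) (D t))" for t
  have s: "sqrt (G (\<gamma> t) (vector_derivative \<gamma> (at t)) (vector_derivative \<gamma> (at t))) = s t" if "t \<in> {0..1}" for t
    using metric_quad_eq[OF G \<gamma>S[OF that] tangent[OF that]] by (simp add: s_def vd[OF that])
  have cs: "continuous_on {0..1} s"
  proof -
    have "continuous_on {0..1} (\<lambda>t. (\<gamma> t, D t))" by (intro continuous_intros c\<gamma> cD)
    moreover have "(\<lambda>t. (\<gamma> t, D t)) ` {0..1} \<subseteq> S2_prod \<times> UNIV" using \<gamma>S by auto
    ultimately have "continuous_on {0..1} (\<lambda>t. metric_quad G (fst (\<gamma> t, D t)) (snd (\<gamma> t, D t)))"
      by (rule continuous_on_compose2[OF continuous_metric_quad[OF G]])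
    then show ?thesis unfolding s_def by (intro continuous_intros) simp
  qed
  then have int_s: "s integrable_on {0..1}" by (rule integrable_continuous_real)
  have len: "riemannian_length G \<gamma> = integral {0..1} s"
    unfolding riemannian_length_def by (rule integral_cong) (rule s)
  have sb: "c * norm (D t) \<le> s t \<and> s t \<le> B * norm (D t)" if "t \<in> {0..1}" for t
    using c[OF \<gamma>S[OF that] tangent[OF that]] s[OF that] by (simp add: vd[OF that])
  have iD: "D integrable_on {0..1}" by (rule integrable_continuous_real[OF cD])
  have inD: "(\<lambda>t. norm (D t)) integrable_on {0..1}"
    by (rule integrable_continuous_real) (intro continuous_intros cD)
  have "(D has_integral (\<gamma> 1 - \<gamma> 0)) {0..1}"
    by (rule fundamental_theorem_of_calculus[OF _ has_vector_derivative_at_within[OF D]]) simp_all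
  then have "norm (\<gamma> 1 - \<gamma> 0) = norm (integral {0..1} D)" by (simp add: integral_unique)
  also have "\<dots> \<le> integral {0..1} (\<lambda>t. norm (D t))"
    by (rule integral_norm_bound_integral[OF iD inD]) simp
  finally have n: "norm (\<gamma> 1 - \<gamma> 0) \<le> integral {0..1} (\<lambda>t. norm (D t))" .
  show "c * norm (pathfinish \<gamma> - pathstart \<gamma>) \<le> riemannian_length G \<gamma>"
  proof (cases "0 \<le> c")
    case True
    have "c * norm (\<gamma> 1 - \<gamma> 0) \<le> c * integral {0..1} (\<lambda>t. norm (D t))" using n True by (rule mult_left_mono)
    also have "\<dots> = integral {0..1} (\<lambda>t. c * norm (D t))" by simp
    also have "\<dots> \<le> integral {0..1} s"
    proof (rule integral_le[OF _ int_s])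
      show "(\<lambda>t. c * norm (D t)) integrable_on {0..1}"
        by (rule integrable_continuous_real) (intro continuous_intros cD)
    qed (use sb in auto)
    finally show ?thesis by (simp add: len pathfinish_def pathstart_def)
  next
    case False
    have "c * norm (\<gamma> 1 - \<gamma> 0) \<le> 0" using False by (simp add: mult_nonpos_nonneg)
    also have "0 \<le> integral {0..1} s"
    proof (rule integral_nonneg[OF int_s])
      fix t :: real assume t: "t \<in> {0..1}"
      have "0 \<le> G (\<gamma> t) (D t) (D t)"
      proof (cases "D t = 0")
        case True
        then show ?thesis using metric_quad_eq[OF G \<gamma>S[OF t] zero_tangent] by (simp add: metric_quad_def)
      next
        case False
        then show ?thesis using G \<gamma>S[OF t] tangent[OF t] unfolding riemannian_metric_def by (meson less_imp_le)
      qed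
      then show "0 \<le> s t" using metric_quad_eq[OF G \<gamma>S[OF t] tangent[OF t]] by (simp add: s_def)
    qed
    finally show ?thesis by (simp add: len pathfinish_def pathstart_def)
  qed
  assume M: "\<And>t. t \<in> {0..1} \<Longrightarrow> norm (vector_derivative \<gamma> (at t)) \<le> M" and "0 \<le> B"
  have "integral {0..1} s \<le> integral {0..1::real} (\<lambda>_. B * M)"
  proof (rule integral_le[OF int_s])
    fix t :: real assume t: "t \<in> {0..1}"
    have "s t \<le> B * norm (D t)" using sb[OF t] by simp
    also have "\<dots> \<le> B * M" using M[OF t] \<open>0 \<le> B\<close> by (intro mult_left_mono) (simp_all add: vd[OF t])
    finally show "s t \<le> B * M" .
  qed auto
  then show "riemannian_length G \<gamma> \<le> B * M" by (simp add: len)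
qed

text \<open>A great circle through \<open>p\<close> in the direction of a unit vector
  \<open>n\<close> orthogonal to it, traversed at speed \<open>arccos (p \<bullet> q)\<close>, which
  is at most pi. It provides a connecting curve with a speed bound independent of the
  points.\<close>

lemma S2_arc:
  assumes p: "p \<in> S2" and q: "q \<in> S2"
  obtains \<gamma> \<gamma>' where "\<gamma> 0 = p" "\<gamma> 1 = q" "\<And>t. \<gamma> t \<in> S2" "\<And>t. (\<gamma> has_vector_derivative \<gamma>' t) (at t)"
    "continuous_on UNIV \<gamma>'" "\<And>t. norm (\<gamma>' t) \<le> pi"
proof -
  have pp: "p \<bullet> p = 1" and qq: "q \<bullet> q = 1" using p q by (auto simp: S2_iff)
  define d where "d = p \<bullet> q"
  have d: "-1 \<le> d" "d \<le> 1"
    using Cauchy_Schwarz_ineq2[of p q] pp qq by (auto simp: d_def norm_eq_sqrt_inner abs_le_iff)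
  define \<theta> where "\<theta> = arccos d"
  have \<theta>: "0 \<le> \<theta>" "\<theta> \<le> pi" "cos \<theta> = d" using d by (auto simp: \<theta>_def arccos_lbound arccos_ubound cos_arccos)
  define m where "m = q - d *\<^sub>R p"
  have pm: "p \<bullet> m = 0" by (simp add: m_def inner_diff_right d_def pp)
  have mm: "m \<bullet> m = 1 - d\<^sup>2"
    by (simp add: m_def inner_diff_right inner_diff_left d_def pp qq inner_commute power2_eq_square)
  have sin: "sin \<theta> = norm m"
    using sin_arccos_abs[of d] d mm by (simp add: \<theta>_def norm_eq_sqrt_inner sin_arccos)
  \<comment> \<open>If \<open>q\<close> is \<open>p\<close> or its antipode, the direction is
    undetermined and any unit vector orthogonal to \<open>p\<close> serves.\<close>
  obtain n where n: "n \<bullet> n = 1" "p \<bullet> n = 0" "m = norm m *\<^sub>R n"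
  proof (cases "m = 0")
    case True
    obtain y where y: "y \<noteq> 0" "orthogonal p y"
      by (rule orthogonal_to_vector_exists[of p]) auto
    show thesis
      by (rule that[of "inverse (norm y) *\<^sub>R y"])
        (use y True in \<open>auto simp: orthogonal_def dot_square_norm power2_eq_square\<close>)
  next
    case False
    show thesis
      by (rule that[of "inverse (norm m) *\<^sub>R m"])
        (use False pm in \<open>auto simp: dot_square_norm power2_eq_square\<close>)
  qed
  define \<gamma> where "\<gamma> t = cos (t * \<theta>) *\<^sub>R p + sin (t * \<theta>) *\<^sub>R n" for t
  define \<gamma>' where "\<gamma>' t = (- sin (t * \<theta>) * \<theta>) *\<^sub>R p + (cos (t * \<theta>) * \<theta>) *\<^sub>R n" for t
  show thesis
  proof (rule that[of \<gamma> \<gamma>'])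
    show "\<gamma> 0 = p" by (simp add: \<gamma>_def)
    show "\<gamma> 1 = q" using n(3) by (simp add: \<gamma>_def \<theta>(3) sin m_def)
    have sc: "sin r * sin r + cos r * cos r = 1" for r :: real
      using sin_cos_squared_add[of r] by (simp add: power2_eq_square)
    show "\<gamma> t \<in> S2" for t
      using sc[of "t * \<theta>"] n pp by (simp add: S2_iff \<gamma>_def inner_add_left inner_add_right inner_commute[of n p])
    show "(\<gamma> has_vector_derivative \<gamma>' t) (at t)" for t
    proof -
      have 1: "((\<lambda>t. cos (t * \<theta>)) has_real_derivative - sin (t * \<theta>) * \<theta>) (at t)"
        "((\<lambda>t. sin (t * \<theta>)) has_real_derivative cos (t * \<theta>) * \<theta>) (at t)"
        by (auto intro!: derivative_eq_intros)
      show ?thesis unfolding \<gamma>_def[abs_def] \<gamma>'_def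
        using has_vector_derivative_add[OF has_vector_derivative_scaleR[OF 1(1) has_vector_derivative_const[of p]]
            has_vector_derivative_scaleR[OF 1(2) has_vector_derivative_const[of n]]] by simp
    qed
    show "continuous_on UNIV \<gamma>'" unfolding \<gamma>'_def[abs_def] by (intro continuous_intros)
    show "norm (\<gamma>' t) \<le> pi" for t
    proof -
      have "\<gamma>' t = \<theta> *\<^sub>R ((- sin (t * \<theta>)) *\<^sub>R p + cos (t * \<theta>) *\<^sub>R n)" by (simp add: \<gamma>'_def algebra_simps)
      moreover have "norm ((- sin (t * \<theta>)) *\<^sub>R p + cos (t * \<theta>) *\<^sub>R n) = 1"
        using sc[of "t * \<theta>"] n pp
        by (simp add: norm_eq_1 inner_add_left inner_add_right inner_diff_left inner_diff_right inner_commute[of n p])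
      ultimately show ?thesis using \<theta> by simp
    qed
  qed
qed

text \<open>The lower bound lets closeness in the distance control the Euclidean norm. The upper
  bound makes the supremum in \<open>C0_dist\<close> one of a bounded set, so that it dominates its
  terms. The infimum is taken over a nonempty set thanks to a pair of great circle arcs.\<close>

lemma riemannian_dist_bounds:
  assumes G: "riemannian_metric G"
  obtains c C where "0 < c"
    "\<And>x y. x \<in> S2_prod \<Longrightarrow> y \<in> S2_prod \<Longrightarrow> c * norm (y - x) \<le> riemannian_dist G x y \<and> riemannian_dist G x y \<le> C"
proof -
  obtain c B where c: "0 < c" "0 < B"
    "\<And>x u. x \<in> S2_prod \<Longrightarrow> u \<in> tangent_S2_prod x \<Longrightarrow> c * norm u \<le> sqrt (G x u u) \<and> sqrt (G x u u) \<le> B * norm u"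
    by (rule metric_bounds[OF G]) blast
  show thesis
  proof (rule that[of c "B * (2 * pi)"])
    fix x y assume x: "x \<in> S2_prod" and y: "y \<in> S2_prod"
    let ?L = "{riemannian_length G \<gamma> | \<gamma>. \<gamma> C1_differentiable_on {0..1} \<and>
            path_image \<gamma> \<subseteq> S2_prod \<and> pathstart \<gamma> = x \<and> pathfinish \<gamma> = y}"
    have low: "c * norm (y - x) \<le> l" if "l \<in> ?L" for l
      using that C1_curve_length(1)[OF G _ _ c(3)] by blast
    obtain \<gamma>1 \<gamma>1' where 1: "\<gamma>1 0 = fst x" "\<gamma>1 1 = fst y" "\<And>t. \<gamma>1 t \<in> S2" "\<And>t. (\<gamma>1 has_vector_derivative \<gamma>1' t) (at t)"
      "continuous_on UNIV \<gamma>1'" "\<And>t. norm (\<gamma>1' t) \<le> pi"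
      by (rule S2_arc[of "fst x" "fst y"]) (use x y in \<open>auto simp: S2_prod_def\<close>)
    obtain \<gamma>2 \<gamma>2' where 2: "\<gamma>2 0 = snd x" "\<gamma>2 1 = snd y" "\<And>t. \<gamma>2 t \<in> S2" "\<And>t. (\<gamma>2 has_vector_derivative \<gamma>2' t) (at t)"
      "continuous_on UNIV \<gamma>2'" "\<And>t. norm (\<gamma>2' t) \<le> pi"
      by (rule S2_arc[of "snd x" "snd y"]) (use x y in \<open>auto simp: S2_prod_def\<close>)
    define \<gamma> where "\<gamma> t = (\<gamma>1 t, \<gamma>2 t)" for t
    have \<gamma>D: "(\<gamma> has_vector_derivative (\<gamma>1' t, \<gamma>2' t)) (at t)" for t
      unfolding \<gamma>_def[abs_def] by (rule has_vector_derivative_Pair[OF 1(4) 2(4)])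
    have cD: "continuous_on {0..1} (\<lambda>t. (\<gamma>1' t, \<gamma>2' t))"
      by (intro continuous_intros continuous_on_subset[OF 1(5)] continuous_on_subset[OF 2(5)]) auto
    have C1: "\<gamma> C1_differentiable_on {0..1}"
      unfolding C1_differentiable_on_def
      by (rule exI[of _ "\<lambda>t. (\<gamma>1' t, \<gamma>2' t)"]) (intro conjI ballI \<gamma>D cD)
    have im: "path_image \<gamma> \<subseteq> S2_prod" using 1(3) 2(3) by (auto simp: path_image_def \<gamma>_def S2_prod_def)
    have ends: "pathstart \<gamma> = x" "pathfinish \<gamma> = y" by (simp_all add: pathstart_def pathfinish_def \<gamma>_def 1 2)
    have "riemannian_length G \<gamma> \<le> B * (2 * pi)"
    proof (rule C1_curve_length(2)[OF G C1 im c(3)])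
      show "norm (vector_derivative \<gamma> (at t)) \<le> 2 * pi" if "t \<in> {0..1}" for t
        using vector_derivative_at[OF \<gamma>D[of t]] norm_Pair_le[of "\<gamma>1' t" "\<gamma>2' t"] 1(6)[of t] 2(6)[of t] by simp
    qed (use c in auto)
    moreover have mem: "riemannian_length G \<gamma> \<in> ?L" using C1 im ends by blast
    moreover have "Inf ?L \<le> riemannian_length G \<gamma>"
      by (rule cInf_lower[OF mem bdd_belowI[of _ "c * norm (y - x)"]]) (rule low)
    moreover have "c * norm (y - x) \<le> Inf ?L"
      by (rule cInf_greatest) (use mem low in auto)
    ultimately show "c * norm (y - x) \<le> riemannian_dist G x y \<and> riemannian_dist G x y \<le> B * (2 * pi)"
      unfolding riemannian_dist_def by linarith
  qed (use c in simp)
qed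

lemma C0_dist_controls_norm:
  assumes G: "riemannian_metric G" and "0 < \<eta>"
  obtains \<delta> where "0 < \<delta>" "\<And>g x. (\<And>x. x \<in> S2_prod \<Longrightarrow> g x \<in> S2_prod) \<Longrightarrow> C0_dist G g id < \<delta> \<Longrightarrow> x \<in> S2_prod \<Longrightarrow> norm (g x - x) < \<eta>"
proof -
  obtain c C where c: "0 < c"
    "\<And>x y. x \<in> S2_prod \<Longrightarrow> y \<in> S2_prod \<Longrightarrow> c * norm (y - x) \<le> riemannian_dist G x y \<and> riemannian_dist G x y \<le> C"
    by (rule riemannian_dist_bounds[OF G]) blast
  show thesis
  proof (rule that[of "c * \<eta>"])
    show "0 < c * \<eta>" using c assms by simp
    fix g x assume g: "\<And>x. x \<in> S2_prod \<Longrightarrow> g x \<in> S2_prod" and d: "C0_dist G g id < c * \<eta>" and x: "x \<in> S2_prod"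
    have "bdd_above ((\<lambda>x. riemannian_dist G (g x) (id x)) ` S2_prod)"
      by (rule bdd_aboveI2[of _ _ C]) (use c(2) g in auto)
    then have "riemannian_dist G (g x) (id x) \<le> C0_dist G g id"
      unfolding C0_dist_def using x by (intro cSUP_upper) auto
    moreover have "c * norm (x - g x) \<le> riemannian_dist G (g x) (id x)" using c(2)[OF g[OF x] x] by simp
    ultimately have "c * norm (x - g x) < c * \<eta>" using d by linarith
    then show "norm (g x - x) < \<eta>" using c(1) by (simp add: norm_minus_commute)
  qed
qed

section \<open>The extension lemma\<close>

definition height :: "R3 \<times> R3 \<Rightarrow> real" where
  "height x = snd (lambert (snd x))"

lemma height_chart:
  assumes "z \<in> chart_dom" shows "height (chart z) = snd (snd z)"
proof -
  have "height (chart z) = snd (snd (chart_inv (chart z)))" by (simp add: height_def chart_inv_def)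
  then show ?thesis by (simp only: chart_inv_chart[OF assms])
qed

text \<open>A point with one component on the equator is not interior: turning that component
  slightly towards the south pole leaves the hemisphere but not the sphere.\<close>

lemma upper_interior:
  assumes "x \<in> (top_of_set S2_prod) interior_of (hemi_prod D2 D2)"
  shows "0 < fst x $ 3 \<and> 0 < snd x $ 3"
proof -
  obtain T where T: "openin (top_of_set S2_prod) T" "T \<subseteq> hemi_prod D2 D2" "x \<in> T"
    using assms by (auto simp: interior_of_def)
  then obtain U where U: "open U" "T = S2_prod \<inter> U" by (auto simp: openin_open)
  have xS: "x \<in> S2_prod" and xU: "x \<in> U" using T U by auto
  have nonneg: "0 \<le> fst y $ 3 \<and> 0 \<le> snd y $ 3" if "y \<in> S2_prod" "y \<in> U" for y
  proof -
    have "y \<in> hemi_prod D2 D2" using T U that by auto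
    then obtain u v where "y = (hemi u, hemi v)" "u \<in> D2" "v \<in> D2" by (auto simp: hemi_prod_def)
    then show ?thesis using bij_betw_imp_surj_on[OF bij_betw_hemi] by auto
  qed
  have turn: "\<not> (p $ 3 = 0 \<and> p \<in> S2 \<and> open V \<and> p \<in> V \<and> (\<forall>q\<in>V. q \<in> S2 \<longrightarrow> 0 \<le> q $ 3))" for p :: R3 and V
  proof
    assume *: "p $ 3 = 0 \<and> p \<in> S2 \<and> open V \<and> p \<in> V \<and> (\<forall>q\<in>V. q \<in> S2 \<longrightarrow> 0 \<le> q $ 3)"
    define c where "c s = cos s *\<^sub>R p - sin s *\<^sub>R axis 3 (1::real)" for s
    have cS: "c s \<in> S2" for s
    proof -
      have p3: "p $ 3 = 0" and "p \<in> S2" using * by auto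
      then have "(p$1)\<^sup>2 + (p$2)\<^sup>2 = 1" by (simp add: S2_iff_coords)
      then have "(cos s)\<^sup>2 * ((p$1)\<^sup>2 + (p$2)\<^sup>2) + (sin s)\<^sup>2 = 1" by simp
      then show ?thesis by (simp add: S2_iff_coords c_def axis_def power_mult_distrib distrib_left p3)
    qed
    have "continuous (at 0) c" unfolding c_def by (intro continuous_intros)
    moreover have "c 0 = p" by (simp add: c_def)
    ultimately have "\<exists>N. open N \<and> 0 \<in> N \<and> (\<forall>s\<in>N. c s \<in> V)"
      using * unfolding continuous_at_open by metis
    then obtain N where N: "open N" "0 \<in> N" "\<forall>s\<in>N. c s \<in> V" by blast
    then obtain d where d: "0 < d" "ball 0 d \<subseteq> N" using open_contains_ball by blast
    \<comment> \<open>Below \<open>d\<close> to stay in the neighbourhood, at most 1 to have a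
      positive sine.\<close>
    define s where "s = min (d / 2) 1"
    have s: "0 < s" "s < d" "s \<le> 1" using d by (auto simp: s_def)
    then have "c s \<in> V" using N(3) d by (auto simp: subset_iff)
    then have "0 \<le> c s $ 3" using * cS by blast
    moreover have "0 < sin s" using s pi_gt3 by (intro sin_gt_zero) auto
    ultimately show False using * by (simp add: c_def axis_def)
  qed
  have 1: "fst x $ 3 \<noteq> 0"
  proof
    assume "fst x $ 3 = 0"
    moreover have "open ((\<lambda>p. (p, snd x)) -` U)" by (intro open_vimage U(1) continuous_intros)
    moreover have "\<forall>q\<in>(\<lambda>p. (p, snd x)) -` U. q \<in> S2 \<longrightarrow> 0 \<le> q $ 3"
    proof (intro ballI impI)
      fix q assume "q \<in> (\<lambda>p. (p, snd x)) -` U" "q \<in> S2"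
      then show "0 \<le> q $ 3" using nonneg[of "(q, snd x)"] xS by (simp add: S2_prod_def mem_Times_iff)
    qed
    ultimately show False using turn[of "fst x" "(\<lambda>p. (p, snd x)) -` U"] xS xU by (simp add: S2_prod_def mem_Times_iff)
  qed
  have 2: "snd x $ 3 \<noteq> 0"
  proof
    assume "snd x $ 3 = 0"
    moreover have "open ((\<lambda>p. (fst x, p)) -` U)" by (intro open_vimage U(1) continuous_intros)
    moreover have "\<forall>q\<in>(\<lambda>p. (fst x, p)) -` U. q \<in> S2 \<longrightarrow> 0 \<le> q $ 3"
    proof (intro ballI impI)
      fix q assume "q \<in> (\<lambda>p. (fst x, p)) -` U" "q \<in> S2"
      then show "0 \<le> q $ 3" using nonneg[of "(fst x, q)"] xS by (simp add: S2_prod_def mem_Times_iff)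
    qed
    ultimately show False using turn[of "snd x" "(\<lambda>p. (fst x, p)) -` U"] xS xU by (simp add: S2_prod_def mem_Times_iff)
  qed
  show ?thesis using nonneg[OF xS xU] 1 2 by auto
qed

lemma support_in_bidisk:
  assumes "compactly_supported_in g (hemi_prod D2 D2)" and s: "0 < s" "s < 1"
  obtains r where "s \<le> r" "r < 1" "\<And>x. x \<in> S2_prod \<Longrightarrow> x \<notin> chart ` bidisk r \<Longrightarrow> g x = x"
proof -
  let ?C = "closure {x \<in> S2_prod. g x \<noteq> x}"
  have C: "compact ?C" "?C \<subseteq> (top_of_set S2_prod) interior_of (hemi_prod D2 D2)"
    using assms(1) by (auto simp: compactly_supported_in_def)
  have "\<exists>m>0. \<forall>x\<in>?C. m \<le> min (fst x $ 3) (snd x $ 3)"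
  proof (cases "?C = {}")
    case False
    have "continuous_on ?C (\<lambda>x. min (fst x $ 3) (snd x $ 3))" by (intro continuous_intros)
    from continuous_attains_inf[OF C(1) False this]
    obtain x0 where x0: "x0 \<in> ?C" "\<forall>x\<in>?C. min (fst x0 $ 3) (snd x0 $ 3) \<le> min (fst x $ 3) (snd x $ 3)" by blast
    have "0 < min (fst x0 $ 3) (snd x0 $ 3)" using upper_interior[OF subsetD[OF C(2) x0(1)]] by simp
    then show ?thesis using x0(2) by blast
  next
    case True
    show ?thesis unfolding True by (auto intro: exI[of _ 1])
  qed
  then obtain m where m: "0 < m" "\<forall>x\<in>?C. m \<le> min (fst x $ 3) (snd x $ 3)" by blast
  \<comment> \<open>By \<open>chart_bidisk\<close>, a support with third coordinates at least
    \<open>m\<close> fits as soon as \<open>1 - r\<^sup>2 \<le> m\<close>. The maximum with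
    \<open>s\<close> later places the centre of the dilation inside the bidisk, and 1/2 keeps the
    radicand positive.\<close>
  define r where "r = max s (sqrt (1 - min m (1/2)))"
  have r: "s \<le> r" "r < 1" "0 < r" using s m by (auto simp: r_def real_sqrt_lt_1_iff)
  have rm: "1 - r\<^sup>2 \<le> m"
  proof -
    have "1 - min m (1/2) = (sqrt (1 - min m (1/2)))\<^sup>2" by simp
    also have "\<dots> \<le> r\<^sup>2" by (rule power_mono) (auto simp: r_def)
    finally show ?thesis by linarith
  qed
  show thesis
  proof (rule that[OF r(1,2)])
    fix x assume x: "x \<in> S2_prod" "x \<notin> chart ` bidisk r"
    show "g x = x"
    proof (rule ccontr)
      assume "g x \<noteq> x"
      then have "x \<in> {x \<in> S2_prod. g x \<noteq> x}" using x(1) by simp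
      then have "x \<in> ?C" by (rule subsetD[OF closure_subset])
      then have "m \<le> fst x $ 3" "m \<le> snd x $ 3" using m(2) by auto
      then show False using x chart_bidisk[OF r(3,2), of x] rm by auto
    qed
  qed
qed

lemma height_uniformly_continuous:
  assumes "0 < e"
  obtains \<eta> where "0 < \<eta>" "\<And>x y. x \<in> S2_prod \<Longrightarrow> y \<in> S2_prod \<Longrightarrow> 0 \<le> snd x $ 3 \<Longrightarrow> 0 \<le> snd y $ 3 \<Longrightarrow>
    norm (x - y) < \<eta> \<Longrightarrow> \<bar>height x - height y\<bar> < e"
proof -
  let ?K = "S2_prod \<inter> {x. 0 \<le> snd x $ 3}"
  have "compact ?K" by (intro compact_Int_closed compact_S2_prod closed_Collect_le continuous_intros)
  moreover have "continuous_on ?K height"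
    unfolding height_def lambert_def snd_conv by (intro continuous_intros) auto
  ultimately have "uniformly_continuous_on ?K height" by (intro compact_uniformly_continuous)
  then obtain \<eta> where "0 < \<eta>" "\<And>x y. x \<in> ?K \<Longrightarrow> y \<in> ?K \<Longrightarrow> dist y x < \<eta> \<Longrightarrow> dist (height y) (height x) < e"
    using assms unfolding uniformly_continuous_on_def by metis
  then show thesis by (intro that[of \<eta>]) (auto simp: dist_norm norm_minus_commute)
qed

lemma strip_support:
  assumes r: "0 < r" "r < 1" and e: "0 < e" "e < \<epsilon>" "\<epsilon> < 1"
    and supp: "\<And>x. x \<in> S2_prod \<Longrightarrow> x \<notin> chart ` bidisk r \<Longrightarrow> \<psi> x = x"
    and strip: "\<And>z. z \<in> bidisk r \<Longrightarrow> e \<le> \<bar>snd (snd z)\<bar> \<Longrightarrow> \<psi> (chart z) = chart z"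
  shows "compactly_supported_in \<psi> (hemi_prod D2 (D2_strip \<epsilon>))"
proof -
  let ?K = "bidisk r \<inter> {z. \<bar>snd (snd z)\<bar> \<le> e}"
  \<comment> \<open>Divided by the root, the last condition says that the level has modulus below
    \<open>\<epsilon>\<close>; in this form it is visibly open in the ambient space.\<close>
  let ?U = "{x::R3 \<times> R3. 0 < fst x $ 3} \<inter> {x. 0 < snd x $ 3} \<inter> {x. \<bar>snd x $ 2\<bar> < \<epsilon> * sqrt (1 + snd x $ 3)}"
  have K: "compact ?K" by (intro compact_Int_closed compact_bidisk closed_Collect_le continuous_intros)
  have cK: "compact (chart ` ?K)" by (rule compact_chart_image[OF r K]) auto
  have sub: "{x \<in> S2_prod. \<psi> x \<noteq> x} \<subseteq> chart ` ?K"
  proof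
    fix x assume x: "x \<in> {x \<in> S2_prod. \<psi> x \<noteq> x}"
    then obtain z where z: "x = chart z" "z \<in> bidisk r" using supp by blast
    then have "\<not> e \<le> \<bar>snd (snd z)\<bar>" using strip[OF z(2)] x by auto
    then show "x \<in> chart ` ?K" using z by auto
  qed
  then have cl: "closure {x \<in> S2_prod. \<psi> x \<noteq> x} \<subseteq> chart ` ?K"
    using cK by (intro closure_minimal compact_imp_closed)
  have "open ?U" by (intro open_Int open_Collect_less continuous_intros)
  then have "openin (top_of_set S2_prod) (S2_prod \<inter> ?U)" by (auto simp: openin_open)
  moreover have "S2_prod \<inter> ?U \<subseteq> hemi_prod D2 (D2_strip \<epsilon>)"
  proof
    fix x assume x: "x \<in> S2_prod \<inter> ?U"
    then have S: "fst x \<in> S2" "snd x \<in> S2" by (auto simp: S2_prod_def)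
    have p: "-1 < fst x $ 3" "-1 < snd x $ 3" using x by auto
    have "(norm (lambert (fst x)))\<^sup>2 \<le> 1" "(norm (lambert (snd x)))\<^sup>2 \<le> 1"
      using norm_lambert[OF S(1) p(1)] norm_lambert[OF S(2) p(2)] x by auto
    then have n: "norm (lambert (fst x)) \<le> 1" "norm (lambert (snd x)) \<le> 1"
      by (auto simp: abs_square_le_1)
    have "\<bar>snd (lambert (snd x))\<bar> = \<bar>snd x $ 2\<bar> / sqrt (1 + snd x $ 3)"
      using p(2) by (simp add: lambert_def)
    also have "\<dots> < \<epsilon>" using x p(2) by (simp add: divide_less_eq)
    finally have "lambert (fst x) \<in> D2" "lambert (snd x) \<in> D2_strip \<epsilon>"
      using n by (auto simp: D2_def D2_strip_def case_prod_unfold abs_less_iff)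
    moreover have "x = (hemi (lambert (fst x)), hemi (lambert (snd x)))"
      using hemi_lambert[OF S(1) p(1)] hemi_lambert[OF S(2) p(2)] by simp
    ultimately show "x \<in> hemi_prod D2 (D2_strip \<epsilon>)" unfolding hemi_prod_def by (metis SigmaI image_eqI)
  qed
  ultimately have "S2_prod \<inter> ?U \<subseteq> (top_of_set S2_prod) interior_of (hemi_prod D2 (D2_strip \<epsilon>))"
    by (intro interior_of_maximal)
  moreover have "chart ` ?K \<subseteq> S2_prod \<inter> ?U"
  proof
    fix x assume "x \<in> chart ` ?K"
    then obtain z where z: "x = chart z" "z \<in> bidisk r" "\<bar>snd (snd z)\<bar> \<le> e" by auto
    have d: "z \<in> chart_dom" using bidisk_subset_chart_dom[OF r] z(2) by blast
    have r2: "r\<^sup>2 < 1" using r by (simp add: abs_square_less_1)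
    have n2: "(norm (fst z))\<^sup>2 \<le> r\<^sup>2" "(norm (snd z))\<^sup>2 \<le> r\<^sup>2"
      using z(2) by (auto simp: bidisk_def intro!: power_mono)
    then have pos: "0 < 2 - (norm (snd z))\<^sup>2" using r2 by simp
    have "\<bar>snd (snd z)\<bar> * sqrt (2 - (norm (snd z))\<^sup>2) < \<epsilon> * sqrt (2 - (norm (snd z))\<^sup>2)"
      using z(3) e pos by (intro mult_strict_right_mono) auto
    then have "x \<in> ?U" using n2 r2 pos
      by (simp add: z(1) chart_def hemi_nth abs_mult)
    then show "x \<in> S2_prod \<inter> ?U" using chart_in_S2_prod[OF d] z(1) by simp
  qed
  ultimately have "closure {x \<in> S2_prod. \<psi> x \<noteq> x} \<subseteq> (top_of_set S2_prod) interior_of (hemi_prod D2 (D2_strip \<epsilon>))"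
    using cl by blast
  moreover have "compact (closure {x \<in> S2_prod. \<psi> x \<noteq> x})"
    unfolding compact_closure by (rule bounded_subset[OF compact_imp_bounded[OF cK] sub])
  ultimately show ?thesis by (simp add: compactly_supported_in_def)
qed

section \<open>Cutting off along both walls of the strip\<close>

theorem lemma3p3:
  fixes a b \<epsilon>\<^sub>1 \<epsilon>\<^sub>2 \<epsilon>\<^sub>3 :: real
    and G :: "R3 \<times> R3 \<Rightarrow> R3 \<times> R3 \<Rightarrow> R3 \<times> R3 \<Rightarrow> real"
  assumes "0 < a" and "0 < b"
    and "0 < \<epsilon>\<^sub>1" and "\<epsilon>\<^sub>1 < \<epsilon>\<^sub>2" and "\<epsilon>\<^sub>2 < \<epsilon>\<^sub>3" and "\<epsilon>\<^sub>3 < 1"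
    and "riemannian_metric G"
  shows "\<exists>\<delta>>0. \<forall>g\<in>Ham a b.
           compactly_supported_in g (hemi_prod D2 D2) \<and> C0_dist G g id < \<delta> \<longrightarrow>
           (\<exists>\<psi>\<in>Ham a b. compactly_supported_in \<psi> (hemi_prod D2 (D2_strip \<epsilon>\<^sub>3)) \<and>
              (\<forall>x\<in>hemi_prod D2 (D2_strip \<epsilon>\<^sub>1). \<psi> x = g x))"
proof -
  \<comment> \<open>\<open>e2\<close> and \<open>e3\<close> divide the interval from
    \<open>\<epsilon>\<^sub>1\<close> to \<open>\<epsilon>\<^sub>3\<close> into thirds. Levels may
    move under \<open>g\<close> by less than \<open>e3 - e2\<close>, and the room between
    \<open>e3\<close> and \<open>\<epsilon>\<^sub>3\<close> keeps the support of the result in the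
    interior of the strip.\<close>
  define e2 where "e2 = \<epsilon>\<^sub>1 + (\<epsilon>\<^sub>3 - \<epsilon>\<^sub>1) / 3"
  define e3 where "e3 = \<epsilon>\<^sub>1 + 2 * (\<epsilon>\<^sub>3 - \<epsilon>\<^sub>1) / 3"
  have e: "0 < \<epsilon>\<^sub>1" "\<epsilon>\<^sub>1 < e2" "e2 < e3" "e3 < \<epsilon>\<^sub>3" "0 < e2" "e2 < 1" "0 < e3"
    using assms by (auto simp: e2_def e3_def field_simps)
  obtain \<eta> where \<eta>: "0 < \<eta>" "\<And>x y. x \<in> S2_prod \<Longrightarrow> y \<in> S2_prod \<Longrightarrow> 0 \<le> snd x $ 3 \<Longrightarrow> 0 \<le> snd y $ 3 \<Longrightarrow>
    norm (x - y) < \<eta> \<Longrightarrow> \<bar>height x - height y\<bar> < e3 - e2"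
    by (rule height_uniformly_continuous[of "e3 - e2"]) (use e in auto)
  obtain \<delta> where \<delta>: "0 < \<delta>"
    "\<And>g x. (\<And>x. x \<in> S2_prod \<Longrightarrow> g x \<in> S2_prod) \<Longrightarrow> C0_dist G g id < \<delta> \<Longrightarrow> x \<in> S2_prod \<Longrightarrow> norm (g x - x) < \<eta>"
    by (rule C0_dist_controls_norm[OF assms(7) \<eta>(1)]) blast
  show ?thesis
  proof (intro exI[of _ \<delta>] conjI \<delta>(1) ballI impI)
    fix g assume g: "g \<in> Ham a b" and "compactly_supported_in g (hemi_prod D2 D2) \<and> C0_dist G g id < \<delta>"
    then have gs: "compactly_supported_in g (hemi_prod D2 D2)" and gd: "C0_dist G g id < \<delta>" by auto
    \<comment> \<open>\<open>r\<close> depends on \<open>g\<close>, whereas \<open>\<delta>\<close>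
      was fixed before \<open>g\<close>: only the gap between the levels has to be uniform, not the
      size of the support.\<close>
    obtain r where r: "e2 \<le> r" "r < 1" "\<And>x. x \<in> S2_prod \<Longrightarrow> x \<notin> chart ` bidisk r \<Longrightarrow> g x = x"
      using support_in_bidisk[OF gs e(5,6)] by blast
    have r0: "0 < r" using r e by linarith
    interpret g: chart_Ham a b r g by unfold_locales (use assms r r0 g in auto)
    let ?y = "\<lambda>z::R4. snd (snd z)"
    have close: "\<bar>?y (in_chart r g z) - ?y z\<bar> < e3 - e2" if z: "z \<in> bidisk r" for z
    proof -
      have zd: "z \<in> chart_dom" "in_chart r g z \<in> chart_dom" using z g.dom g.in_chart_bidisk by blast+
      have up: "0 \<le> snd (chart w) $ 3" if "w \<in> bidisk r" for w
      proof -
        have "(norm (snd w))\<^sup>2 \<le> 1" using that r by (intro power_le_one) (auto simp: bidisk_def)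
        then show ?thesis by (simp add: chart_def hemi_nth)
      qed
      have "\<bar>height (g (chart z)) - height (chart z)\<bar> < e3 - e2"
      proof (rule \<eta>(2))
        show "norm (g (chart z) - chart z) < \<eta>"
          by (rule \<delta>(2)[OF Ham_in_S2_prod[OF g] gd chart_in_S2_prod[OF zd(1)]])
        show "0 \<le> snd (g (chart z)) $ 3"
          using up[OF g.in_chart_bidisk[OF z]] by (simp add: g.chart_in_chart_bidisk[OF z])
      qed (use up[OF z] chart_in_S2_prod[OF zd(1)] Ham_in_S2_prod[OF g] in auto)
      then show ?thesis
        using height_chart[OF zd(1)] height_chart[OF zd(2)] by (simp add: g.chart_in_chart_bidisk[OF z])
    qed
    obtain \<psi>1 where \<psi>1: "chart_Ham a b r \<psi>1"
      "\<And>z. z \<in> bidisk r \<Longrightarrow> 1 * ?y z \<le> \<epsilon>\<^sub>1 \<Longrightarrow> \<psi>1 (chart z) = g (chart z)"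
      "\<And>z. z \<in> bidisk r \<Longrightarrow> e3 \<le> 1 * ?y z \<Longrightarrow> \<psi>1 (chart z) = chart z"
    proof (rule g.cut[of 1 \<epsilon>\<^sub>1 e2 e3])
      show "e2 \<le> 1 * ?y z" if "z \<in> bidisk r" "e3 \<le> 1 * ?y (in_chart r g z)" for z
        using close[OF that(1)] that(2) by linarith
    qed (use e r in auto)
    interpret \<psi>1: chart_Ham a b r \<psi>1 by (rule \<psi>1(1))
    obtain \<psi>2 where \<psi>2: "chart_Ham a b r \<psi>2"
      "\<And>z. z \<in> bidisk r \<Longrightarrow> -1 * ?y z \<le> \<epsilon>\<^sub>1 \<Longrightarrow> \<psi>2 (chart z) = \<psi>1 (chart z)"
      "\<And>z. z \<in> bidisk r \<Longrightarrow> e3 \<le> -1 * ?y z \<Longrightarrow> \<psi>2 (chart z) = chart z"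
    proof (rule \<psi>1.cut[of "-1" \<epsilon>\<^sub>1 e2 e3])
      \<comment> \<open>\<open>\<psi>1\<close> need not be close to the identity, so the condition
        for the second wall is taken over from \<open>g\<close>. The preimage \<open>p\<close> of
        the value \<open>q\<close> under \<open>g\<close> lies at level at most \<open>- e2\<close>,
        where \<open>\<psi>1\<close> still agrees with \<open>g\<close>; by injectivity of
        \<open>\<psi>1\<close> it is \<open>z\<close>.\<close>
      fix z assume z: "z \<in> bidisk r" and low: "e3 \<le> -1 * ?y (in_chart r \<psi>1 z)"
      define q where "q = in_chart r \<psi>1 z"
      have q: "q \<in> bidisk r" unfolding q_def by (rule \<psi>1.in_chart_bidisk[OF z])
      obtain p where p: "in_chart r g p = q" using bij_is_surj[OF g.in_chart_bij] by (metis surjD)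
      have pb: "p \<in> bidisk r" using p q g.in_chart_out[of p] by metis
      have py: "e2 \<le> - ?y p" using close[OF pb] low by (simp add: p q_def)
      have "\<psi>1 (chart p) = g (chart p)" using \<psi>1(2)[OF pb] py e by simp
      also have "\<dots> = chart q" using g.chart_in_chart_bidisk[OF pb] by (simp add: p)
      also have "\<dots> = \<psi>1 (chart z)" unfolding q_def by (rule \<psi>1.chart_in_chart_bidisk[OF z])
      finally have "chart p = chart z"
        by (rule \<psi>1.g_inj[OF chart_in_S2_prod[OF g.dom[OF pb]] chart_in_S2_prod[OF g.dom[OF z]]])
      then have "p = z" by (rule inj_onD[OF inj_on_chart _ g.dom[OF pb] g.dom[OF z]])
      then show "e2 \<le> -1 * ?y z" using py by simp
    qed (use e r in auto)
    interpret \<psi>2: chart_Ham a b r \<psi>2 by (rule \<psi>2(1))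
    have "compactly_supported_in \<psi>2 (hemi_prod D2 (D2_strip \<epsilon>\<^sub>3))"
    proof (rule strip_support[OF r0 r(2), of e3])
      show "\<psi>2 (chart z) = chart z" if z: "z \<in> bidisk r" "e3 \<le> \<bar>?y z\<bar>" for z
      proof (cases "0 \<le> ?y z")
        case True
        then show ?thesis using \<psi>2(2)[OF z(1)] \<psi>1(3)[OF z(1)] z(2) e by simp
      next
        case False
        then show ?thesis using \<psi>2(3)[OF z(1)] z(2) by simp
      qed
    qed (use e assms \<psi>2.supp in auto)
    moreover have "\<forall>x\<in>hemi_prod D2 (D2_strip \<epsilon>\<^sub>1). \<psi>2 x = g x"
    proof
      fix x assume "x \<in> hemi_prod D2 (D2_strip \<epsilon>\<^sub>1)"
      then obtain u v where x: "x = chart (u, v)" and u: "u \<in> D2" and v: "v \<in> D2" "\<bar>snd v\<bar> \<le> \<epsilon>\<^sub>1"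
        by (auto simp: hemi_prod_def D2_strip_def chart_def abs_le_iff)
      show "\<psi>2 x = g x"
      proof (cases "(u, v) \<in> bidisk r")
        case True
        then show ?thesis using \<psi>2(2)[OF True] \<psi>1(2)[OF True] v(2) by (simp add: x abs_le_iff)
      next
        case False
        have "(norm u)\<^sup>2 \<le> 1" "(norm v)\<^sup>2 \<le> 1" using u v by (auto simp: D2_def intro!: power_le_one)
        then have d: "(u, v) \<in> chart_dom" by (simp add: chart_dom_def)
        have "x \<notin> chart ` bidisk r"
          using False d g.dom inj_onD[OF inj_on_chart] unfolding x by blast
        then show ?thesis using r(3) \<psi>2.supp chart_in_S2_prod[OF d] by (simp add: x)
      qed
    qed
    ultimately show "\<exists>\<psi>\<in>Ham a b. compactly_supported_in \<psi> (hemi_prod D2 (D2_strip \<epsilon>\<^sub>3)) \<and>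
        (\<forall>x\<in>hemi_prod D2 (D2_strip \<epsilon>\<^sub>1). \<psi> x = g x)"
      using \<psi>2.g by blast
  qed
qed

end
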